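(* Let $(M,g,J)$ be a Hermitian manifold of real dimension $2m+2$ such that $Hol(\nabla^a)\subset U(m)\times U(1)$, with corresponding splitting $TM=\mathcal{H}\oplus\mathcal{V}$, $$T^a\in\Lambda^{2,0}\mathcal{H}^*\otimes\Lambda^{0,1}\mathcal{V}^*\oplus\Lambda^{0,2}\mathcal{H}^*\otimes\Lambda^{1,0}\mathcal{V}^*,$$ and $T^a$ is non-degenerate. Then $m=2n$ is even, $Hol(\nabla^a)\subset\rho(Sp(n)U(1))$, and $T^a=\lambda T_0+\bar\lambda\overline{T}_0$, where $\lambda\in\mathbb{C}\setminus\{0\}$ is a constant.
   Context: Manifolds are smooth and connected. A Hermitian manifold is $(M,g,J)$ with $J$ an integrable $g$-orthogonal almost complex structure. $\nabla^a$ is the unique connection with $\nabla^a g=0$, $\nabla^a J=0$ whose torsion $T^a$, viewed as $T^a(X,Y,Z)=g(T^a(X,Y),Z)$, is a 3-form; $\nabla^a=\nabla+\frac12T^a$ with $\nabla$ the Levi-Civita connection. $T^a$ is non-degenerate if $T^a(X,\cdot)\ne0$ for every tangent vector $X\neq0$. $Hol(\nabla^a)\subset U(m)\times U(1)\subset U(m+1)$ means that there is a (fixed) $\nabla^a$-parallel, $g$-orthogonal, $J$-invariant splitting $TM=\mathcal{H}\oplus\mathcal{V}$ with real ranks $2m$ and $2$. $\Lambda^{p,q}\mathcal{H}^*$, $\Lambda^{p,q}\mathcal{V}^*$ are the complex $(p,q)$-forms on $\mathcal{H}$, $\mathcal{V}$ with respect to $J$ (extended by zero), and tensor products of them are embedded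 in $\Lambda^3T^*M\otimes\mathbb{C}$ by the wedge product. $Sp(n)U(1)=\{ab: a\in Sp(n),b\in U(1)\}\subset U(2n)$ ($U(1)$ acting by scalars), and $\rho:Sp(n)U(1)\to U(2n)\times U(1)\subset U(2n+1)$ is $\rho(ab)=\begin{pmatrix}ab&0\\0&b^2\end{pmatrix}$. Holonomy inclusions are up to conjugation, i.e. with respect to a suitable unitary frame. On $T=\mathbb{C}^{2n+1}$ with standard unitary basis $e_1,\dots,e_{2n+1}$ of $T^{1,0}$ and dual basis $e^1,\dots,e^{2n+1}$, put $\omega_0=\sum_{k=1}^ne^{2k-1}\wedge e^{2k}$ (so $Sp(n)$ is the stabilizer of $\omega_0$ in $U(2n)$) and $T_0=\omega_0\wedge\bar e^{2n+1}$. $T_0$ is $\rho(Sp(n)U(1))$-invariant, so if $Hol(\nabla^a)\subset\rho(Sp(n)U(1))$ it defines a $\nabla^a$-parallel tensor field on $M$, also denoted $T_0$, where $e_1,\dots,e_{2n}$ span $\mathcal{H}^{1,0}$ and $e_{2n+1}$ spans $\mathcal{V}^{1,0}$. *)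

theory Defs
  imports "HOL-Analysis.Analysis" "Jordan_Normal_Form.Matrix"
begin

section \<open>Smooth manifolds\<close>

text \<open>For open \<open>S\<close>, \<open>Ck_on k S f\<close> says that \<open>f\<close> is of class \<open>C^k\<close> on \<open>S\<close>.\<close>

primrec Ck_on :: "nat \<Rightarrow> 'b::euclidean_space set \<Rightarrow> ('b \<Rightarrow> 'c::real_normed_vector) \<Rightarrow> bool" where
  "Ck_on 0 S f \<longleftrightarrow> continuous_on S f"
| "Ck_on (Suc k) S f \<longleftrightarrow>
     f differentiable_on S \<and> (\<forall>v. Ck_on k S (\<lambda>x. frechet_derivative f (at x) v))"

definition smooth_on :: "'b::euclidean_space set \<Rightarrow> ('b \<Rightarrow> 'c::real_normed_vector) \<Rightarrow> bool" where
  "smooth_on S f \<longleftrightarrow> (\<forall>k. Ck_on k S f)"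

text \<open>A chart is a pair of its domain and its coordinate map; values of the coordinate map
  outside the domain are irrelevant.\<close>

type_synonym ('a, 'e) chart = "'a set \<times> ('a \<Rightarrow> 'e)"

abbreviation cdom :: "('a, 'e) chart \<Rightarrow> 'a set" where "cdom c \<equiv> fst c"
abbreviation cmap :: "('a, 'e) chart \<Rightarrow> 'a \<Rightarrow> 'e" where "cmap c \<equiv> snd c"

definition cimg :: "('a, 'e) chart \<Rightarrow> 'e set" where
  "cimg c = cmap c ` cdom c"

definition cinv :: "('a, 'e) chart \<Rightarrow> 'e \<Rightarrow> 'a" where
  "cinv c = inv_into (cdom c) (cmap c)"

definition overlap :: "('a, 'e) chart \<Rightarrow> ('a, 'e) chart \<Rightarrow> 'e set" where
  "overlap c d = cmap c ` (cdom c \<inter> cdom d)"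

definition transition :: "('a, 'e) chart \<Rightarrow> ('a, 'e) chart \<Rightarrow> 'e \<Rightarrow> 'e" where
  "transition c d = cmap d \<circ> cinv c"

definition jac :: "('a, 'e::euclidean_space) chart \<Rightarrow> ('a, 'e) chart \<Rightarrow> 'e \<Rightarrow> 'e \<Rightarrow> 'e" where
  "jac c d x = frechet_derivative (transition c d) (at x)"

definition smooth_manifold ::
    "('a::{t2_space, second_countable_topology}, 'e::euclidean_space) chart set \<Rightarrow> bool" where
  "smooth_manifold A \<longleftrightarrow>
     connected (UNIV :: 'a set) \<and>
     (\<Union>c\<in>A. cdom c) = UNIV \<and>
     (\<forall>c\<in>A. open (cdom c) \<and> open (cimg c) \<and>
        homeomorphism (cdom c) (cimg c) (cmap c) (cinv c)) \<and>
     (\<forall>c\<in>A. \<forall>d\<in>A. smooth_on (overlap c d) (transition c d))"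


section \<open>Hermitian manifolds\<close>

text \<open>Tensor fields are given by their local representatives: in a chart \<open>c\<close> the tangent
  space at the point with coordinates \<open>x \<in> cimg c\<close> is the model space, and the
  representatives in different charts are related by the Jacobian of the coordinate change.
  Only values at charts \<open>c\<close> of the atlas and at points \<open>x \<in> cimg c\<close> are meaningful.\<close>

type_synonym ('a, 'e) metric = "('a, 'e) chart \<Rightarrow> 'e \<Rightarrow> 'e \<Rightarrow> 'e \<Rightarrow> real"
type_synonym ('a, 'e) endo_field = "('a, 'e) chart \<Rightarrow> 'e \<Rightarrow> 'e \<Rightarrow> 'e"
type_synonym ('a, 'e) christoffel = "('a, 'e) chart \<Rightarrow> 'e \<Rightarrow> 'e \<Rightarrow> 'e \<Rightarrow> 'e"
type_synonym ('a, 'e) tensor3 = "('a, 'e) chart \<Rightarrow> 'e \<Rightarrow> 'e \<Rightarrow> 'e \<Rightarrow> 'e \<Rightarrow> complex"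
type_synonym ('a, 'e) distribution = "('a, 'e) chart \<Rightarrow> 'e \<Rightarrow> 'e set"

definition riemannian_metric ::
    "('a, 'e::euclidean_space) chart set \<Rightarrow> ('a, 'e) metric \<Rightarrow> bool" where
  "riemannian_metric A g \<longleftrightarrow>
     (\<forall>c\<in>A. \<forall>x\<in>cimg c. bilinear (g c x) \<and> (\<forall>u v. g c x u v = g c x v u) \<and>
        (\<forall>u. u \<noteq> 0 \<longrightarrow> g c x u u > 0)) \<and>
     (\<forall>c\<in>A. \<forall>u v. smooth_on (cimg c) (\<lambda>x. g c x u v)) \<and>
     (\<forall>c\<in>A. \<forall>d\<in>A. \<forall>x\<in>overlap c d. \<forall>u v.
        g c x u v = g d (transition c d x) (jac c d x u) (jac c d x v))"

definition almost_complex_structure ::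
    "('a, 'e::euclidean_space) chart set \<Rightarrow> ('a, 'e) endo_field \<Rightarrow> bool" where
  "almost_complex_structure A J \<longleftrightarrow>
     (\<forall>c\<in>A. \<forall>x\<in>cimg c. linear (J c x) \<and> (\<forall>u. J c x (J c x u) = - u)) \<and>
     (\<forall>c\<in>A. \<forall>u. smooth_on (cimg c) (\<lambda>x. J c x u)) \<and>
     (\<forall>c\<in>A. \<forall>d\<in>A. \<forall>x\<in>overlap c d. \<forall>u.
        jac c d x (J c x u) = J d (transition c d x) (jac c d x u))"

definition lie_bracket ::
    "('e::euclidean_space \<Rightarrow> 'e) \<Rightarrow> ('e \<Rightarrow> 'e) \<Rightarrow> 'e \<Rightarrow> 'e" where
  "lie_bracket X Y x = frechet_derivative Y (at x) (X x) - frechet_derivative X (at x) (Y x)"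

definition nijenhuis ::
    "('e::euclidean_space \<Rightarrow> 'e \<Rightarrow> 'e) \<Rightarrow> ('e \<Rightarrow> 'e) \<Rightarrow> ('e \<Rightarrow> 'e) \<Rightarrow> 'e \<Rightarrow> 'e" where
  "nijenhuis j X Y x =
     lie_bracket (\<lambda>y. j y (X y)) (\<lambda>y. j y (Y y)) x
     - j x (lie_bracket (\<lambda>y. j y (X y)) Y x)
     - j x (lie_bracket X (\<lambda>y. j y (Y y)) x)
     - lie_bracket X Y x"

definition integrable_acs ::
    "('a, 'e::euclidean_space) chart set \<Rightarrow> ('a, 'e) endo_field \<Rightarrow> bool" where
  "integrable_acs A J \<longleftrightarrow>
     (\<forall>c\<in>A. \<forall>X Y. smooth_on (cimg c) X \<and> smooth_on (cimg c) Y \<longrightarrow>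
        (\<forall>x\<in>cimg c. nijenhuis (J c) X Y x = 0))"

definition hermitian_manifold ::
    "('a::{t2_space, second_countable_topology}, 'e::euclidean_space) chart set \<Rightarrow>
     ('a, 'e) metric \<Rightarrow> ('a, 'e) endo_field \<Rightarrow> bool" where
  "hermitian_manifold A g J \<longleftrightarrow>
     smooth_manifold A \<and> riemannian_metric A g \<and>
     almost_complex_structure A J \<and> integrable_acs A J \<and>
     (\<forall>c\<in>A. \<forall>x\<in>cimg c. \<forall>u v. g c x (J c x u) (J c x v) = g c x u v)"


section \<open>Connections\<close>

definition cov ::
    "('e::euclidean_space \<Rightarrow> 'e \<Rightarrow> 'e \<Rightarrow> 'e) \<Rightarrow> ('e \<Rightarrow> 'e) \<Rightarrow> ('e \<Rightarrow> 'e) \<Rightarrow> 'e \<Rightarrow> 'e" where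
  "cov \<Gamma>c X Y x = frechet_derivative Y (at x) (X x) + \<Gamma>c x (X x) (Y x)"

text \<open>The last clause is the transformation law of Christoffel symbols; it expresses that the
  local operators \<open>cov (\<Gamma> c)\<close> agree on overlaps.\<close>

definition affine_connection ::
    "('a, 'e::euclidean_space) chart set \<Rightarrow> ('a, 'e) christoffel \<Rightarrow> bool" where
  "affine_connection A \<Gamma> \<longleftrightarrow>
     (\<forall>c\<in>A. \<forall>x\<in>cimg c. bilinear (\<Gamma> c x)) \<and>
     (\<forall>c\<in>A. \<forall>u v. smooth_on (cimg c) (\<lambda>x. \<Gamma> c x u v)) \<and>
     (\<forall>c\<in>A. \<forall>d\<in>A. \<forall>x\<in>overlap c d. \<forall>u v.
        jac c d x (\<Gamma> c x u v) =
          frechet_derivative (\<lambda>y. jac c d y v) (at x) u +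
          \<Gamma> d (transition c d x) (jac c d x u) (jac c d x v))"

text \<open>The torsion is tensorial, so it may be evaluated on coordinate vector fields.\<close>

definition torsion ::
    "('e::euclidean_space \<Rightarrow> 'e \<Rightarrow> 'e \<Rightarrow> 'e) \<Rightarrow> 'e \<Rightarrow> 'e \<Rightarrow> 'e \<Rightarrow> 'e" where
  "torsion \<Gamma>c x u v =
     cov \<Gamma>c (\<lambda>_. u) (\<lambda>_. v) x - cov \<Gamma>c (\<lambda>_. v) (\<lambda>_. u) x - lie_bracket (\<lambda>_. u) (\<lambda>_. v) x"

definition torsion3 ::
    "('a, 'e::euclidean_space) metric \<Rightarrow> ('a, 'e) christoffel \<Rightarrow>
     ('a, 'e) chart \<Rightarrow> 'e \<Rightarrow> 'e \<Rightarrow> 'e \<Rightarrow> 'e \<Rightarrow> real" where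
  "torsion3 g \<Gamma> c x u v w = g c x (torsion (\<Gamma> c) x u v) w"

definition metric_connection ::
    "('a, 'e::euclidean_space) chart set \<Rightarrow> ('a, 'e) metric \<Rightarrow> ('a, 'e) christoffel \<Rightarrow> bool" where
  "metric_connection A g \<Gamma> \<longleftrightarrow>
     (\<forall>c\<in>A. \<forall>X Y Z. smooth_on (cimg c) X \<and> smooth_on (cimg c) Y \<and> smooth_on (cimg c) Z \<longrightarrow>
        (\<forall>x\<in>cimg c. frechet_derivative (\<lambda>y. g c y (Y y) (Z y)) (at x) (X x) =
           g c x (cov (\<Gamma> c) X Y x) (Z x) + g c x (Y x) (cov (\<Gamma> c) X Z x)))"

definition complex_connection ::
    "('a, 'e::euclidean_space) chart set \<Rightarrow> ('a, 'e) endo_field \<Rightarrow> ('a, 'e) christoffel \<Rightarrow> bool" where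
  "complex_connection A J \<Gamma> \<longleftrightarrow>
     (\<forall>c\<in>A. \<forall>X Y. smooth_on (cimg c) X \<and> smooth_on (cimg c) Y \<longrightarrow>
        (\<forall>x\<in>cimg c. cov (\<Gamma> c) X (\<lambda>y. J c y (Y y)) x = J c x (cov (\<Gamma> c) X Y x)))"

text \<open>The characteristic (Bismut) connection \<open>\<nabla>\<^sup>a\<close>.  Since the torsion is
  multilinear, it is a 3-form if and only if it is alternating.\<close>

definition bismut_connection ::
    "('a, 'e::euclidean_space) chart set \<Rightarrow> ('a, 'e) metric \<Rightarrow> ('a, 'e) endo_field \<Rightarrow>
     ('a, 'e) christoffel \<Rightarrow> bool" where
  "bismut_connection A g J \<Gamma> \<longleftrightarrow>
     affine_connection A \<Gamma> \<and> metric_connection A g \<Gamma> \<and> complex_connection A J \<Gamma> \<and>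
     (\<forall>c\<in>A. \<forall>x\<in>cimg c. \<forall>u v w.
        torsion3 g \<Gamma> c x u v w = - torsion3 g \<Gamma> c x v u w \<and>
        torsion3 g \<Gamma> c x u v w = - torsion3 g \<Gamma> c x u w v)"

definition nondegenerate_torsion ::
    "('a, 'e::euclidean_space) chart set \<Rightarrow> ('a, 'e) metric \<Rightarrow> ('a, 'e) christoffel \<Rightarrow> bool" where
  "nondegenerate_torsion A g \<Gamma> \<longleftrightarrow>
     (\<forall>c\<in>A. \<forall>x\<in>cimg c. \<forall>u. u \<noteq> 0 \<longrightarrow> (\<exists>v w. torsion3 g \<Gamma> c x u v w \<noteq> 0))"


section \<open>Parallel splittings\<close>

definition smooth_subbundle ::
    "('a, 'e::euclidean_space) chart set \<Rightarrow> nat \<Rightarrow> ('a, 'e) distribution \<Rightarrow> bool" where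
  "smooth_subbundle A r D \<longleftrightarrow>
     (\<forall>c\<in>A. \<forall>x\<in>cimg c. subspace (D c x) \<and> dim (D c x) = r) \<and>
     (\<forall>c\<in>A. \<forall>x\<in>cimg c. \<exists>S F. open S \<and> x \<in> S \<and> S \<subseteq> cimg c \<and>
        (\<forall>i<r. smooth_on S (F i)) \<and> (\<forall>y\<in>S. D c y = span ((\<lambda>i. F i y) ` {..<r}))) \<and>
     (\<forall>c\<in>A. \<forall>d\<in>A. \<forall>x\<in>overlap c d. jac c d x ` D c x = D d (transition c d x))"

definition parallel_subbundle ::
    "('a, 'e::euclidean_space) chart set \<Rightarrow> ('a, 'e) christoffel \<Rightarrow> ('a, 'e) distribution \<Rightarrow> bool" where
  "parallel_subbundle A \<Gamma> D \<longleftrightarrow>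
     (\<forall>c\<in>A. \<forall>S X Y. open S \<and> S \<subseteq> cimg c \<and> smooth_on S X \<and> smooth_on S Y \<and>
        (\<forall>y\<in>S. Y y \<in> D c y) \<longrightarrow> (\<forall>y\<in>S. cov (\<Gamma> c) X Y y \<in> D c y))"

text \<open>\<open>Hol(\<nabla>\<^sup>a) \<subseteq> U(m) \<times> U(1)\<close>, with splitting \<open>TM = H \<oplus> V\<close>.\<close>

definition parallel_splitting ::
    "('a, 'e::euclidean_space) chart set \<Rightarrow> ('a, 'e) metric \<Rightarrow> ('a, 'e) endo_field \<Rightarrow>
     ('a, 'e) christoffel \<Rightarrow> nat \<Rightarrow> ('a, 'e) distribution \<Rightarrow> ('a, 'e) distribution \<Rightarrow> bool" where
  "parallel_splitting A g J \<Gamma> m H V \<longleftrightarrow>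
     smooth_subbundle A (2 * m) H \<and> smooth_subbundle A 2 V \<and>
     parallel_subbundle A \<Gamma> H \<and> parallel_subbundle A \<Gamma> V \<and>
     (\<forall>c\<in>A. \<forall>x\<in>cimg c.
        (\<forall>w. \<exists>u\<in>H c x. \<exists>v\<in>V c x. w = u + v) \<and> H c x \<inter> V c x = {0} \<and>
        (\<forall>u\<in>H c x. \<forall>v\<in>V c x. g c x u v = 0) \<and>
        J c x ` H c x \<subseteq> H c x \<and> J c x ` V c x \<subseteq> V c x)"


section \<open>Complex forms and their types\<close>

text \<open>Complex-valued 1- and 2-forms on one summand of the splitting, extended by zero, i.e.
  vanishing on the other summand \<open>K\<close>.  For \<open>s = \<i>\<close> they have type \<open>(1,0)\<close> and \<open>(2,0)\<close>, for
  \<open>s = - \<i>\<close> they have type \<open>(0,1)\<close> and \<open>(0,2)\<close>.\<close>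

definition forms1 :: "complex \<Rightarrow> ('e::euclidean_space \<Rightarrow> 'e) \<Rightarrow> 'e set \<Rightarrow> ('e \<Rightarrow> complex) set" where
  "forms1 s j K = {\<alpha>. linear \<alpha> \<and> (\<forall>u. \<alpha> (j u) = s * \<alpha> u) \<and> (\<forall>u\<in>K. \<alpha> u = 0)}"

definition forms2 ::
    "complex \<Rightarrow> ('e::euclidean_space \<Rightarrow> 'e) \<Rightarrow> 'e set \<Rightarrow> ('e \<Rightarrow> 'e \<Rightarrow> complex) set" where
  "forms2 s j K = {\<beta>. bilinear \<beta> \<and> (\<forall>u v. \<beta> u v = - \<beta> v u) \<and>
     (\<forall>u v. \<beta> (j u) v = s * \<beta> u v) \<and> (\<forall>u\<in>K. \<forall>v. \<beta> u v = 0)}"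

definition wedge21 :: "('b \<Rightarrow> 'b \<Rightarrow> complex) \<Rightarrow> ('b \<Rightarrow> complex) \<Rightarrow> 'b \<Rightarrow> 'b \<Rightarrow> 'b \<Rightarrow> complex" where
  "wedge21 \<beta> \<alpha> u v w = \<beta> u v * \<alpha> w + \<beta> v w * \<alpha> u + \<beta> w u * \<alpha> v"

text \<open>The image of the tensor product of \<open>B\<close> and \<open>F\<close> in the 3-forms.\<close>

definition tensor21 ::
    "('b \<Rightarrow> 'b \<Rightarrow> complex) set \<Rightarrow> ('b \<Rightarrow> complex) set \<Rightarrow> ('b \<Rightarrow> 'b \<Rightarrow> 'b \<Rightarrow> complex) set" where
  "tensor21 B F = {\<lambda>u v w. \<Sum>i<k. wedge21 (\<beta> i) (\<alpha> i) u v w | (k::nat) \<beta> \<alpha>.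
     \<forall>i<k. \<beta> i \<in> B \<and> \<alpha> i \<in> F}"

definition torsion_type ::
    "('a, 'e::euclidean_space) chart set \<Rightarrow> ('a, 'e) metric \<Rightarrow> ('a, 'e) endo_field \<Rightarrow>
     ('a, 'e) christoffel \<Rightarrow> ('a, 'e) distribution \<Rightarrow> ('a, 'e) distribution \<Rightarrow> bool" where
  "torsion_type A g J \<Gamma> H V \<longleftrightarrow>
     (\<forall>c\<in>A. \<forall>x\<in>cimg c.
        \<exists>\<sigma> \<in> tensor21 (forms2 \<i> (J c x) (V c x)) (forms1 (- \<i>) (J c x) (H c x)).
        \<exists>\<tau> \<in> tensor21 (forms2 (- \<i>) (J c x) (V c x)) (forms1 \<i> (J c x) (H c x)).
        \<forall>u v w. complex_of_real (torsion3 g \<Gamma> c x u v w) = \<sigma> u v w + \<tau> u v w)"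


section \<open>Holonomy\<close>

text \<open>Smooth curves are parametrised by the whole real line; only their restriction to
  \<open>{0..1}\<close> is used, and every smooth curve on \<open>{0..1}\<close> arises in this way.\<close>

definition smooth_curve :: "('a::topological_space, 'e::euclidean_space) chart set \<Rightarrow> (real \<Rightarrow> 'a) \<Rightarrow> bool" where
  "smooth_curve A \<gamma> \<longleftrightarrow>
     continuous_on UNIV \<gamma> \<and> (\<forall>c\<in>A. smooth_on (\<gamma> -` cdom c) (cmap c \<circ> \<gamma>))"

text \<open>\<open>W c t\<close> represents, in the chart \<open>c\<close>, a vector field along \<open>\<gamma>\<close>.\<close>

definition parallel_along ::
    "('a, 'e::euclidean_space) chart set \<Rightarrow> ('a, 'e) christoffel \<Rightarrow> (real \<Rightarrow> 'a) \<Rightarrow>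
     (('a, 'e) chart \<Rightarrow> real \<Rightarrow> 'e) \<Rightarrow> bool" where
  "parallel_along A \<Gamma> \<gamma> W \<longleftrightarrow>
     (\<forall>c\<in>A. \<forall>t. \<gamma> t \<in> cdom c \<longrightarrow>
        (W c has_vector_derivative
           - \<Gamma> c (cmap c (\<gamma> t)) (vector_derivative (cmap c \<circ> \<gamma>) (at t)) (W c t)) (at t)) \<and>
     (\<forall>c\<in>A. \<forall>d\<in>A. \<forall>t. \<gamma> t \<in> cdom c \<inter> cdom d \<longrightarrow>
        W d t = jac c d (cmap c (\<gamma> t)) (W c t))"

text \<open>\<open>parallel_transport A \<Gamma> p c q d P\<close>: with respect to the charts \<open>c\<close> at \<open>p\<close> and \<open>d\<close> at \<open>q\<close>,
  \<open>P\<close> is the parallel transport along some piecewise smooth path from \<open>p\<close> to \<open>q\<close>.\<close>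

inductive parallel_transport ::
    "('a::topological_space, 'e::euclidean_space) chart set \<Rightarrow> ('a, 'e) christoffel \<Rightarrow>
     'a \<Rightarrow> ('a, 'e) chart \<Rightarrow> 'a \<Rightarrow> ('a, 'e) chart \<Rightarrow> ('e \<Rightarrow> 'e) \<Rightarrow> bool"
  for A \<Gamma> where
  segment: "\<lbrakk>smooth_curve A \<gamma>; c \<in> A; d \<in> A; \<gamma> 0 \<in> cdom c; \<gamma> 1 \<in> cdom d;
     \<forall>u. \<exists>W. parallel_along A \<Gamma> \<gamma> W \<and> W c 0 = u \<and> W d 1 = P u\<rbrakk>
     \<Longrightarrow> parallel_transport A \<Gamma> (\<gamma> 0) c (\<gamma> 1) d P"
| concat: "\<lbrakk>parallel_transport A \<Gamma> p c q d P; parallel_transport A \<Gamma> q d r e Q\<rbrakk>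
     \<Longrightarrow> parallel_transport A \<Gamma> p c r e (Q \<circ> P)"

definition holonomy_group ::
    "('a::topological_space, 'e::euclidean_space) chart set \<Rightarrow> ('a, 'e) christoffel \<Rightarrow>
     'a \<Rightarrow> ('a, 'e) chart \<Rightarrow> ('e \<Rightarrow> 'e) set" where
  "holonomy_group A \<Gamma> p c = {P. parallel_transport A \<Gamma> p c p c P}"


section \<open>The group and the model torsion\<close>

text \<open>Indices are shifted by one: the basis is \<open>e\<^sub>0, \<dots>, e\<^sub>2\<^sub>n\<close>, where the first \<open>2n\<close> vectors
  belong to the horizontal part.  \<open>omega0 n\<close> is used both on \<open>\<complex>\<^sup>2\<^sup>n\<close> and on \<open>\<complex>\<^sup>2\<^sup>n\<^sup>+\<^sup>1\<close>.\<close>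

definition omega0 :: "nat \<Rightarrow> complex Matrix.vec \<Rightarrow> complex Matrix.vec \<Rightarrow> complex" where
  "omega0 n z w = (\<Sum>k<n. vec_index z (2 * k) * vec_index w (2 * k + 1)
                        - vec_index z (2 * k + 1) * vec_index w (2 * k))"

definition T0 :: "nat \<Rightarrow> complex Matrix.vec \<Rightarrow> complex Matrix.vec \<Rightarrow> complex Matrix.vec \<Rightarrow> complex" where
  "T0 n = wedge21 (omega0 n) (\<lambda>z. cnj (vec_index z (2 * n)))"

definition unitary_group :: "nat \<Rightarrow> complex mat set" where
  "unitary_group N = {a \<in> carrier_mat N N. map_mat cnj (transpose_mat a) * a = 1\<^sub>m N}"

definition Sp_group :: "nat \<Rightarrow> complex mat set" where
  "Sp_group n = {a \<in> unitary_group (2 * n).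
     \<forall>z \<in> carrier_vec (2 * n). \<forall>w \<in> carrier_vec (2 * n).
       omega0 n (a *\<^sub>v z) (a *\<^sub>v w) = omega0 n z w}"

definition rho_SpU1 :: "nat \<Rightarrow> complex mat set" where
  "rho_SpU1 n = {four_block_mat (b \<cdot>\<^sub>m a) (0\<^sub>m (2 * n) 1) (0\<^sub>m 1 (2 * n)) (b\<^sup>2 \<cdot>\<^sub>m 1\<^sub>m 1) | a b.
     a \<in> Sp_group n \<and> cmod b = 1}"

text \<open>A unitary frame of \<open>T\<^sup>1\<^sup>,\<^sup>0\<close> is represented by the real vectors corresponding to its members
  under the complex-linear isomorphism \<open>X \<mapsto> (X - \<i> JX)/2\<close> from \<open>(T, J)\<close> to \<open>T\<^sup>1\<^sup>,\<^sup>0\<close>.\<close>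

definition unitary_frame ::
    "('e::euclidean_space \<Rightarrow> 'e \<Rightarrow> real) \<Rightarrow> ('e \<Rightarrow> 'e) \<Rightarrow> nat \<Rightarrow> (nat \<Rightarrow> 'e) \<Rightarrow> bool" where
  "unitary_frame h j N E \<longleftrightarrow> DIM('e) = 2 * N \<and>
     (\<forall>k<N. \<forall>l<N. h (E k) (E l) = (if k = l then 1 else 0) \<and> h (E k) (j (E l)) = 0)"

text \<open>The complex coordinates \<open>a\<^sub>k + \<i> b\<^sub>k\<close> of \<open>u = \<Sum>\<^sub>k a\<^sub>k E\<^sub>k + b\<^sub>k j E\<^sub>k\<close>, i.e. the values on
  \<open>u\<close> of the dual \<open>(1,0)\<close>-coframe.\<close>

definition frame_coords ::
    "('e \<Rightarrow> 'e \<Rightarrow> real) \<Rightarrow> ('e \<Rightarrow> 'e) \<Rightarrow> nat \<Rightarrow> (nat \<Rightarrow> 'e) \<Rightarrow> 'e \<Rightarrow> complex Matrix.vec" where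
  "frame_coords h j N E u = Matrix.vec N (\<lambda>k. Complex (h u (E k)) (h u (j (E k))))"

definition acts_via ::
    "('e \<Rightarrow> 'e \<Rightarrow> real) \<Rightarrow> ('e \<Rightarrow> 'e) \<Rightarrow> nat \<Rightarrow> (nat \<Rightarrow> 'e) \<Rightarrow> complex mat set \<Rightarrow> ('e \<Rightarrow> 'e) \<Rightarrow> bool" where
  "acts_via h j N E G P \<longleftrightarrow>
     (\<exists>B\<in>G. \<forall>u. frame_coords h j N E (P u) = B *\<^sub>v frame_coords h j N E u)"


section \<open>Parallel complex tensor fields\<close>

definition complex_tensor3 ::
    "('a, 'e::euclidean_space) chart set \<Rightarrow> ('a, 'e) tensor3 \<Rightarrow> bool" where
  "complex_tensor3 A S \<longleftrightarrow>
     (\<forall>c\<in>A. \<forall>x\<in>cimg c. \<forall>u v. linear (\<lambda>w. S c x w u v) \<and> linear (\<lambda>w. S c x u w v) \<and>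
        linear (\<lambda>w. S c x u v w)) \<and>
     (\<forall>c\<in>A. \<forall>u v w. smooth_on (cimg c) (\<lambda>x. S c x u v w)) \<and>
     (\<forall>c\<in>A. \<forall>d\<in>A. \<forall>x\<in>overlap c d. \<forall>u v w.
        S c x u v w = S d (transition c d x) (jac c d x u) (jac c d x v) (jac c d x w))"

definition parallel_tensor3 ::
    "('a, 'e::euclidean_space) chart set \<Rightarrow> ('a, 'e) christoffel \<Rightarrow> ('a, 'e) tensor3 \<Rightarrow> bool" where
  "parallel_tensor3 A \<Gamma> S \<longleftrightarrow> complex_tensor3 A S \<and>
     (\<forall>c\<in>A. \<forall>W X Y Z. smooth_on (cimg c) W \<and> smooth_on (cimg c) X \<and>
        smooth_on (cimg c) Y \<and> smooth_on (cimg c) Z \<longrightarrow>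
        (\<forall>x\<in>cimg c. frechet_derivative (\<lambda>y. S c y (X y) (Y y) (Z y)) (at x) (W x) =
           S c x (cov (\<Gamma> c) W X x) (Y x) (Z x) +
           S c x (X x) (cov (\<Gamma> c) W Y x) (Z x) +
           S c x (X x) (Y x) (cov (\<Gamma> c) W Z x)))"

text \<open>\<open>Hol(\<nabla>\<^sup>a) \<subseteq> \<rho>(Sp(n)U(1))\<close>, and \<open>S\<close> is the parallel tensor field defined by \<open>T0 n\<close>: at
  every point there is a unitary frame, adapted to the splitting, with respect to which both
  the holonomy group consists of elements of \<open>\<rho>(Sp(n)U(1))\<close> and \<open>S\<close> is given by \<open>T0 n\<close>.\<close>

definition holonomy_reduction ::
    "('a::topological_space, 'e::euclidean_space) chart set \<Rightarrow> ('a, 'e) metric \<Rightarrow>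
     ('a, 'e) endo_field \<Rightarrow> ('a, 'e) christoffel \<Rightarrow> ('a, 'e) distribution \<Rightarrow>
     ('a, 'e) distribution \<Rightarrow> nat \<Rightarrow> ('a, 'e) tensor3 \<Rightarrow> bool" where
  "holonomy_reduction A g J \<Gamma> H V n S \<longleftrightarrow>
     parallel_tensor3 A \<Gamma> S \<and>
     (\<forall>p. \<forall>c\<in>A. p \<in> cdom c \<longrightarrow>
        (let x = cmap c p; N = 2 * n + 1 in
         \<exists>E. unitary_frame (g c x) (J c x) N E \<and>
           (\<forall>k<2 * n. E k \<in> H c x) \<and> E (2 * n) \<in> V c x \<and>
           (\<forall>P \<in> holonomy_group A \<Gamma> p c. acts_via (g c x) (J c x) N E (rho_SpU1 n) P) \<and>
           (\<forall>u v w. S c x u v w =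
              T0 n (frame_coords (g c x) (J c x) N E u) (frame_coords (g c x) (J c x) N E v)
                (frame_coords (g c x) (J c x) N E w))))"

end

theory Submission
  imports Defs
begin

text \<open>Put \<open>N = \<nabla>\<^sup>aT\<close> and let \<open>R\<close> be the curvature of \<open>\<nabla>\<^sup>a\<close>, which commutes with \<open>J\<close> and preserves \<open>g\<close>,
  \<open>H\<close> and \<open>V\<close>; \<open>N\<close> has the same type as \<open>T\<close>.  Comparing types in the first Bianchi identity, and
  using that \<open>V\<close> is a complex line, one obtains \<open>N = 0\<close>.  For \<open>x\<close> in \<open>V\<close> let \<open>\<phi> = T(x, \<cdot>)\<close>, a skew
  endomorphism of \<open>H\<close> anticommuting with \<open>J\<close>.  The Bianchi identity now reads \<open>R(Jx, x) = -2J\<phi>\<^sup>2\<close> on \<open>H\<close>,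
  and \<open>R(Jx, x)\<close> annihilates the parallel tensor \<open>T\<close>; with \<open>\<phi>\<close> injective this makes \<open>\<phi>\<^sup>2\<close> a negative
  multiple of the identity, namely \<open>-\<mu>|x|\<^sup>2\<close> with a locally constant, hence constant, \<open>\<mu>\<close>.  So \<open>J\<close> and
  \<open>\<phi>/\<surd>\<mu>\<close> (for \<open>|x| = 1\<close>) generate a quaternionic structure on \<open>H\<close>, in whose adapted frames \<open>T\<close> is
  \<open>\<surd>\<mu>\<close> times the real part of \<open>T\<^sub>0\<close>, that is \<open>\<lambda> = \<surd>\<mu>/2\<close>.  Parallel transport preserves \<open>g\<close>, \<open>J\<close> and \<open>T\<close>,
  and the common stabilizer is \<open>\<rho>(Sp(n)U(1))\<close>.\<close>

section \<open>Calculus of smooth maps\<close>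

text \<open>The Bianchi identity is used twice. For \<nabla>T = 0 with a direction x in V, it writes
  N(x, a, b, w) as a curvature term minus a quadratic torsion term, both skew in x and w; together
  with the type condition this leaves nothing on the complex line V. For directions in H the cyclic
  sum of N vanishes, so the type condition also governs the direction slot. Replacing two arguments
  by their J-images flips the sign of the N side, while the curvature terms cancel in combination; N
  becomes symmetric in the direction and the next slot, hence zero. The second use has Jx and x
  among its arguments and brings in \<phi> twice.

  No smooth adapted frame is constructed. Frames are chosen independently at each point, while the
  parallel tensor \<open>S\<close> is written globally in terms of T and J, and the frames only
  certify its pointwise shape. Constancy of the scalar \<mu> likewise needs only local sections of H
  and V. The real condition \<open>mixed_form\<close> replaces the complex types because it can be
  differentiated along such sections and is determined on H x H x V.\<close>

lemma frechet_derivative_cong: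
  assumes "open S" "x \<in> S" "\<And>y. y \<in> S \<Longrightarrow> f y = g y"
  shows "frechet_derivative f (at x) = frechet_derivative g (at x)"
proof -
  have "(f has_derivative D) (at x) \<longleftrightarrow> (g has_derivative D) (at x)" for D
    using has_derivative_transform_within_open[OF _ assms(1,2), of f D UNIV g]
      has_derivative_transform_within_open[OF _ assms(1,2), of g D UNIV f] assms(3) by auto
  then show ?thesis by (simp add: frechet_derivative_def)
qed

text \<open>The derivatives inside \<open>Ck_on\<close> are taken in the whole space, so agreement
  on \<open>S\<close> determines them only because \<open>S\<close> is open; hence the openness
  assumption in most of the smoothness lemmas.\<close>

lemma Ck_on_cong:
  assumes "open S" "\<And>x. x \<in> S \<Longrightarrow> f x = g x" "Ck_on k S f"
  shows "Ck_on k S g"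
  using assms(2,3)
proof (induction k arbitrary: f g)
  case 0
  then show ?case by (simp cong: continuous_on_cong)
next
  case (Suc k)
  have eq: "frechet_derivative f (at x) = frechet_derivative g (at x)" if "x \<in> S" for x
    by (rule frechet_derivative_cong[OF assms(1) that Suc.prems(1)])
  have "g differentiable_on S"
    unfolding differentiable_on_def
    using Suc.prems by (auto intro!: differentiable_transform_within[of f _ S 1 g] simp: differentiable_on_def)
  moreover have "Ck_on k S (\<lambda>x. frechet_derivative g (at x) v)" for v
    by (rule Suc.IH[of "\<lambda>x. frechet_derivative f (at x) v"]) (use Suc.prems eq in auto)
  ultimately show ?case by simp
qed

lemma Ck_on_subset: "Ck_on k S f \<Longrightarrow> T \<subseteq> S \<Longrightarrow> Ck_on k T f"
  by (induction k arbitrary: f) (auto intro: continuous_on_subset differentiable_on_subset)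

lemma Ck_on_Suc: "Ck_on (Suc k) S f \<Longrightarrow> Ck_on k S f"
  by (induction k arbitrary: f) (auto intro: differentiable_imp_continuous_on)

lemma Ck_on_const: "Ck_on k S (\<lambda>x. c)"
  by (induction k arbitrary: c) auto

lemma differentiable_on_has_derivative:
  assumes "open S" "x \<in> S" "f differentiable_on S"
  shows "(f has_derivative frechet_derivative f (at x)) (at x)"
  using assms by (metis differentiable_on_eq_differentiable_at frechet_derivative_works)

lemma Ck_on_add:
  assumes "open S" "Ck_on k S f" "Ck_on k S g"
  shows "Ck_on k S (\<lambda>x. f x + g x)"
  using assms(2,3)
proof (induction k arbitrary: f g)
  case 0
  then show ?case by (simp add: continuous_on_add)
next
  case (Suc k)
  have d: "((\<lambda>x. f x + g x) has_derivative
     (\<lambda>v. frechet_derivative f (at x) v + frechet_derivative g (at x) v)) (at x)" if "x \<in> S" for x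
    using Suc.prems by (auto intro!: has_derivative_add differentiable_on_has_derivative[OF assms(1) that])
  have "Ck_on k S (\<lambda>x. frechet_derivative (\<lambda>x. f x + g x) (at x) v)" for v
    by (rule Ck_on_cong[OF assms(1), of "\<lambda>x. frechet_derivative f (at x) v + frechet_derivative g (at x) v"])
      (use Suc frechet_derivative_at[OF d] in \<open>auto simp: fun_eq_iff\<close>)
  then show ?case
    using Suc.prems by (auto intro: derivative_intros simp: differentiable_on_def)
qed

text \<open>By the product rule the derivative is a sum of two products of the same kind;
  \<open>Ck_on_Suc\<close> lowers the class of the undifferentiated factor so that the induction
  hypothesis applies.\<close>

lemma (in bounded_bilinear) Ck_on:
  assumes "open S" "Ck_on k S f" "Ck_on k S g"
  shows "Ck_on k S (\<lambda>x. prod (f x) (g x))"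
  using assms(2,3)
proof (induction k arbitrary: f g)
  case 0
  then show ?case by (simp add: continuous_on)
next
  case (Suc k)
  have d: "((\<lambda>x. prod (f x) (g x)) has_derivative
     (\<lambda>v. prod (f x) (frechet_derivative g (at x) v) + prod (frechet_derivative f (at x) v) (g x))) (at x)"
    if "x \<in> S" for x
    using Suc.prems by (auto intro!: FDERIV differentiable_on_has_derivative[OF assms(1) that])
  have "Ck_on k S (\<lambda>x. frechet_derivative (\<lambda>x. prod (f x) (g x)) (at x) v)" for v
    by (rule Ck_on_cong[OF assms(1), of "\<lambda>x. prod (f x) (frechet_derivative g (at x) v)
          + prod (frechet_derivative f (at x) v) (g x)"])
      (use Suc Suc.prems[THEN Ck_on_Suc] frechet_derivative_at[OF d] in
        \<open>auto simp: fun_eq_iff intro!: Ck_on_add[OF assms(1)]\<close>)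
  moreover have "(\<lambda>x. prod (f x) (g x)) differentiable_on S"
    using d by (meson assms(1) differentiable_def differentiable_on_eq_differentiable_at)
  ultimately show ?case by simp
qed

lemma smooth_on_cong:
  "open S \<Longrightarrow> (\<And>x. x \<in> S \<Longrightarrow> f x = g x) \<Longrightarrow> smooth_on S f \<Longrightarrow> smooth_on S g"
  unfolding smooth_on_def using Ck_on_cong by blast

lemma smooth_on_subset: "smooth_on S f \<Longrightarrow> T \<subseteq> S \<Longrightarrow> smooth_on T f"
  unfolding smooth_on_def using Ck_on_subset by blast

lemma smooth_on_const: "smooth_on S (\<lambda>x. c)"
  unfolding smooth_on_def using Ck_on_const by blast

lemma smooth_on_add: "open S \<Longrightarrow> smooth_on S f \<Longrightarrow> smooth_on S g \<Longrightarrow> smooth_on S (\<lambda>x. f x + g x)"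
  unfolding smooth_on_def using Ck_on_add by blast

lemma (in bounded_bilinear) smooth_on:
  "open S \<Longrightarrow> smooth_on S f \<Longrightarrow> smooth_on S g \<Longrightarrow> smooth_on S (\<lambda>x. prod (f x) (g x))"
  unfolding smooth_on_def using Ck_on by blast

lemmas smooth_on_scaleR = bounded_bilinear.smooth_on[OF bounded_bilinear_scaleR]
lemmas smooth_on_mult = bounded_bilinear.smooth_on[OF bounded_bilinear_mult]
lemmas smooth_on_inner = bounded_bilinear.smooth_on[OF bounded_bilinear_inner]

lemma smooth_on_of_real:
  fixes f :: "'b::euclidean_space \<Rightarrow> real"
  assumes "open S" "smooth_on S f"
  shows "smooth_on S (\<lambda>x. complex_of_real (f x))"
  using smooth_on_scaleR[OF assms smooth_on_const[of S "1::complex"]]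
  by (simp add: scaleR_conv_of_real)

lemma smooth_on_uminus: "open S \<Longrightarrow> smooth_on S f \<Longrightarrow> smooth_on S (\<lambda>x. - f x)"
  using smooth_on_scaleR[OF _ smooth_on_const[of S "-1::real"], of f] by simp

lemma smooth_on_diff:
  "open S \<Longrightarrow> smooth_on S f \<Longrightarrow> smooth_on S g \<Longrightarrow> smooth_on S (\<lambda>x. f x - g x)"
  using smooth_on_add[OF _ _ smooth_on_uminus, of S f g] by simp

lemma smooth_on_sum:
  assumes "open S" "\<And>i. i \<in> I \<Longrightarrow> smooth_on S (f i)"
  shows "smooth_on S (\<lambda>x. \<Sum>i\<in>I. f i x)"
  using assms(2)
  by (induction I rule: infinite_finite_induct) (auto intro: smooth_on_const smooth_on_add[OF assms(1)])

lemma smooth_on_deriv: "smooth_on S f \<Longrightarrow> smooth_on S (\<lambda>x. frechet_derivative f (at x) v)"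
  unfolding smooth_on_def by (metis Ck_on.simps(2))

lemma smooth_on_has_derivative:
  assumes "open S" "x \<in> S" "smooth_on S f"
  shows "(f has_derivative frechet_derivative f (at x)) (at x)"
  using assms differentiable_on_has_derivative unfolding smooth_on_def by (metis Ck_on.simps(2))

lemma smooth_on_continuous_on: "smooth_on S f \<Longrightarrow> continuous_on S f"
  unfolding smooth_on_def by (metis Ck_on.simps(1))

lemma linear_basis_sum:
  fixes u :: "'b::euclidean_space"
  assumes "linear G"
  shows "G u = (\<Sum>e\<in>Basis. inner u e *\<^sub>R G e)"
proof -
  have "G u = G (\<Sum>e\<in>Basis. inner u e *\<^sub>R e)" by (simp add: euclidean_representation)
  also have "\<dots> = (\<Sum>e\<in>Basis. inner u e *\<^sub>R G e)"
    using assms by (simp add: linear_sum linear_cmul)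
  finally show ?thesis .
qed

text \<open>Tensor fields are given as smooth only on constant arguments. Expanding the moving
  argument in the standard basis leaves a finite sum of products of smooth functions.\<close>

lemma smooth_on_linear_apply:
  fixes u :: "'b::euclidean_space \<Rightarrow> 'd::euclidean_space"
  assumes "open S" "\<And>x. x \<in> S \<Longrightarrow> linear (G x)" "\<And>e. smooth_on S (\<lambda>x. G x e)" "smooth_on S u"
  shows "smooth_on S (\<lambda>x. G x (u x))"
proof (rule smooth_on_cong[OF assms(1)])
  show "smooth_on S (\<lambda>x. \<Sum>e\<in>Basis. inner (u x) e *\<^sub>R G x e)"
    by (intro smooth_on_sum smooth_on_scaleR smooth_on_inner smooth_on_const assms)
  show "(\<Sum>e\<in>Basis. inner (u x) e *\<^sub>R G x e) = G x (u x)" if "x \<in> S" for x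
    by (rule linear_basis_sum[OF assms(2)[OF that], symmetric])
qed

text \<open>The product rule for a varying linear map applied to a moving vector. The parameter
  space is general because it serves both for points of a chart and for the time along a
  curve.\<close>

lemma has_derivative_linear_apply:
  fixes u :: "'z::real_normed_vector \<Rightarrow> 'd::euclidean_space"
    and G :: "'z \<Rightarrow> 'd \<Rightarrow> 'c::real_normed_vector"
  assumes "open S" "t \<in> S" "\<And>s. s \<in> S \<Longrightarrow> linear (G s)"
    and G: "\<And>e. ((\<lambda>s. G s e) has_derivative G' e) (at t)"
    and u: "(u has_derivative u') (at t)"
  shows "((\<lambda>s. G s (u s)) has_derivative (\<lambda>h. G' (u t) h + G t (u' h))) (at t)"
proof -
  \<comment> \<open>The derivatives \<open>G' e\<close> are given one argument at a time; uniqueness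
    of derivatives makes them linear in \<open>e\<close>.\<close>
  have lin: "linear (\<lambda>e. G' e h)" for h
  proof (rule linearI)
    show "G' (a + b) h = G' a h + G' b h" for a b
    proof -
      have "((\<lambda>s. G s a + G s b) has_derivative G' (a + b)) (at t)"
        by (rule has_derivative_transform_within_open[OF G assms(1,2)]) (simp add: linear_add assms(3))
      from has_derivative_unique[OF this has_derivative_add[OF G G]] show ?thesis by metis
    qed
    show "G' (r *\<^sub>R a) h = r *\<^sub>R G' a h" for r a
    proof -
      have "((\<lambda>s. r *\<^sub>R G s a) has_derivative G' (r *\<^sub>R a)) (at t)"
        by (rule has_derivative_transform_within_open[OF G assms(1,2)]) (simp add: linear_cmul assms(3))
      from has_derivative_unique[OF this has_derivative_scaleR_right[OF G]] show ?thesis by metis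
    qed
  qed
  have "((\<lambda>s. \<Sum>e\<in>Basis. inner (u s) e *\<^sub>R G s e) has_derivative
     (\<lambda>h. \<Sum>e\<in>Basis. inner (u t) e *\<^sub>R G' e h + inner (u' h) e *\<^sub>R G t e)) (at t)"
    by (intro has_derivative_sum has_derivative_scaleR has_derivative_inner_left u G)
  moreover have "(\<Sum>e\<in>Basis. inner (u t) e *\<^sub>R G' e h + inner (u' h) e *\<^sub>R G t e)
      = G' (u t) h + G t (u' h)" for h
    unfolding sum.distrib linear_basis_sum[OF lin, of "u t" h]
      linear_basis_sum[OF assms(3)[OF assms(2)], of "u' h"] ..
  ultimately have "((\<lambda>s. \<Sum>e\<in>Basis. inner (u s) e *\<^sub>R G s e) has_derivative
     (\<lambda>h. G' (u t) h + G t (u' h))) (at t)" by simp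
  then show ?thesis
    by (rule has_derivative_transform_within_open[OF _ assms(1,2)])
      (metis assms(3) linear_basis_sum)
qed

lemma frechet_derivative_add:
  assumes "open S" "x \<in> S" "smooth_on S f" "smooth_on S g"
  shows "frechet_derivative (\<lambda>y. f y + g y) (at x) k
    = frechet_derivative f (at x) k + frechet_derivative g (at x) k"
  using frechet_derivative_at[OF has_derivative_add[OF smooth_on_has_derivative[OF assms(1,2,3)]
    smooth_on_has_derivative[OF assms(1,2,4)]]] by metis

lemma frechet_derivative_uminus:
  assumes "open S" "x \<in> S" "smooth_on S f"
  shows "frechet_derivative (\<lambda>y. - f y) (at x) k = - frechet_derivative f (at x) k"
  using frechet_derivative_at[OF has_derivative_minus[OF smooth_on_has_derivative[OF assms]]] by metis

lemma frechet_derivative_diff: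
  assumes "open S" "x \<in> S" "smooth_on S f" "smooth_on S g"
  shows "frechet_derivative (\<lambda>y. f y - g y) (at x) k
    = frechet_derivative f (at x) k - frechet_derivative g (at x) k"
  using frechet_derivative_at[OF has_derivative_diff[OF smooth_on_has_derivative[OF assms(1,2,3)]
    smooth_on_has_derivative[OF assms(1,2,4)]]] by metis

lemma frechet_derivative_linear_apply:
  fixes F :: "'b::euclidean_space \<Rightarrow> 'd::euclidean_space \<Rightarrow> 'c::real_normed_vector"
  assumes "open S" "x \<in> S" "\<And>s. s \<in> S \<Longrightarrow> linear (F s)"
    and "\<And>e. smooth_on S (\<lambda>s. F s e)" and "smooth_on S u"
  shows "frechet_derivative (\<lambda>s. F s (u s)) (at x) k
    = frechet_derivative (\<lambda>s. F s (u x)) (at x) k + F x (frechet_derivative u (at x) k)"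
  using frechet_derivative_at[OF has_derivative_linear_apply[OF assms(1,2,3)
    smooth_on_has_derivative[OF assms(1,2,4)] smooth_on_has_derivative[OF assms(1,2,5)]]]
  by (metis (no_types, lifting))

text \<open>Two applications of the mean value theorem, in direction \<open>u\<close> and in
  direction \<open>v\<close>, turn the second difference into a mixed second derivative at a point
  near \<open>x\<close>.\<close>

lemma second_difference:
  fixes f :: "'b::euclidean_space \<Rightarrow> real"
  assumes S: "open S" "smooth_on S f" and sub: "ball x r \<subseteq> S" and h: "h > 0" "h * (norm u + norm v) < r"
  shows "\<exists>z. dist x z \<le> h * (norm u + norm v) \<and>
    f (x + h *\<^sub>R u + h *\<^sub>R v) - f (x + h *\<^sub>R u) - f (x + h *\<^sub>R v) + f x
      = h\<^sup>2 * frechet_derivative (\<lambda>y. frechet_derivative f (at y) u) (at z) v"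
proof -
  have close: "dist x (x + s *\<^sub>R u + t *\<^sub>R v) \<le> h * (norm u + norm v)"
    if "0 \<le> s" "s \<le> h" "0 \<le> t" "t \<le> h" for s t
  proof -
    have "norm (s *\<^sub>R u + t *\<^sub>R v) \<le> s * norm u + t * norm v"
      using that norm_triangle_ineq[of "s *\<^sub>R u" "t *\<^sub>R v"] by simp
    also have "\<dots> \<le> h * norm u + h * norm v"
      by (intro add_mono mult_right_mono that) auto
    moreover have "x - (x + s *\<^sub>R u + t *\<^sub>R v) = - (s *\<^sub>R u + t *\<^sub>R v)" by simp
    ultimately show ?thesis unfolding dist_norm by (simp only: norm_minus_cancel distrib_left)
  qed
  have inS: "x + s *\<^sub>R u + t *\<^sub>R v \<in> S" if "0 \<le> s" "s \<le> h" "0 \<le> t" "t \<le> h" for s t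
    using close[OF that] h sub by auto
  have du: "((\<lambda>s. F (x + s *\<^sub>R u + t *\<^sub>R v)) has_real_derivative
      frechet_derivative F (at (x + s *\<^sub>R u + t *\<^sub>R v)) u) (at s)"
    if "0 \<le> s" "s \<le> h" "0 \<le> t" "t \<le> h" "smooth_on S F" for s t and F :: "'b \<Rightarrow> real"
  proof -
    have F: "(F has_derivative frechet_derivative F (at (x + s *\<^sub>R u + t *\<^sub>R v))) (at (x + s *\<^sub>R u + t *\<^sub>R v))"
      using smooth_on_has_derivative[OF S(1) inS] that by auto
    have "((\<lambda>s. F (x + s *\<^sub>R u + t *\<^sub>R v)) has_derivative
       (\<lambda>k. frechet_derivative F (at (x + s *\<^sub>R u + t *\<^sub>R v)) (k *\<^sub>R u))) (at s)"
      by (rule has_derivative_compose[where f = "\<lambda>s. x + s *\<^sub>R u + t *\<^sub>R v", OF _ F])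
        (auto intro!: derivative_eq_intros)
    then show ?thesis
      using linear_cmul[OF has_derivative_linear[OF F]]
      by (simp add: has_field_derivative_def mult.commute[of _ "frechet_derivative _ _ _"] mult_commute_abs)
  qed
  have dv: "((\<lambda>t. F (x + s *\<^sub>R u + t *\<^sub>R v)) has_real_derivative
      frechet_derivative F (at (x + s *\<^sub>R u + t *\<^sub>R v)) v) (at t)"
    if "0 \<le> s" "s \<le> h" "0 \<le> t" "t \<le> h" "smooth_on S F" for s t and F :: "'b \<Rightarrow> real"
  proof -
    have F: "(F has_derivative frechet_derivative F (at (x + s *\<^sub>R u + t *\<^sub>R v))) (at (x + s *\<^sub>R u + t *\<^sub>R v))"
      using smooth_on_has_derivative[OF S(1) inS] that by auto
    have "((\<lambda>t. F (x + s *\<^sub>R u + t *\<^sub>R v)) has_derivative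
       (\<lambda>k. frechet_derivative F (at (x + s *\<^sub>R u + t *\<^sub>R v)) (k *\<^sub>R v))) (at t)"
      by (rule has_derivative_compose[where f = "\<lambda>t. x + s *\<^sub>R u + t *\<^sub>R v", OF _ F])
        (auto intro!: derivative_eq_intros)
    then show ?thesis
      using linear_cmul[OF has_derivative_linear[OF F]]
      by (simp add: has_field_derivative_def mult.commute[of _ "frechet_derivative _ _ _"] mult_commute_abs)
  qed
  \<comment> \<open>The increment in direction \<open>v\<close>, as a function of the position along
    \<open>u\<close>: its mean value is a difference of \<open>u\<close>-derivatives, to which the
    mean value theorem applies again in direction \<open>v\<close>.\<close>
  define \<phi> where "\<phi> = (\<lambda>s. f (x + s *\<^sub>R u + h *\<^sub>R v) - f (x + s *\<^sub>R u + 0 *\<^sub>R v))"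
  have "\<exists>s. 0 < s \<and> s < h \<and> \<phi> h - \<phi> 0 = (h - 0) *
      (frechet_derivative f (at (x + s *\<^sub>R u + h *\<^sub>R v)) u - frechet_derivative f (at (x + s *\<^sub>R u + 0 *\<^sub>R v)) u)"
    by (rule MVT2[OF h(1)]) (auto simp only: \<phi>_def order_refl less_imp_le[OF h(1)] S(2)
        intro!: DERIV_diff du)
  then obtain s where s: "0 < s" "s < h" "\<phi> h - \<phi> 0 = h *
      (frechet_derivative f (at (x + s *\<^sub>R u + h *\<^sub>R v)) u - frechet_derivative f (at (x + s *\<^sub>R u + 0 *\<^sub>R v)) u)"
    by auto
  define F where "F = (\<lambda>y. frechet_derivative f (at y) u)"
  have F: "smooth_on S F" unfolding F_def by (rule smooth_on_deriv[OF S(2)])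
  have "\<exists>t. 0 < t \<and> t < h \<and> F (x + s *\<^sub>R u + h *\<^sub>R v) - F (x + s *\<^sub>R u + 0 *\<^sub>R v)
      = (h - 0) * frechet_derivative F (at (x + s *\<^sub>R u + t *\<^sub>R v)) v"
    by (rule MVT2[OF h(1)]) (use s F in \<open>auto intro!: dv\<close>)
  then obtain t where t: "0 < t" "t < h" "F (x + s *\<^sub>R u + h *\<^sub>R v) - F (x + s *\<^sub>R u + 0 *\<^sub>R v)
      = h * frechet_derivative F (at (x + s *\<^sub>R u + t *\<^sub>R v)) v" by auto
  have "\<phi> h - \<phi> 0 = h * (h * frechet_derivative F (at (x + s *\<^sub>R u + t *\<^sub>R v)) v)"
    using s(3) t(3) unfolding F_def by simp
  then show ?thesis
    using close[of s t] s t unfolding \<phi>_def F_def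
    by (intro exI[of _ "x + s *\<^sub>R u + t *\<^sub>R v"]) (simp add: power2_eq_square algebra_simps)
qed

text \<open>The second difference is symmetric in \<open>u\<close> and \<open>v\<close>, so the two
  mixed derivatives take a common value at points arbitrarily close to \<open>x\<close>; continuity
  excludes a gap at \<open>x\<close> itself.\<close>

lemma second_derivative_symmetric_real:
  fixes f :: "'b::euclidean_space \<Rightarrow> real"
  assumes "open S" "x \<in> S" "smooth_on S f"
  shows "frechet_derivative (\<lambda>y. frechet_derivative f (at y) u) (at x) v
       = frechet_derivative (\<lambda>y. frechet_derivative f (at y) v) (at x) u"
proof (rule ccontr)
  define P where "P = (\<lambda>z. frechet_derivative (\<lambda>y. frechet_derivative f (at y) u) (at z) v)"
  define Q where "Q = (\<lambda>z. frechet_derivative (\<lambda>y. frechet_derivative f (at y) v) (at z) u)"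
  assume "\<not> ?thesis"
  then have ne: "\<bar>P x - Q x\<bar> / 2 > 0" by (simp add: P_def Q_def)
  have "continuous_on S P" "continuous_on S Q"
    unfolding P_def Q_def by (intro smooth_on_continuous_on smooth_on_deriv assms)+
  then have "isCont P x" "isCont Q x" using assms(1,2) by (simp_all add: continuous_on_eq_continuous_at)
  then obtain d1 d2 where d: "d1 > 0" "d2 > 0"
    "\<And>z. dist z x < d1 \<Longrightarrow> dist (P z) (P x) < \<bar>P x - Q x\<bar> / 2"
    "\<And>z. dist z x < d2 \<Longrightarrow> dist (Q z) (Q x) < \<bar>P x - Q x\<bar> / 2"
    using ne unfolding continuous_at_eps_delta by (elim allE[of _ "\<bar>P x - Q x\<bar> / 2"]) blast
  obtain r where r: "r > 0" "ball x r \<subseteq> S" using assms open_contains_ball by blast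
  define e where "e = min r (min d1 d2)"
  have e: "e > 0" "ball x e \<subseteq> S" using r d by (auto simp: e_def)
  \<comment> \<open>The summand 1 keeps the denominator positive when both directions
    vanish.\<close>
  define h where "h = e / (norm u + norm v + 1)"
  have n: "norm u + norm v \<ge> 0" by simp
  have h: "h > 0" "h * (norm u + norm v) < e"
    using e n by (auto simp: h_def field_simps add_pos_nonneg intro!: divide_pos_pos)
  obtain z where z: "dist x z \<le> h * (norm u + norm v)"
    "f (x + h *\<^sub>R u + h *\<^sub>R v) - f (x + h *\<^sub>R u) - f (x + h *\<^sub>R v) + f x = h\<^sup>2 * P z"
    using second_difference[OF assms(1,3) e(2) h] unfolding P_def by auto
  have h': "h * (norm v + norm u) < e" using h by (simp add: add.commute)
  obtain w where w: "dist x w \<le> h * (norm v + norm u)"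
    "f (x + h *\<^sub>R v + h *\<^sub>R u) - f (x + h *\<^sub>R v) - f (x + h *\<^sub>R u) + f x = h\<^sup>2 * Q w"
    using second_difference[OF assms(1,3) e(2) h(1) h'] unfolding Q_def by auto
  have "f (x + h *\<^sub>R v + h *\<^sub>R u) = f (x + h *\<^sub>R u + h *\<^sub>R v)"
    by (simp only: add.assoc add.commute[of "h *\<^sub>R v"])
  then have "h\<^sup>2 * P z = h\<^sup>2 * Q w" using z(2) w(2) by linarith
  then have "P z = Q w" using h by simp
  moreover have "dist (P z) (P x) < \<bar>P x - Q x\<bar> / 2" "dist (Q w) (Q x) < \<bar>P x - Q x\<bar> / 2"
    using d(3)[of z] d(4)[of w] z w h h' by (auto simp: e_def dist_commute)
  ultimately show False by (simp add: dist_real_def abs_if split: if_splits)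
qed

lemma second_derivative_symmetric:
  fixes f :: "'b::euclidean_space \<Rightarrow> 'd::euclidean_space"
  assumes "open S" "x \<in> S" "smooth_on S f"
  shows "frechet_derivative (\<lambda>y. frechet_derivative f (at y) u) (at x) v
       = frechet_derivative (\<lambda>y. frechet_derivative f (at y) v) (at x) u"
proof (rule euclidean_eqI)
  fix e :: 'd
  have sm: "smooth_on S (\<lambda>y. inner (f y) e)"
    by (intro smooth_on_inner smooth_on_const assms)
  have d1: "frechet_derivative (\<lambda>y. inner (F y) e) (at y) w = inner (frechet_derivative F (at y) w) e"
    if "y \<in> S" "smooth_on S F" for y w and F :: "'b \<Rightarrow> 'd"
    using frechet_derivative_at[OF has_derivative_inner_left[OF smooth_on_has_derivative[OF assms(1) that]]]
    by metis
  have d2: "frechet_derivative (\<lambda>y. frechet_derivative (\<lambda>y. inner (f y) e) (at y) a) (at x) b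
     = inner (frechet_derivative (\<lambda>y. frechet_derivative f (at y) a) (at x) b) e" for a b
  proof -
    have "((\<lambda>y. inner (frechet_derivative f (at y) a) e) has_derivative
        (\<lambda>w. inner (frechet_derivative (\<lambda>y. frechet_derivative f (at y) a) (at x) w) e)) (at x)"
      by (intro has_derivative_inner_left smooth_on_has_derivative[OF assms(1,2)] smooth_on_deriv assms)
    then have "((\<lambda>y. frechet_derivative (\<lambda>y. inner (f y) e) (at y) a) has_derivative
        (\<lambda>w. inner (frechet_derivative (\<lambda>y. frechet_derivative f (at y) a) (at x) w) e)) (at x)"
      by (rule has_derivative_transform_within_open[OF _ assms(1,2)]) (simp add: d1 assms)
    from frechet_derivative_at[OF this] show ?thesis by metis
  qed
  show "inner (frechet_derivative (\<lambda>y. frechet_derivative f (at y) u) (at x) v) e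
       = inner (frechet_derivative (\<lambda>y. frechet_derivative f (at y) v) (at x) u) e"
    using second_derivative_symmetric_real[OF assms(1,2) sm, of u v] by (simp add: d2)
qed

section \<open>The torsion at a point\<close>

locale hermitian_space =
  fixes h :: "'e::euclidean_space \<Rightarrow> 'e \<Rightarrow> real" and j :: "'e \<Rightarrow> 'e"
  assumes h_bilinear: "bilinear h"
    and h_sym: "h u v = h v u"
    and h_pos: "u \<noteq> 0 \<Longrightarrow> h u u > 0"
    and j_linear: "linear j"
    and j_j [simp]: "j (j u) = - u"
    and h_j [simp]: "h (j u) (j v) = h u v"
begin

lemmas h_simps [simp] = bilinear_ladd[OF h_bilinear] bilinear_radd[OF h_bilinear]
  bilinear_lsub[OF h_bilinear] bilinear_rsub[OF h_bilinear]
  bilinear_lneg[OF h_bilinear] bilinear_rneg[OF h_bilinear]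
  bilinear_lmul[OF h_bilinear] bilinear_rmul[OF h_bilinear]
  bilinear_lzero[OF h_bilinear] bilinear_rzero[OF h_bilinear]

lemmas j_simps [simp] = linear_add[OF j_linear] linear_diff[OF j_linear] linear_neg[OF j_linear]
  linear_cmul[OF j_linear] linear_0[OF j_linear]

lemma h_eq_0: "h u u = 0 \<longleftrightarrow> u = 0"
  using h_pos[of u] by (cases "u = 0") auto

lemma h_eqI: "(\<And>b. h u b = h v b) \<Longrightarrow> u = v"
  using h_eq_0[of "u - v"] by simp

lemma h_j_left: "h (j u) v = - h u (j v)"
  using h_j[of u "j v"] by simp

lemma h_j_self [simp]: "h u (j u) = 0"
  using h_j_left[of u u] h_sym[of u "j u"] by simp

text \<open>Projecting along \<open>e\<close> exhibits \<open>W\<close> as the direct sum of a line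
  and its \<open>h\<close>-complement; \<open>h\<close> is the metric at a point, not the inner
  product of the model space.\<close>

lemma dim_orthogonal:
  assumes W: "subspace W" and e: "e \<in> W" "h e e = 1"
  shows "dim W = dim {w\<in>W. h w e = 0} + 1"
proof -
  let ?W = "{w\<in>W. h w e = 0}"
  have sub: "subspace ?W"
    using W by (auto simp: subspace_def)
  have "W = {u + v |u v. u \<in> span {e} \<and> v \<in> ?W}"
  proof (intro Set.set_eqI iffI)
    fix w assume w: "w \<in> W"
    have "w - h w e *\<^sub>R e \<in> ?W"
      using w e W by (simp add: subspace_diff subspace_scale)
    moreover have "h w e *\<^sub>R e \<in> span {e}" by (simp add: span_scale span_base)
    moreover have "w = h w e *\<^sub>R e + (w - h w e *\<^sub>R e)" by simp
    ultimately show "w \<in> {u + v |u v. u \<in> span {e} \<and> v \<in> ?W}" by blast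
  next
    fix w assume "w \<in> {u + v |u v. u \<in> span {e} \<and> v \<in> ?W}"
    then show "w \<in> W" using W e by (auto simp: span_singleton subspace_add subspace_scale)
  qed
  moreover have "span {e} \<inter> ?W = {0}"
    using e sub by (auto simp: span_singleton subspace_0 W)
  moreover have "dim (span {e}) = 1"
    using e by (auto simp: dim_span dim_singleton)
  ultimately show ?thesis
    using dim_sums_Int[OF subspace_span sub, of "{e}"] by simp
qed

text \<open>Gram-Schmidt over the quaternions: a unit vector \<open>e\<close> spans with
  \<open>j e\<close>, \<open>K e\<close>, \<open>j (K e)\<close> an orthonormal quaternionic line,
  and since \<open>j\<close> and \<open>K\<close> are skew its complement is again invariant. The
  last clause says that the frame is complete.\<close>

lemma quaternionic_frame:
  assumes W: "subspace W" and K: "linear K"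
    and jW: "\<And>a. a \<in> W \<Longrightarrow> j a \<in> W" and KW: "\<And>a. a \<in> W \<Longrightarrow> K a \<in> W"
    and KK: "\<And>a. a \<in> W \<Longrightarrow> K (K a) = - a" and Kj: "\<And>a. a \<in> W \<Longrightarrow> K (j a) = - j (K a)"
    and hK: "\<And>a b. a \<in> W \<Longrightarrow> b \<in> W \<Longrightarrow> h (K a) b = - h a (K b)"
  shows "\<exists>n E. dim W = 4 * n \<and>
     (\<forall>k<2 * n. E k \<in> W) \<and>
     (\<forall>k<2 * n. \<forall>l<2 * n. h (E k) (E l) = (if k = l then 1 else 0) \<and> h (E k) (j (E l)) = 0) \<and>
     (\<forall>k<n. E (2 * k + 1) = K (E (2 * k))) \<and>
     (\<forall>w\<in>W. (\<forall>k<2 * n. h w (E k) = 0 \<and> h w (j (E k)) = 0) \<longrightarrow> w = 0)"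
  using W jW KW KK Kj hK
proof (induction "dim W" arbitrary: W rule: less_induct)
  case less
  note W = less.prems(1) and jW = less.prems(2) and KW = less.prems(3) and KK = less.prems(4)
    and Kj = less.prems(5) and hK = less.prems(6)
  show ?case
  proof (cases "W = {0}")
    case True
    then show ?thesis by (intro exI[of _ 0]) simp
  next
    case False
    then obtain w where w: "w \<in> W" "w \<noteq> 0" using subspace_0[OF W] by auto
    define e where "e = (1 / sqrt (h w w)) *\<^sub>R w"
    have e: "e \<in> W" "h e e = 1"
      using w h_pos[OF w(2)] W by (auto simp: e_def subspace_scale real_div_sqrt field_simps)
    have je: "j e \<in> W" and Ke: "K e \<in> W" and jKe: "j (K e) \<in> W"
      using e jW KW by auto
    have hKe: "h (K e) (K e) = 1"
      using hK[OF e(1) Ke] KK[OF e(1)] e(2) by simp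
    have hKe0: "h (K e) e = 0"
      using hK[OF e(1) e(1)] h_sym[of e "K e"] by simp
    have hKje: "h (K e) (j e) = 0"
      using hK[OF e(1) je] Kj[OF e(1)] h_sym[of e "j (K e)"] h_j_left[of "K e" e] by simp
    \<comment> \<open>The quaternionic line is removed one unit vector at a time, so that each cut
      lowers the real dimension by one.\<close>
    define W1 where "W1 = {w\<in>W. h w e = 0}"
    define W2 where "W2 = {w\<in>W1. h w (j e) = 0}"
    define W3 where "W3 = {w\<in>W2. h w (K e) = 0}"
    define W4 where "W4 = {w\<in>W3. h w (j (K e)) = 0}"
    have sub: "subspace W1" "subspace W2" "subspace W3" "subspace W4"
      using W unfolding W1_def W2_def W3_def W4_def by (auto simp: subspace_def)
    have "dim W = dim W1 + 1"
      unfolding W1_def by (rule dim_orthogonal[OF W e])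
    moreover have "dim W1 = dim W2 + 1"
      unfolding W2_def by (rule dim_orthogonal[OF sub(1)])
        (use je e h_sym[of "j e" e] in \<open>auto simp: W1_def\<close>)
    moreover have "dim W2 = dim W3 + 1"
      unfolding W3_def by (rule dim_orthogonal[OF sub(2)])
        (use Ke hKe hKe0 hKje in \<open>auto simp: W1_def W2_def\<close>)
    moreover have "dim W3 = dim W4 + 1"
      unfolding W4_def by (rule dim_orthogonal[OF sub(3)])
        (use jKe hKe hKe0 hKje h_j_left[of "K e" e] h_j_left[of "K e" "K e"] in
          \<open>auto simp: W1_def W2_def W3_def\<close>)
    ultimately have dim: "dim W = dim W4 + 4" by simp
    have W4: "w \<in> W4 \<longleftrightarrow> w \<in> W \<and> h w e = 0 \<and> h w (j e) = 0 \<and> h w (K e) = 0 \<and> h w (j (K e)) = 0" for w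
      by (auto simp: W1_def W2_def W3_def W4_def)
    have j4: "j w \<in> W4" if "w \<in> W4" for w
      using that jW by (simp add: W4 h_j_left)
    have K4: "K w \<in> W4" if "w \<in> W4" for w
      using that KW hK[of w] e je Ke jKe KK[OF e(1)] Kj[OF e(1)] Kj[OF Ke]
      by (simp add: W4)
    have "dim W4 < dim W" using dim by simp
    then have "\<exists>n E. dim W4 = 4 * n \<and> (\<forall>k<2 * n. E k \<in> W4) \<and>
     (\<forall>k<2 * n. \<forall>l<2 * n. h (E k) (E l) = (if k = l then 1 else 0) \<and> h (E k) (j (E l)) = 0) \<and>
     (\<forall>k<n. E (2 * k + 1) = K (E (2 * k))) \<and>
     (\<forall>w\<in>W4. (\<forall>k<2 * n. h w (E k) = 0 \<and> h w (j (E k)) = 0) \<longrightarrow> w = 0)"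
      by (rule less.hyps[OF _ sub(4) j4 K4]) (use KK Kj hK W4 in auto)
    then obtain n E where nE: "dim W4 = 4 * n" "\<forall>k<2 * n. E k \<in> W4"
     "\<And>k l. k<2 * n \<Longrightarrow> l<2 * n \<Longrightarrow> h (E k) (E l) = (if k = l then 1 else 0)"
     "\<And>k l. k<2 * n \<Longrightarrow> l<2 * n \<Longrightarrow> h (E k) (j (E l)) = 0"
     "\<forall>k<n. E (2 * k + 1) = K (E (2 * k))"
     "\<And>w. w \<in> W4 \<Longrightarrow> \<forall>k<2 * n. h w (E k) = 0 \<and> h w (j (E k)) = 0 \<Longrightarrow> w = 0"
      by blast
    have E4: "h (E k) e = 0" "h (E k) (j e) = 0" "h (E k) (K e) = 0" "h (E k) (j (K e)) = 0"
       "h e (E k) = 0" "h e (j (E k)) = 0" "h (K e) (E k) = 0" "h (K e) (j (E k)) = 0" if "k < 2 * n" for k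
      using nE(2) that W4[of "E k"] h_sym[of e "E k"] h_sym[of "K e" "E k"]
        h_j_left[of e "E k"] h_j_left[of "K e" "E k"] h_sym[of "j e" "E k"] h_sym[of "j (K e)" "E k"]
      by auto
    \<comment> \<open>The new pair \<open>e\<close>, \<open>K e\<close> occupies the positions
      \<open>2 * n\<close> and \<open>2 * n + 1\<close>, which keeps every odd vector the
      \<open>K\<close>-image of its predecessor.\<close>
    define F where "F k = (if k < 2 * n then E k else if k = 2 * n then e else K e)" for k
    have *: "k < 2 * Suc n \<longleftrightarrow> k < 2 * n \<or> k = 2 * n \<or> k = Suc (2 * n)" for k by auto
    have mem: "\<forall>k<2 * Suc n. F k \<in> W"
      using nE(2) e Ke W4 unfolding * by (auto simp: F_def)
    have orth: "\<forall>k<2 * Suc n. \<forall>l<2 * Suc n. h (F k) (F l) = (if k = l then 1 else 0) \<and> h (F k) (j (F l)) = 0"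
      unfolding * using E4 nE(3,4) e hKe hKe0 hKje h_sym[of e "K e"] h_j_left[of e "K e"] h_sym[of "j e" "K e"]
      by (auto simp: F_def)
    have FK: "\<forall>k<Suc n. F (2 * k + 1) = K (F (2 * k))"
    proof (intro allI impI)
      fix k assume "k < Suc n"
      then consider "k < n" | "k = n" by linarith
      then show "F (2 * k + 1) = K (F (2 * k))"
        using nE(5) by cases (auto simp: F_def)
    qed
    have compl: "\<forall>w\<in>W. (\<forall>k<2 * Suc n. h w (F k) = 0 \<and> h w (j (F k)) = 0) \<longrightarrow> w = 0"
    proof (intro ballI impI)
      fix w assume w: "w \<in> W" and 0: "\<forall>k<2 * Suc n. h w (F k) = 0 \<and> h w (j (F k)) = 0"
      have "w \<in> W4"
        using 0[rule_format, of "2 * n"] 0[rule_format, of "Suc (2 * n)"] w unfolding W4 by (simp add: F_def)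
      moreover have "\<forall>k<2 * n. h w (E k) = 0 \<and> h w (j (E k)) = 0"
      proof (intro allI impI)
        fix k assume "k < 2 * n"
        then show "h w (E k) = 0 \<and> h w (j (E k)) = 0" using 0[rule_format, of k] by (simp add: F_def)
      qed
      ultimately show "w = 0" by (rule nE(6))
    qed
    show ?thesis
      using dim nE(1) mem orth FK compl by (intro exI[of _ "Suc n"] exI[of _ F]) simp
  qed
qed

end

section \<open>Mixed forms and the algebra of the Bianchi identity\<close>

definition alternating3 :: "('e::real_vector \<Rightarrow> 'e \<Rightarrow> 'e \<Rightarrow> real) \<Rightarrow> bool" where
  "alternating3 F \<longleftrightarrow> (\<forall>u v. linear (F u v)) \<and>
     (\<forall>u v w. F u v w = - F v u w) \<and> (\<forall>u v w. F u v w = - F u w v)"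

text \<open>Real 3-forms in \<open>\<Lambda>\<^sup>2\<^sup>,\<^sup>0H\<^sup>* \<otimes> \<Lambda>\<^sup>0\<^sup>,\<^sup>1V\<^sup>* \<oplus> \<Lambda>\<^sup>0\<^sup>,\<^sup>2H\<^sup>* \<otimes> \<Lambda>\<^sup>1\<^sup>,\<^sup>0V\<^sup>*\<close>, described
  without complexification.\<close>

definition mixed_form :: "('e::real_vector \<Rightarrow> 'e) \<Rightarrow> 'e set \<Rightarrow> 'e set \<Rightarrow> ('e \<Rightarrow> 'e \<Rightarrow> 'e \<Rightarrow> real) \<Rightarrow> bool" where
  "mixed_form j H V F \<longleftrightarrow> alternating3 F \<and>
     (\<forall>a\<in>H. \<forall>b\<in>H. \<forall>c\<in>H. F a b c = 0) \<and> (\<forall>x\<in>V. \<forall>y\<in>V. \<forall>u. F x y u = 0) \<and>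
     (\<forall>a\<in>H. \<forall>b\<in>H. \<forall>x\<in>V. F (j a) b x = - F a b (j x))"

locale hermitian_splitting = hermitian_space h j
  for h :: "'e::euclidean_space \<Rightarrow> 'e \<Rightarrow> real" and j :: "'e \<Rightarrow> 'e" +
  fixes H V :: "'e set"
  assumes H_subspace: "subspace H" and V_subspace: "subspace V"
    and HV_split: "\<exists>u\<in>H. \<exists>v\<in>V. w = u + v"
    and HV_orth: "u \<in> H \<Longrightarrow> v \<in> V \<Longrightarrow> h u v = 0"
    and j_H: "u \<in> H \<Longrightarrow> j u \<in> H" and j_V: "u \<in> V \<Longrightarrow> j u \<in> V"
    and dim_V: "dim V = 2"
begin

text \<open>Here V enters as a complex line: \<open>x\<close> and \<open>j x\<close> are nonzero and
  orthogonal, so they fill its two real dimensions.\<close>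

lemma V_rep:
  assumes "x \<in> V" "x \<noteq> 0" "y \<in> V"
  obtains \<alpha> \<beta> where "y = \<alpha> *\<^sub>R x + \<beta> *\<^sub>R j x"
proof -
  have "x \<noteq> j x" using assms(2) h_j_self[of x] h_eq_0[of x] by metis
  moreover have "independent {x, j x}"
  proof (rule independent_insertI)
    have "x \<noteq> k *\<^sub>R j x" for k
    proof
      assume "x = k *\<^sub>R j x"
      then have "h x x = h x (k *\<^sub>R j x)" by simp
      then show False using assms h_eq_0 by simp
    qed
    then show "x \<notin> span {j x}" by (auto simp: span_singleton)
    have "j x \<noteq> 0" using assms(2) j_j[of x] by (metis j_simps(5) neg_equal_0_iff_equal)
    then show "independent {j x}" by simp
  qed
  ultimately have "V \<subseteq> span {x, j x}"
    using card_ge_dim_independent[of "{x, j x}" V] assms j_V dim_V by auto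
  then have "y \<in> span {x, j x}" using assms by auto
  then obtain \<alpha> where "y - \<alpha> *\<^sub>R x \<in> span {j x}"
    using span_breakdown[of x "{x, j x}" y] \<open>x \<noteq> j x\<close> by (auto simp: insert_Diff_if)
  then obtain \<beta> where "y - \<alpha> *\<^sub>R x = \<beta> *\<^sub>R j x" by (auto simp: span_singleton)
  then have "y = \<alpha> *\<^sub>R x + \<beta> *\<^sub>R j x" by (simp add: algebra_simps)
  then show ?thesis by (rule that)
qed

lemma H_memI: "(\<And>y. y \<in> V \<Longrightarrow> h u y = 0) \<Longrightarrow> u \<in> H"
proof -
  assume *: "\<And>y. y \<in> V \<Longrightarrow> h u y = 0"
  obtain a y where a: "a \<in> H" "y \<in> V" "u = a + y" using HV_split by blast
  have "h u y = h a y + h y y" using a(3) by simp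
  with *[OF a(2)] HV_orth[OF a(1,2)] have "y = 0" by (simp add: h_eq_0)
  then show ?thesis using a by simp
qed

lemma H_eqI: "u \<in> H \<Longrightarrow> v \<in> H \<Longrightarrow> (\<And>b. b \<in> H \<Longrightarrow> h u b = h v b) \<Longrightarrow> u = v"
  using h_eq_0[of "u - v"] subspace_diff[OF H_subspace, of u v] by auto

text \<open>After splitting all arguments, only components with exactly one argument in V can
  survive, and cyclic symmetry moves that argument to the last slot. This serves both for \<nabla>T
  = 0 and for identifying T with the model form.\<close>

lemma mixed_form_eq_0:
  assumes F: "mixed_form j H V F" and 0: "\<And>a b x. a \<in> H \<Longrightarrow> b \<in> H \<Longrightarrow> x \<in> V \<Longrightarrow> F a b x = 0"
  shows "F u v w = 0"
proof -
  have lin: "linear (F u v)" and s1: "F u v w = - F v u w" and s2: "F u v w = - F u w v" for u v w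
    using F unfolding mixed_form_def alternating3_def by blast+
  have cyc: "F u v w = F v w u" for u v w using s1[of u v w] s2[of v u w] by simp
  have add: "F u v (w + w') = F u v w + F u v w'" for u v w w' using linear_add[OF lin] .
  have add1: "F (u + u') v w = F u v w + F u' v w" for u u' v w using add[of v w u u'] cyc by metis
  have add2: "F u (v + v') w = F u v w + F u v' w" for u v v' w using add[of w u v v'] cyc by metis
  have HHH: "a \<in> H \<Longrightarrow> b \<in> H \<Longrightarrow> c \<in> H \<Longrightarrow> F a b c = 0"
    and VV: "x \<in> V \<Longrightarrow> y \<in> V \<Longrightarrow> F x y u = 0" for a b c x y u
    using F by (auto simp: mixed_form_def)
  obtain a x where a: "u = a + x" "a \<in> H" "x \<in> V" using HV_split by blast
  obtain b y where b: "v = b + y" "b \<in> H" "y \<in> V" using HV_split by blast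
  obtain c z where c: "w = c + z" "c \<in> H" "z \<in> V" using HV_split by blast
  have "F x b c = 0" using 0[OF b(2) c(2) a(3)] cyc[of x b c] by linarith
  moreover have "F a y c = 0" using 0[OF c(2) a(2) b(3)] cyc[of a y c] cyc[of y c a] by linarith
  moreover have "F a y z = 0" using VV[OF b(3) c(3), of a] cyc[of a y z] by linarith
  moreover have "F x b z = 0" using VV[OF c(3) a(3), of b] cyc[of x b z] cyc[of b z x] by linarith
  ultimately show ?thesis
    using a b c 0 HHH VV by (simp add: add add1 add2)
qed

text \<open>The argument for \<open>\<nabla>T = 0\<close>: \<open>N\<close> plays the role of the covariant derivative of the
  torsion and \<open>R\<close> that of the curvature; only their symmetries and the first Bianchi identity enter.\<close>

lemma bianchi_mixed_form_eq_0:
  fixes R N :: "'e \<Rightarrow> 'e \<Rightarrow> 'e \<Rightarrow> 'e \<Rightarrow> real" and T :: "'e \<Rightarrow> 'e \<Rightarrow> 'e"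
  defines "\<sigma> \<equiv> \<lambda>u v w z. h (T u v) (T w z) + h (T v w) (T u z) + h (T w u) (T v z)"
  assumes T: "mixed_form j H V (\<lambda>u v w. h (T u v) w)"
    and N: "\<And>k. mixed_form j H V (N k)" and N_linear: "\<And>u v w. linear (\<lambda>k. N k u v w)"
    and R1: "\<And>u v w z. R u v w z = - R v u w z" and R2: "\<And>u v w z. R u v w z = - R u v z w"
    and R_linear: "\<And>u v w. linear (R u v w)"
    and Rj: "\<And>u v w z. R u v (j w) (j z) = R u v w z"
    and RHV: "\<And>u v a x. a \<in> H \<Longrightarrow> x \<in> V \<Longrightarrow> R u v a x = 0"
    and bianchi: "\<And>u v w z. R u v w z + R v w u z + R w u v z
        = N u v w z + N v w u z + N w u v z + \<sigma> u v w z"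
  shows "N k u v w = 0"
proof (rule mixed_form_eq_0[OF N])
  have Ns1: "N k u v w = - N k v u w" and Ns2: "N k u v w = - N k u w v" for k u v w
    using N unfolding mixed_form_def alternating3_def by blast+
  have N_lin: "linear (N k u v)" for k u v
    using N unfolding mixed_form_def alternating3_def by blast
  have NHHH: "a \<in> H \<Longrightarrow> b \<in> H \<Longrightarrow> c \<in> H \<Longrightarrow> N k a b c = 0"
    and NVV: "x \<in> V \<Longrightarrow> y \<in> V \<Longrightarrow> N k x y u = 0"
    and Nj: "a \<in> H \<Longrightarrow> b \<in> H \<Longrightarrow> x \<in> V \<Longrightarrow> N k (j a) b x = - N k a b (j x)" for k a b c x y u
    using N unfolding mixed_form_def by blast+
  have Nj2: "N k a (j b) x = - N k a b (j x)" if "a \<in> H" "b \<in> H" "x \<in> V" for k a b x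
    using Ns1[of k a "j b" x] Ns1[of k a b "j x"] Nj[of b a x k] that by simp
  have RVH: "R u v x a = 0" if "a \<in> H" "x \<in> V" for u v a x
    using R2[of u v x a] RHV that by simp
  have T1: "h (T u v) w = - h (T v u) w" and T2: "h (T u v) w = - h (T u w) v"
    and THHH: "a \<in> H \<Longrightarrow> b \<in> H \<Longrightarrow> c \<in> H \<Longrightarrow> h (T a b) c = 0"
    and TVV: "x \<in> V \<Longrightarrow> y \<in> V \<Longrightarrow> h (T x y) u = 0" for u v w a b c x y
    using T unfolding mixed_form_def alternating3_def by blast+
  have THV: "T x a \<in> H" "T a x \<in> H" if "a \<in> H" "x \<in> V" for a x
    using T2[of x a] T1[of a x] TVV that by (auto intro!: H_memI)
  have Ts: "T u v = - T v u" for u v using T1[of u v] by (intro h_eqI) simp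
  have TVH0: "T x y = 0" if "x \<in> V" "y \<in> V" for x y using TVV that by (intro h_eqI) simp
  have THH0: "h (T a b) u = 0" if "a \<in> H" "b \<in> H" "u \<in> H" for a b u using THHH that by simp
  fix a b w assume H: "a \<in> H" "b \<in> H" and w: "w \<in> V"
  \<comment> \<open>Derivatives in vertical directions.\<close>
  have V0: "N x a b w = 0" if x: "x \<in> V" for x
  proof -
    \<comment> \<open>With \<open>w\<close> in V, the only curvature term left in the Bianchi
      identity is \<open>R a b x w\<close>; it is skew in \<open>x\<close> and \<open>w\<close>, and
      so is \<sigma>.\<close>
    have sk: "N x a b w = - N w a b x" if "a \<in> H" "b \<in> H" "x \<in> V" "w \<in> V" for a b x w
    proof -
      have *: "R a b x w = N x a b w + \<sigma> x a b w" if "x \<in> V" "w \<in> V" for x w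
        using bianchi[of x a b w] RHV[OF \<open>a \<in> H\<close> that(2), of b x] RHV[OF \<open>b \<in> H\<close> that(2), of x a]
          Ns1[of a b x w] Ns2[of a x b w] NVV[OF that, of a b] NVV[OF that, of b a] Ns2[of b x a w]
        by linarith
      have \<sigma>1: "\<sigma> x a b w = h (T x a) (T b w) + h (T b x) (T a w)" if "x \<in> V" "w \<in> V" for x w
        using TVH0[OF that] by (simp add: \<sigma>_def)
      have "\<sigma> x a b w + \<sigma> w a b x = 0"
        unfolding \<sigma>1[OF that(3,4)] \<sigma>1[OF that(4,3)]
        by (simp add: Ts[of x a] Ts[of b w] Ts[of w a] Ts[of b x] h_sym)
      then show ?thesis using *[of x w] *[of w x] R2[of a b x w] that by simp
    qed
    have d: "N x a b x = 0" if "a \<in> H" "b \<in> H" "x \<in> V" for a b x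
      using sk[OF that(1,2,3,3)] by simp
    \<comment> \<open>The type condition moves \<open>j\<close> from \<open>x\<close> to
      \<open>a\<close>, so vanishing on the diagonal extends to all of the line spanned by
      \<open>x\<close> and \<open>j x\<close>.\<close>
    have e: "N x a b (j x) = 0" if "a \<in> H" "b \<in> H" "x \<in> V" for a b x
      using Nj[OF that, of x] d[OF j_H[OF that(1)] that(2,3)] by simp
    show ?thesis
    proof (cases "x = 0")
      case True
      then show ?thesis using linear_0[OF N_linear] by simp
    next
      case False
      obtain \<alpha> \<beta> where "w = \<alpha> *\<^sub>R x + \<beta> *\<^sub>R j x" by (rule V_rep[OF x False w])
      then show ?thesis using d[OF H x] e[OF H x] N_lin[of x a b] by (simp add: linear_add linear_cmul)
    qed
  qed
  \<comment> \<open>Derivatives in horizontal directions.\<close>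
  have sym: "N a c b w = N c a b w" if H: "a \<in> H" "b \<in> H" "c \<in> H" and w: "w \<in> V" for a b c w
  proof -
    have \<sigma>0: "\<sigma> c a b w = 0" if "a \<in> H" "b \<in> H" "c \<in> H" "w \<in> V" for a b c w
      using that THV by (simp add: \<sigma>_def THH0)
    \<comment> \<open>All curvature terms pair H with V and vanish, and so does \<sigma>.\<close>
    have cyc: "N c a b w + N a b c w + N b c a w = 0" if "a \<in> H" "b \<in> H" "c \<in> H" "w \<in> V" for a b c w
      using bianchi[of c a b w] RHV that \<sigma>0[OF that] by simp
    \<comment> \<open>The cyclic identity expresses the direction slot through form slots and
      thereby transfers the type condition to the direction.\<close>
    have jc: "N (j c) a b w = - N c a b (j w)" if "a \<in> H" "b \<in> H" "c \<in> H" "w \<in> V" for a b c w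
      using cyc[of a b "j c" w] cyc[of a b c "j w"] Nj[of c a w b] Nj2[of b c w a] that
      by (simp add: j_H j_V)
    have P: "R a w c b - R c w a b = N a c b w - N c a b w" if "a \<in> H" "b \<in> H" "c \<in> H" "w \<in> V" for a b c w
    proof -
      have "\<sigma> c a w b = 0"
        using that THV by (simp add: \<sigma>_def THH0 h_sym[of "T a w"] h_sym[of "T w c"])
      moreover have "N w c a b = 0" using NHHH that by simp
      moreover have "R c a w b = 0" using RVH that by simp
      ultimately show ?thesis
        using bianchi[of c a w b] R1[of w c a b] Ns2[of c a w b]
          Ns1[of a w c b] Ns2[of a c w b] by linarith
    qed
    have j2: "R u v (j c) b = - R u v c (j b)" for u v c b
      using Rj[of u v c "j b"] linear_neg[OF R_linear, of u v "j c" b] by simp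
    \<comment> \<open>Applying \<open>j\<close> to two of \<open>a\<close>, \<open>b\<close>,
      \<open>c\<close> changes the sign of the right side. The left sides of the three resulting
      equations add up to the original left side, so the difference equals minus three times
      itself.\<close>
    let ?d = "N a c b w - N c a b w"
    have 1: "R a w c b - R c w a b = ?d" by (rule P) (use H w in auto)
    have 2: "R a w c b - R (j c) w a (j b) = - ?d"
    proof -
      have "N a (j c) (j b) w = - N a c b w"
        using Nj[of c "j b" w a] Nj2[of c b "j w" a] H w linear_neg[OF N_lin, of a c b w]
        by (simp add: j_H j_V)
      moreover have "N (j c) a (j b) w = - N c a b w"
        using jc[of a "j b" c w] Nj2[of a b "j w" c] H w linear_neg[OF N_lin, of c a b w]
        by (simp add: j_H j_V)
      ultimately show ?thesis using P[of a "j b" "j c" w] H w Rj by (simp add: j_H)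
    qed
    have 3: "R (j a) w c (j b) - R c w a b = - ?d"
    proof -
      have "N c (j a) (j b) w = - N c a b w"
        using Nj[of a "j b" w c] Nj2[of a b "j w" c] H w linear_neg[OF N_lin, of c a b w]
        by (simp add: j_H j_V)
      moreover have "N (j a) c (j b) w = - N a c b w"
        using jc[of c "j b" a w] Nj2[of c b "j w" a] H w linear_neg[OF N_lin, of a c b w]
        by (simp add: j_H j_V)
      ultimately show ?thesis using P[of "j a" "j b" c w] H w Rj by (simp add: j_H)
    qed
    have 4: "- R (j a) w c (j b) + R (j c) w a (j b) = - ?d"
    proof -
      have "N (j a) (j c) b w = - N a c b w"
        using jc[of "j c" b a w] Nj[of c b "j w" a] H w linear_neg[OF N_lin, of a c b w]
        by (simp add: j_H j_V)
      moreover have "N (j c) (j a) b w = - N c a b w"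
        using jc[of "j a" b c w] Nj[of a b "j w" c] H w linear_neg[OF N_lin, of c a b w]
        by (simp add: j_H j_V)
      ultimately show ?thesis using P[of "j a" b "j c" w] H w j2 by (simp add: j_H)
    qed
    from 1 2 3 4 have "?d = 0" by linarith
    then show ?thesis by simp
  qed
  \<comment> \<open>A tensor symmetric in its first two slots and skew in the next two is
    zero.\<close>
  have H0: "N c a b w = 0" if "a \<in> H" "b \<in> H" "c \<in> H" "w \<in> V" for a b c w
    using sym[of a b c w] sym[of a c b w] sym[of b a c w] that
      Ns1[of c a b w] Ns1[of a b c w] Ns1[of b c a w] by simp
  obtain c x where k: "c \<in> H" "x \<in> V" "k = c + x" using HV_split by blast
  then show "N k a b w = 0"
    using linear_add[OF N_linear[of a b w], of c x] V0[OF k(2)] H0[OF H k(1) w] by simp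
qed

text \<open>Cyclic symmetry turns the type condition on triples \<open>a\<close>, \<open>b\<close>,
  \<open>x\<close> into properties of the endomorphism \<open>T x\<close> of H: it is skew,
  anticommutes with \<open>j\<close>, and depends complex linearly on \<open>x\<close>.\<close>

lemma torsion_mixed:
  fixes T :: "'e \<Rightarrow> 'e \<Rightarrow> 'e"
  assumes T: "mixed_form j H V (\<lambda>u v w. h (T u v) w)" and x: "x \<in> V" and a: "a \<in> H"
  shows "T x a \<in> H" and "T x (j a) = - j (T x a)" and "T (j x) a = j (T x a)"
    and "b \<in> H \<Longrightarrow> h (T x a) b = - h a (T x b)" and "T a x = - T x a"
proof -
  have T1: "h (T u v) w = - h (T v u) w" and T2: "h (T u v) w = - h (T u w) v"
    and TVV: "x \<in> V \<Longrightarrow> y \<in> V \<Longrightarrow> h (T x y) u = 0"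
    and Tj: "a \<in> H \<Longrightarrow> b \<in> H \<Longrightarrow> x \<in> V \<Longrightarrow> h (T (j a) b) x = - h (T a b) (j x)" for u v w x y a b
    using T unfolding mixed_form_def alternating3_def by blast+
  have cyc: "h (T u v) w = h (T v w) u" for u v w
    using T1[of u v w] T2[of v u w] by linarith
  have TH: "T x a \<in> H" if "x \<in> V" "a \<in> H" for x a
    using T2[of x a] TVV that by (auto intro!: H_memI)
  show "T x a \<in> H" by (rule TH[OF x a])
  have Tj2: "h (T a (j b)) x = - h (T a b) (j x)" if "a \<in> H" "b \<in> H" "x \<in> V" for a b x
    using T1[of a "j b" x] T1[of a b "j x"] Tj[OF that(2,1,3)] by linarith
  show "T x (j a) = - j (T x a)"
  proof (rule H_eqI)
    fix b assume b: "b \<in> H"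
    show "h (T x (j a)) b = h (- j (T x a)) b"
      using cyc[of x "j a" b] cyc[of x a "j b"] Tj[OF a b x] Tj2[OF a b x] by (simp add: h_j_left)
  qed (use TH x a j_H subspace_neg[OF H_subspace] in auto)
  show "T (j x) a = j (T x a)"
  proof (rule H_eqI)
    fix b assume b: "b \<in> H"
    show "h (T (j x) a) b = h (j (T x a)) b"
      using cyc[of "j x" a b] cyc[of x a "j b"] Tj2[OF a b x] by (simp add: h_j_left)
  qed (use TH x a j_H j_V in auto)
  show "h (T x a) b = - h a (T x b)" using T2[of x a b] h_sym[of a "T x b"] by simp
  show "T a x = - T x a" using T1[of a x] by (intro h_eqI) simp
qed

text \<open>A horizontal vector killed by one \<open>T x\<close> is killed by \<open>T (j x)\<close>
  too, hence by all of V; as T vanishes on H x H x H, it would lie in the kernel of the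
  3-form.\<close>

lemma torsion_injective:
  fixes T :: "'e \<Rightarrow> 'e \<Rightarrow> 'e"
  assumes T: "mixed_form j H V (\<lambda>u v w. h (T u v) w)" and Tb: "bilinear T"
    and nondeg: "\<And>u. u \<noteq> 0 \<Longrightarrow> \<exists>v w. h (T u v) w \<noteq> 0"
    and x: "x \<in> V" "x \<noteq> 0" and a: "a \<in> H" "T x a = 0"
  shows "a = 0"
proof (rule ccontr)
  assume "a \<noteq> 0"
  then obtain v w where ne: "h (T a v) w \<noteq> 0" using nondeg by blast
  have T1: "h (T u v) w = - h (T v u) w" and T2: "h (T u v) w = - h (T u w) v"
    and HHH: "a \<in> H \<Longrightarrow> b \<in> H \<Longrightarrow> c \<in> H \<Longrightarrow> h (T a b) c = 0" for u v w a b c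
    using T unfolding mixed_form_def alternating3_def by blast+
  have V0: "T y a = 0" if y: "y \<in> V" for y
  proof -
    obtain \<alpha> \<beta> where "y = \<alpha> *\<^sub>R x + \<beta> *\<^sub>R j x" by (rule V_rep[OF x y])
    then show ?thesis
      using torsion_mixed(3)[OF T x(1) a(1)] a(2) by (simp add: bilinear_ladd[OF Tb] bilinear_lmul[OF Tb])
  qed
  have aV: "T a y = 0" if "y \<in> V" for y using torsion_mixed(5)[OF T that a(1)] V0[OF that] by simp
  obtain b y where b: "b \<in> H" "y \<in> V" "v = b + y" using HV_split by blast
  obtain c z where c: "c \<in> H" "z \<in> V" "w = c + z" using HV_split by blast
  have "h (T a b) z = 0" using T2[of a b z] aV[OF c(2)] by simp
  then have "h (T a v) w = 0"
    using HHH[OF a(1) b(1) c(1)] aV[OF b(2)] b c by (simp add: bilinear_radd[OF Tb])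
  with ne show False by simp
qed

text \<open>As \<open>T y\<close> is skew on H, this says that its square is the scalar - \<mu>
  |y|^2. The norm version is scalar valued, which suits differentiation and changes of
  charts.\<close>

definition conformal_torsion :: "('e \<Rightarrow> 'e \<Rightarrow> 'e) \<Rightarrow> real \<Rightarrow> bool" where
  "conformal_torsion T \<mu> \<longleftrightarrow> (\<forall>y\<in>V. \<forall>a\<in>H. h (T y a) (T y a) = \<mu> * h y y * h a a)"

text \<open>\<open>L\<close> stands for the curvature operator \<open>R(Jx, x)\<close>, which the Bianchi identity expresses on
  \<open>H\<close> by \<open>-2J\<phi>\<^sup>2\<close> with \<open>\<phi> = T(x, \<cdot>)\<close>; invariance of \<open>T\<close> under \<open>L\<close> then gives \<open>4\<phi>\<^sup>3 = -s\<phi>\<close>.\<close>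

lemma conformal_torsionI:
  fixes T :: "'e \<Rightarrow> 'e \<Rightarrow> 'e" and L :: "'e \<Rightarrow> 'e"
  assumes T: "mixed_form j H V (\<lambda>u v w. h (T u v) w)" and Tb: "bilinear T"
    and nondeg: "\<And>u. u \<noteq> 0 \<Longrightarrow> \<exists>v w. h (T u v) w \<noteq> 0"
    and x: "x \<in> V" "x \<noteq> 0"
    and L_skew: "\<And>u v. h (L u) v = - h u (L v)"
    and L_H: "\<And>u. u \<in> H \<Longrightarrow> L u \<in> H" and L_V: "\<And>u. u \<in> V \<Longrightarrow> L u \<in> V"
    and L_T: "\<And>u v. L (T u v) = T (L u) v + T u (L v)"
    and L: "\<And>a b. a \<in> H \<Longrightarrow> b \<in> H \<Longrightarrow> h (L a) b = h (T x a) (T (j x) b) - h (T (j x) a) (T x b)"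
  shows "\<exists>\<mu>. conformal_torsion T \<mu>"
proof -
  note [simp] = bilinear_ladd[OF Tb] bilinear_radd[OF Tb] bilinear_lneg[OF Tb] bilinear_rneg[OF Tb]
    bilinear_lmul[OF Tb] bilinear_rmul[OF Tb]
  define \<phi> where "\<phi> = T x"
  have \<phi>H: "\<phi> a \<in> H" and \<phi>j: "\<phi> (j a) = - j (\<phi> a)" and Tjx: "T (j x) a = j (\<phi> a)" if "a \<in> H" for a
    using torsion_mixed[OF T x(1) that] by (simp_all add: \<phi>_def)
  have \<phi>skew: "h (\<phi> a) b = - h a (\<phi> b)" if "a \<in> H" "b \<in> H" for a b
    using torsion_mixed(4)[OF T x(1) that] by (simp add: \<phi>_def)
  have \<phi>lin: "\<phi> (u + v) = \<phi> u + \<phi> v" "\<phi> (c *\<^sub>R u) = c *\<^sub>R \<phi> u" "\<phi> (- u) = - \<phi> u" for u v c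
    by (simp_all add: \<phi>_def)
  have La: "L a = - 2 *\<^sub>R j (\<phi> (\<phi> a))" if a: "a \<in> H" for a
  proof (rule H_eqI)
    fix b assume b: "b \<in> H"
    have "h (L a) b = - 2 * h (j (\<phi> a)) (\<phi> b)"
      using L[OF a b] Tjx[OF a] Tjx[OF b] h_j_left[of "\<phi> a" "\<phi> b"] by (simp add: \<phi>_def)
    also have "\<dots> = 2 * h (\<phi> (j (\<phi> a))) b"
      using \<phi>skew[OF j_H[OF \<phi>H[OF a]] b] by simp
    also have "\<dots> = h (- 2 *\<^sub>R j (\<phi> (\<phi> a))) b"
      using \<phi>j[OF \<phi>H[OF a]] by simp
    finally show "h (L a) b = h (- 2 *\<^sub>R j (\<phi> (\<phi> a))) b" .
  qed (use L_H a \<phi>H j_H H_subspace in \<open>auto simp: subspace_scale subspace_neg\<close>)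
  \<comment> \<open>Skewness removes the component along \<open>x\<close>, so \<open>L\<close> sends
    \<open>x\<close> to a multiple of its rotation \<open>j x\<close>.\<close>
  obtain r s where Lx: "L x = r *\<^sub>R x + s *\<^sub>R j x" by (rule V_rep[OF x L_V[OF x(1)]])
  have "r * h x x = 0" using L_skew[of x x] h_sym[of "L x" x] h_sym[of "j x" x] unfolding Lx by simp
  then have "r = 0" using x h_pos[of x] by simp
  have \<phi>2: "\<phi> (\<phi> a) = - (s / 4) *\<^sub>R a" if a: "a \<in> H" for a
  proof -
    have "L (\<phi> a) = s *\<^sub>R j (\<phi> a) + \<phi> (L a)"
      using L_T[of x a] Lx \<open>r = 0\<close> Tjx[OF a] by (simp add: \<phi>_def)
    then have "- 2 *\<^sub>R j (\<phi> (\<phi> (\<phi> a))) = s *\<^sub>R j (\<phi> a) + 2 *\<^sub>R j (\<phi> (\<phi> (\<phi> a)))"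
      using La[OF a] La[OF \<phi>H[OF a]] \<phi>j[OF \<phi>H[OF \<phi>H[OF a]]] by (simp add: \<phi>lin)
    moreover have "j (s *\<^sub>R \<phi> a + 4 *\<^sub>R \<phi> (\<phi> (\<phi> a)))
        = (s *\<^sub>R j (\<phi> a) + 2 *\<^sub>R j (\<phi> (\<phi> (\<phi> a)))) + 2 *\<^sub>R j (\<phi> (\<phi> (\<phi> a)))"
      by (simp add: add.assoc flip: scaleR_left_distrib)
    ultimately have "j (s *\<^sub>R \<phi> a + 4 *\<^sub>R \<phi> (\<phi> (\<phi> a))) = 0" by (metis ab_left_minus scaleR_minus_left)
    then have "s *\<^sub>R \<phi> a + 4 *\<^sub>R \<phi> (\<phi> (\<phi> a)) = 0" by (metis j_j j_simps(5) neg_equal_0_iff_equal)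
    \<comment> \<open>One factor \<phi> is cancelled by injectivity; this is where nondegeneracy
      enters.\<close>
    then have "T x (s *\<^sub>R a + 4 *\<^sub>R \<phi> (\<phi> a)) = 0" by (simp add: \<phi>_def)
    moreover have "s *\<^sub>R a + 4 *\<^sub>R \<phi> (\<phi> a) \<in> H"
      by (intro subspace_add subspace_scale H_subspace a \<phi>H)
    ultimately have "s *\<^sub>R a + 4 *\<^sub>R \<phi> (\<phi> a) = 0"
      using torsion_injective[OF T Tb nondeg x] by blast
    then have "(1 / 4) *\<^sub>R (s *\<^sub>R a + 4 *\<^sub>R \<phi> (\<phi> a)) = 0" by simp
    then have "(s / 4) *\<^sub>R a + \<phi> (\<phi> a) = 0" by (simp add: scaleR_add_right)
    then show ?thesis by (simp add: add_eq_0_iff2)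
  qed
  \<comment> \<open>The number \<open>s / 4\<close> belongs to the chosen \<open>x\<close>; division
    by \<open>h x x\<close> gives the constant valid for every vector of V.\<close>
  have "h (T y a) (T y a) = s / (4 * h x x) * h y y * h a a" if y: "y \<in> V" and a: "a \<in> H" for y a
  proof -
    have n: "h (\<phi> a) (\<phi> a) = s / 4 * h a a"
      using \<phi>skew[OF a \<phi>H[OF a]] \<phi>2[OF a] by simp
    obtain \<alpha> \<beta> where y': "y = \<alpha> *\<^sub>R x + \<beta> *\<^sub>R j x" by (rule V_rep[OF x y])
    have "T y a = \<alpha> *\<^sub>R \<phi> a + \<beta> *\<^sub>R j (\<phi> a)" using y' Tjx[OF a] by (simp add: \<phi>_def)
    then have "h (T y a) (T y a) = (\<alpha>\<^sup>2 + \<beta>\<^sup>2) * h (\<phi> a) (\<phi> a)"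
      using h_sym[of "j (\<phi> a)" "\<phi> a"] by (simp add: power2_eq_square algebra_simps)
    moreover have "h y y = (\<alpha>\<^sup>2 + \<beta>\<^sup>2) * h x x"
      using y' h_sym[of "j x" x] by (simp add: power2_eq_square algebra_simps)
    ultimately show ?thesis using n h_pos[OF x(2)] by (simp add: field_simps)
  qed
  then show ?thesis unfolding conformal_torsion_def by blast
qed

text \<open>If H were zero, everything would be vertical and T would vanish. Injectivity then makes
  \<open>T x a\<close> a nonzero vector, whose norm forces \<mu> to be positive.\<close>

lemma conformal_torsion_pos:
  fixes T :: "'e \<Rightarrow> 'e \<Rightarrow> 'e"
  assumes T: "mixed_form j H V (\<lambda>u v w. h (T u v) w)" and Tb: "bilinear T"
    and nondeg: "\<And>u. u \<noteq> 0 \<Longrightarrow> \<exists>v w. h (T u v) w \<noteq> 0" and \<mu>: "conformal_torsion T \<mu>"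
  shows "\<mu> > 0" and "\<exists>a\<in>H. a \<noteq> 0" and "\<exists>x\<in>V. x \<noteq> 0"
proof -
  show V: "\<exists>x\<in>V. x \<noteq> 0" using dim_V dim_eq_0[of V] by auto
  then obtain x where x: "x \<in> V" "x \<noteq> 0" by blast
  show "\<exists>a\<in>H. a \<noteq> 0"
  proof (rule ccontr)
    assume "\<not> (\<exists>a\<in>H. a \<noteq> 0)"
    then have V: "u \<in> V" for u using HV_split[of u] by auto
    obtain v w where "h (T x v) w \<noteq> 0" using nondeg[OF x(2)] by blast
    moreover have "h (T x v) w = 0" using T V unfolding mixed_form_def by blast
    ultimately show False by simp
  qed
  then obtain a where a: "a \<in> H" "a \<noteq> 0" by blast
  have "T x a \<noteq> 0" using torsion_injective[OF T Tb nondeg x a(1)] a(2) by blast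
  then have "0 < \<mu> * h x x * h a a" using \<mu> x a h_pos[of "T x a"] by (auto simp: conformal_torsion_def)
  then show "\<mu> > 0" using h_pos[OF x(2)] h_pos[OF a(2)] by (simp add: zero_less_mult_iff)
qed

text \<open>Polarization in the vertical and in the horizontal slot: the two terms that arise when
  |T(Y, A)|^2 is differentiated.\<close>

lemma conformal_torsion_polar:
  assumes Tb: "bilinear T" and \<mu>: "conformal_torsion T \<mu>" and "y \<in> V" "z \<in> V" "a \<in> H" "b \<in> H"
  shows "h (T z a) (T y a) = \<mu> * h z y * h a a" and "h (T y b) (T y a) = \<mu> * h y y * h b a"
proof -
  have c: "h (T y a) (T y a) = \<mu> * h y y * h a a" if "y \<in> V" "a \<in> H" for y a
    using \<mu> that by (simp add: conformal_torsion_def)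
  show "h (T z a) (T y a) = \<mu> * h z y * h a a"
    using c[of "z + y" a] c[of z a] c[of y a] assms subspace_add[OF V_subspace, of z y]
      h_sym[of y z] h_sym[of "T y a" "T z a"]
    by (simp add: bilinear_ladd[OF Tb] algebra_simps)
  show "h (T y b) (T y a) = \<mu> * h y y * h b a"
    using c[of y "b + a"] c[of y a] c[of y b] assms subspace_add[OF H_subspace, of b a]
      h_sym[of a b] h_sym[of "T y a" "T y b"]
    by (simp add: bilinear_radd[OF Tb] algebra_simps)
qed

end

section \<open>Complex coordinates and adapted frames\<close>

lemma sum_lessThan_double:
  fixes f :: "nat \<Rightarrow> 'b::comm_monoid_add"
  shows "(\<Sum>k<2 * n. f k) = (\<Sum>k<n. f (2 * k) + f (2 * k + 1))"
  by (induction n) (simp_all add: algebra_simps)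

lemma frame_coords_index [simp]:
  "k < N \<Longrightarrow> vec_index (frame_coords h j N E u) k = Complex (h u (E k)) (h u (j (E k)))"
  by (simp add: frame_coords_def)

lemma frame_coords_dim [simp]: "frame_coords h j N E u \<in> carrier_vec N"
  by (simp add: frame_coords_def)

context hermitian_space
begin

lemma frame_coords_add:
  "k < N \<Longrightarrow> vec_index (frame_coords h j N E (u + v)) k
     = vec_index (frame_coords h j N E u) k + vec_index (frame_coords h j N E v) k"
  by (simp add: complex_eq_iff)

lemma frame_coords_scaleR:
  "k < N \<Longrightarrow> vec_index (frame_coords h j N E (r *\<^sub>R u)) k
     = r *\<^sub>R vec_index (frame_coords h j N E u) k"
  by (simp add: complex_eq_iff)

lemma frame_coords_j:
  "k < N \<Longrightarrow> vec_index (frame_coords h j N E (j u)) k = \<i> * vec_index (frame_coords h j N E u) k"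
  by (simp add: complex_eq_iff h_j_left)

text \<open>The two slots of \<omega>0 contribute \<i> each and the conjugated slot contributes -
  \<i>.\<close>

lemma T0_frame_j:
  fixes E :: "nat \<Rightarrow> 'e" and n :: nat
  defines "f \<equiv> frame_coords h j (2 * n + 1) E"
  shows "T0 n (f (j u)) (f v) (f w) + T0 n (f u) (f (j v)) (f w) + T0 n (f u) (f v) (f (j w))
    = \<i> * T0 n (f u) (f v) (f w)"
proof -
  have o1: "omega0 n (f (j u)) (f v) = \<i> * omega0 n (f u) (f v)" for u v
    unfolding omega0_def sum_distrib_left f_def
    by (rule sum.cong) (simp_all add: frame_coords_j algebra_simps del: frame_coords_index)
  have o2: "omega0 n (f u) (f (j v)) = \<i> * omega0 n (f u) (f v)" for u v
    unfolding omega0_def sum_distrib_left f_def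
    by (rule sum.cong) (simp_all add: frame_coords_j algebra_simps del: frame_coords_index)
  have c: "cnj (vec_index (f (j u)) (2 * n)) = - \<i> * cnj (vec_index (f u) (2 * n))" for u
    unfolding f_def by (simp add: frame_coords_j del: frame_coords_index)
  show ?thesis
    unfolding T0_def wedge21_def o1 o2 c by (simp add: algebra_simps)
qed

end

context hermitian_splitting
begin

lemma adapted_frame:
  fixes T :: "'e \<Rightarrow> 'e \<Rightarrow> 'e"
  assumes T: "mixed_form j H V (\<lambda>u v w. h (T u v) w)" and Tb: "bilinear T"
    and \<mu>: "conformal_torsion T \<mu>" "\<mu> > 0"
  shows "\<exists>n E. dim H = 4 * n \<and> unitary_frame h j (2 * n + 1) E \<and> (\<forall>k<2 * n. E k \<in> H) \<and> E (2 * n) \<in> V \<and>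
    (\<forall>u v w. h (T u v) w = sqrt \<mu> * Re (T0 n (frame_coords h j (2 * n + 1) E u)
        (frame_coords h j (2 * n + 1) E v) (frame_coords h j (2 * n + 1) E w)))"
proof -
  note [simp] = bilinear_ladd[OF Tb] bilinear_radd[OF Tb] bilinear_lneg[OF Tb] bilinear_rneg[OF Tb]
    bilinear_lmul[OF Tb] bilinear_rmul[OF Tb]
  obtain x0 where x0: "x0 \<in> V" "x0 \<noteq> 0"
    using dim_V dim_eq_0[of V] by auto
  define x where "x = (1 / sqrt (h x0 x0)) *\<^sub>R x0"
  have x: "x \<in> V" "h x x = 1"
    using x0 h_pos[OF x0(2)] V_subspace by (auto simp: x_def subspace_scale real_div_sqrt field_simps)
  have x_ne: "x \<noteq> 0" using x(2) by auto
  \<comment> \<open>The factor makes \<open>K\<close> an isometry of H; being also skew, it squares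
    to -1.\<close>
  define K where "K = (\<lambda>a. (1 / sqrt \<mu>) *\<^sub>R T x a)"
  have s\<mu>: "sqrt \<mu> * sqrt \<mu> = \<mu>" "sqrt \<mu> > 0" using \<mu> by simp_all
  have K: "linear K" unfolding K_def by (rule linearI) (simp_all add: scaleR_add_right)
  have KH: "K a \<in> H" if "a \<in> H" for a
    using torsion_mixed(1)[OF T x(1) that] H_subspace by (simp add: K_def subspace_scale)
  have Kj: "K (j a) = - j (K a)" if "a \<in> H" for a
    using torsion_mixed(2)[OF T x(1) that] by (simp add: K_def)
  have hK: "h (K a) b = - h a (K b)" if "a \<in> H" "b \<in> H" for a b
    using torsion_mixed(4)[OF T x(1) that] by (simp add: K_def)
  have n1: "h (K a) (K a) = h a a" if "a \<in> H" for a
    using \<mu>(1) x that s\<mu> by (simp add: K_def conformal_torsion_def field_simps)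
  have n2: "h (K a) (K b) = h a b" if "a \<in> H" "b \<in> H" for a b
    using n1[of "a + b"] n1[OF that(1)] n1[OF that(2)] subspace_add[OF H_subspace that]
      h_sym[of a b] h_sym[of "K a" "K b"] by (simp add: linear_add[OF K])
  have KK: "K (K a) = - a" if a: "a \<in> H" for a
    by (rule H_eqI) (use hK[OF KH[OF a]] n2[OF a] KH a subspace_neg[OF H_subspace] in auto)
  obtain n E where nE: "dim H = 4 * n" "\<And>k. k < 2 * n \<Longrightarrow> E k \<in> H"
     "\<And>k l. k < 2 * n \<Longrightarrow> l < 2 * n \<Longrightarrow> h (E k) (E l) = (if k = l then 1 else 0) \<and> h (E k) (j (E l)) = 0"
     "\<And>k. k < n \<Longrightarrow> E (2 * k + 1) = K (E (2 * k))"
     "\<And>w. w \<in> H \<Longrightarrow> \<forall>k<2 * n. h w (E k) = 0 \<and> h w (j (E k)) = 0 \<Longrightarrow> w = 0"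
    using quaternionic_frame[OF H_subspace K j_H KH KK Kj hK] by blast
  \<comment> \<open>The horizontal quaternionic frame completed by the unit vertical vector that
    defines \<open>K\<close>.\<close>
  define F where "F = (\<lambda>k. if k < 2 * n then E k else x)"
  have Fk: "F k = E k" if "k < 2 * n" for k using that by (simp add: F_def)
  have Fn: "F (2 * n) = x" by (simp add: F_def)
  have expand: "b = (\<Sum>k<2 * n. h b (E k) *\<^sub>R E k + h b (j (E k)) *\<^sub>R j (E k))" if b: "b \<in> H" for b
  proof -
    let ?s = "\<Sum>k<2 * n. h b (E k) *\<^sub>R E k + h b (j (E k)) *\<^sub>R j (E k)"
    have hl: "h (sum f {..<2 * n}) w = (\<Sum>k<2 * n. h (f k) w)" for f w
      using linear_sum[of "\<lambda>u. h u w"] h_bilinear by (simp add: bilinear_def)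
    have "b - ?s \<in> H"
      by (intro subspace_diff subspace_sum H_subspace b subspace_add subspace_scale nE j_H) auto
    moreover have "h (b - ?s) (E l) = 0 \<and> h (b - ?s) (j (E l)) = 0" if l: "l < 2 * n" for l
    proof -
      have "h ?s (E l) = (\<Sum>k<2 * n. if k = l then h b (E l) else 0)"
        unfolding hl by (rule sum.cong) (use nE(3) l in \<open>auto simp: h_j_left\<close>)
      moreover have "h ?s (j (E l)) = (\<Sum>k<2 * n. if k = l then h b (j (E l)) else 0)"
        unfolding hl by (rule sum.cong) (use nE(3) l in auto)
      ultimately show ?thesis using l by simp
    qed
    ultimately have "b - ?s = 0" using nE(5) by blast
    then show ?thesis by simp
  qed
  let ?f = "frame_coords h j (2 * n + 1) F"
  \<comment> \<open>The relation between odd and even frame vectors makes the expansion of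
    \<open>b\<close> reproduce the symplectic pairs of \<open>omega0\<close>.\<close>
  have hKa: "h (K a) b = Re (omega0 n (?f a) (?f b))" if a: "a \<in> H" and b: "b \<in> H" for a b
  proof -
    have hr: "h (K a) (sum f {..<2 * n}) = (\<Sum>k<2 * n. h (K a) (f k))" for f
      using linear_sum[of "\<lambda>u. h (K a) u"] h_bilinear by (simp add: bilinear_def)
    have "h (K a) b = (\<Sum>k<2 * n. h b (E k) * h (K a) (E k) + h b (j (E k)) * h (K a) (j (E k)))"
      by (subst expand[OF b]) (simp add: hr)
    also have "\<dots> = (\<Sum>k<n. Re (vec_index (?f a) (2 * k) * vec_index (?f b) (2 * k + 1)
                        - vec_index (?f a) (2 * k + 1) * vec_index (?f b) (2 * k)))"
      unfolding sum_lessThan_double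
    proof (rule sum.cong)
      fix k assume "k \<in> {..<n}"
      then have k: "k < n" by simp
      then have E0: "E (2 * k) \<in> H" and E1: "E (2 * k + 1) = K (E (2 * k))" using nE by auto
      have 1: "h (K a) (E (2 * k)) = - h a (E (2 * k + 1))"
        using hK[OF a E0] E1 by simp
      have 2: "h (K a) (j (E (2 * k))) = h a (j (E (2 * k + 1)))"
        using hK[OF a j_H[OF E0]] E1 Kj[OF E0] by simp
      have 3: "h (K a) (E (2 * k + 1)) = h a (E (2 * k))"
        using n2[OF a E0] E1 by simp
      have 4: "h (K a) (j (E (2 * k + 1))) = - h a (j (E (2 * k)))"
        using hK[OF a j_H[OF KH[OF E0]]] E1 Kj[OF KH[OF E0]] KK[OF E0] by simp
      have "2 * k + 1 < 2 * n" using k by simp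
      then show "h b (E (2 * k)) * h (K a) (E (2 * k)) + h b (j (E (2 * k))) * h (K a) (j (E (2 * k))) +
         (h b (E (2 * k + 1)) * h (K a) (E (2 * k + 1)) + h b (j (E (2 * k + 1))) * h (K a) (j (E (2 * k + 1))))
         = Re (vec_index (?f a) (2 * k) * vec_index (?f b) (2 * k + 1)
                        - vec_index (?f a) (2 * k + 1) * vec_index (?f b) (2 * k))"
        unfolding 1 2 3 4 by (simp add: Fk algebra_simps)
    qed simp
    also have "\<dots> = Re (omega0 n (?f a) (?f b))" by (simp add: omega0_def)
    finally show ?thesis .
  qed
  define om where "om = (\<lambda>u v. omega0 n (?f u) (?f v))"
  define ze where "ze = (\<lambda>u. vec_index (?f u) (2 * n))"
  have T0f: "T0 n (?f u) (?f v) (?f w) = om u v * cnj (ze w) + om v w * cnj (ze u) + om w u * cnj (ze v)" for u v w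
    by (simp add: T0_def wedge21_def om_def ze_def)
  \<comment> \<open>The difference between T and its claimed model. It is again a mixed form, so
    checking it on H x H x V suffices.\<close>
  define G where "G = (\<lambda>u v w. h (T u v) w - sqrt \<mu> * Re (om u v * cnj (ze w) + om v w * cnj (ze u) + om w u * cnj (ze v)))"
  have o_swap: "om u v = - om v u" for u v
    unfolding om_def omega0_def sum_negf[symmetric] by (rule sum.cong) simp_all
  have o_lin: "om (u + u') v = om u v + om u' v" "om (r *\<^sub>R u) v = r *\<^sub>R om u v" for u u' v r
    unfolding om_def omega0_def sum.distrib[symmetric] scaleR_right.sum
    by (rule sum.cong; simp add: frame_coords_add frame_coords_scaleR algebra_simps del: frame_coords_index)+
  have o_lin2: "om v (u + u') = om v u + om v u'" "om v (r *\<^sub>R u) = r *\<^sub>R om v u" for u u' v r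
    using o_lin o_swap[of v] by simp_all
  have c_lin: "ze (u + u') = ze u + ze u'" "ze (r *\<^sub>R u) = r *\<^sub>R ze u" for u u' r
    by (simp_all add: ze_def frame_coords_add frame_coords_scaleR del: frame_coords_index)
  have o_V: "om y u = 0" if "y \<in> V" for y u
    using HV_orth[OF nE(2) that] HV_orth[OF j_H[OF nE(2)] that] h_sym[of y]
    by (simp add: om_def omega0_def Fk Complex_eq)
  have o_V2: "om u y = 0" if "y \<in> V" for y u
    using o_V[OF that, of u] o_swap[of u y] by simp
  have c_H: "ze a = 0" if "a \<in> H" for a
    using HV_orth[OF that x(1)] HV_orth[OF that j_V[OF x(1)]] by (simp add: ze_def Fn Complex_eq)
  have oj: "om (j u) v = \<i> * om u v" for u v
    unfolding om_def omega0_def sum_distrib_left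
    by (rule sum.cong) (simp_all add: frame_coords_j algebra_simps del: frame_coords_index)
  have cj: "ze (j u) = \<i> * ze u" for u
    by (simp add: ze_def frame_coords_j del: frame_coords_index)
  have T1: "h (T u v) w = - h (T v u) w" and T2: "h (T u v) w = - h (T u w) v"
    and THHH: "a \<in> H \<Longrightarrow> b \<in> H \<Longrightarrow> c \<in> H \<Longrightarrow> h (T a b) c = 0"
    and TVV: "x \<in> V \<Longrightarrow> y \<in> V \<Longrightarrow> h (T x y) u = 0" 
    and Tj: "a \<in> H \<Longrightarrow> b \<in> H \<Longrightarrow> x \<in> V \<Longrightarrow> h (T (j a) b) x = - h (T a b) (j x)" for u v w a b c x y
    using T unfolding mixed_form_def alternating3_def by blast+
  have "mixed_form j H V G"
    unfolding mixed_form_def alternating3_def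
  proof (intro conjI allI ballI)
    show "linear (G u v)" for u v
      by (rule linearI) (simp_all add: G_def o_lin o_lin2 c_lin algebra_simps)
    show "G u v w = - G v u w" for u v w
      using T1[of u v w] o_swap[of u v] o_swap[of v w] o_swap[of w u]
      by (simp add: G_def algebra_simps)
    show "G u v w = - G u w v" for u v w
      using T2[of u v w] o_swap[of u v] o_swap[of v w] o_swap[of w u]
      by (simp add: G_def algebra_simps)
    show "G a b c = 0" if "a \<in> H" "b \<in> H" "c \<in> H" for a b c
      using that by (simp add: G_def THHH c_H)
    show "G y z u = 0" if "y \<in> V" "z \<in> V" for y z u
      using that by (simp add: G_def TVV o_V o_V2)
    show "G (j a) b y = - G a b (j y)" if "a \<in> H" "b \<in> H" "y \<in> V" for a b y
      using that by (simp add: G_def Tj c_H j_H j_V oj cj o_V o_V2 algebra_simps)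
  qed
  moreover have "G a b y = 0" if a: "a \<in> H" and b: "b \<in> H" and y: "y \<in> V" for a b y
  proof -
    have cx: "ze x = 1" using x by (simp add: ze_def Fn complex_eq_iff)
    have Gx: "G a b x = 0" if a: "a \<in> H" and b: "b \<in> H" for a b
    proof -
      have "h (T a b) x = h (T x a) b" using T1[of a b x] T2[of b a x] T1[of b x a] T2[of x b a] by linarith
      also have "\<dots> = sqrt \<mu> * h (K a) b" using s\<mu> by (simp add: K_def)
      finally have "h (T a b) x = sqrt \<mu> * Re (om a b)" by (simp add: om_def hKa[OF a b])
      then show ?thesis
        using a b x(1) by (simp add: G_def c_H cx)
    qed
    \<comment> \<open>The check is needed only at the single vector \<open>x\<close>: the type
      condition supplies \<open>j x\<close>, and these two span V.\<close>
    have "G (j a) b x = - G a b (j x)"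
      using \<open>mixed_form j H V G\<close> a b x(1) unfolding mixed_form_def by blast
    then have "G a b (j x) = 0" using Gx[OF j_H[OF a] b] by simp
    moreover obtain \<alpha> \<beta> where "y = \<alpha> *\<^sub>R x + \<beta> *\<^sub>R j x" by (rule V_rep[OF x(1) x_ne y])
    moreover have "linear (G a b)" using \<open>mixed_form j H V G\<close> unfolding mixed_form_def alternating3_def by blast
    ultimately show ?thesis using Gx[OF a b] by (simp add: linear_add linear_cmul)
  qed
  ultimately have "G u v w = 0" for u v w by (rule mixed_form_eq_0)
  then have form: "h (T u v) w = sqrt \<mu> * Re (T0 n (?f u) (?f v) (?f w))" for u v w
    unfolding T0f by (simp add: G_def)
  have "DIM('e) = 2 * (2 * n + 1)"
  proof -
    have "{u + v |u v. u \<in> H \<and> v \<in> V} = UNIV" using HV_split by blast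
    moreover have "H \<inter> V = {0}"
      using HV_orth h_eq_0 subspace_0[OF H_subspace] subspace_0[OF V_subspace] by auto
    ultimately show ?thesis
      using dim_sums_Int[OF H_subspace V_subspace] nE(1) dim_V by simp
  qed
  moreover have "h (F k) (F l) = (if k = l then 1 else 0) \<and> h (F k) (j (F l)) = 0"
    if "k < 2 * n + 1" "l < 2 * n + 1" for k l
  proof -
    have "k < 2 * n \<or> k = 2 * n" "l < 2 * n \<or> l = 2 * n" using that by auto
    then show ?thesis
      using nE(3)[of k l] x HV_orth[OF nE(2) x(1), of k] HV_orth[OF nE(2) x(1), of l]
        HV_orth[OF nE(2) j_V[OF x(1)], of k] HV_orth[OF j_H[OF nE(2)] x(1), of l]
        h_sym[of x "E l"] h_sym[of x "j (E l)"]
      by (auto simp: Fk Fn)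
  qed
  ultimately have "unitary_frame h j (2 * n + 1) F" by (simp add: unitary_frame_def)
  moreover have "\<forall>k<2 * n. F k \<in> H" using nE(2) Fk by simp
  moreover have "F (2 * n) \<in> V" using Fn x by simp
  ultimately show ?thesis using nE(1) form by blast
qed

end

section \<open>Unitary frames and the stabilizer of the model form\<close>

locale unitary_framed_space = hermitian_space h j
  for h :: "'e::euclidean_space \<Rightarrow> 'e \<Rightarrow> real" and j :: "'e \<Rightarrow> 'e" +
  fixes N :: nat and E :: "nat \<Rightarrow> 'e"
  assumes frame: "unitary_frame h j N E"
begin

abbreviation "f \<equiv> frame_coords h j N E"

lemma frame_orth:
  assumes "k < N" "l < N"
  shows "h (E k) (E l) = (if k = l then 1 else 0)" "h (E k) (j (E l)) = 0" "h (j (E k)) (E l) = 0"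
  using assms frame h_j_left[of "E k" "E l"] by (auto simp: unitary_frame_def)

text \<open>Each pair \<open>E k\<close>, \<open>j (E k)\<close> lowers the dimension of the
  orthogonal complement by two, and the real dimension is exactly \<open>2 * N\<close>.\<close>

lemma frame_complete:
  assumes "\<And>k. k < N \<Longrightarrow> h w (E k) = 0 \<and> h w (j (E k)) = 0"
  shows "w = 0"
proof -
  define D where "D = (\<lambda>k. dim {w. \<forall>l<k. h w (E l) = 0 \<and> h w (j (E l)) = 0})"
  have "D k + 2 * k = DIM('e)" if "k \<le> N" for k
    using that
  proof (induction k)
    case 0
    show ?case by (simp add: D_def)
  next
    case (Suc k)
    let ?W = "{w. \<forall>l<k. h w (E l) = 0 \<and> h w (j (E l)) = 0}"
    let ?W' = "{w\<in>?W. h w (E k) = 0}"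
    have sub: "subspace ?W" "subspace ?W'" by (auto simp: subspace_def)
    have mem: "E k \<in> ?W" "j (E k) \<in> ?W'" "h (E k) (E k) = 1" "h (j (E k)) (j (E k)) = 1"
      using Suc.prems frame_orth[of k] by auto
    have "dim ?W = dim {w\<in>?W'. h w (j (E k)) = 0} + 2"
      using dim_orthogonal[OF sub(1) mem(1,3)] dim_orthogonal[OF sub(2) mem(2,4)] by linarith
    moreover have "{w\<in>?W'. h w (j (E k)) = 0} = {w. \<forall>l<Suc k. h w (E l) = 0 \<and> h w (j (E l)) = 0}"
      by (auto simp: less_Suc_eq)
    ultimately have "D k = D (Suc k) + 2" unfolding D_def by (simp only:)
    then show ?case using Suc.IH[OF Suc_leD[OF Suc.prems]] by simp
  qed
  from this[of N] have "D N = 0"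
    using frame by (simp add: unitary_frame_def)
  then have "{w. \<forall>l<N. h w (E l) = 0 \<and> h w (j (E l)) = 0} \<subseteq> {0}" by (simp only: dim_eq_0 D_def)
  then show ?thesis using assms by blast
qed

definition of_coords :: "(nat \<Rightarrow> complex) \<Rightarrow> 'e" where
  "of_coords z = (\<Sum>k<N. Re (z k) *\<^sub>R E k + Im (z k) *\<^sub>R j (E k))"

lemma h_sum_left: "h (sum F I) w = (\<Sum>k\<in>I. h (F k) w)"
  using linear_sum[of "\<lambda>u. h u w"] h_bilinear by (simp add: bilinear_def)

lemma frame_coords_of_coords:
  assumes l: "l < N"
  shows "vec_index (f (of_coords z)) l = z l"
proof -
  have "h (of_coords z) (E l) = (\<Sum>k<N. if k = l then Re (z l) else 0)"
    unfolding of_coords_def h_sum_left by (rule sum.cong) (use l in \<open>auto simp: frame_orth\<close>)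
  moreover have "h (of_coords z) (j (E l)) = (\<Sum>k<N. if k = l then Im (z l) else 0)"
    unfolding of_coords_def h_sum_left by (rule sum.cong) (use l in \<open>auto simp: frame_orth\<close>)
  ultimately show ?thesis using l by (simp add: complex_eq_iff)
qed

lemma of_coords_frame_coords: "of_coords (vec_index (f u)) = u"
proof -
  have "u - of_coords (vec_index (f u)) = 0"
  proof (rule frame_complete)
    fix k assume k: "k < N"
    have "vec_index (f (of_coords (vec_index (f u)))) k = vec_index (f u) k"
      by (rule frame_coords_of_coords[OF k])
    then show "h (u - of_coords (vec_index (f u))) (E k) = 0 \<and> h (u - of_coords (vec_index (f u))) (j (E k)) = 0"
      using k by (simp add: complex_eq_iff)
  qed
  then show ?thesis by simp
qed

text \<open>The real part is \<open>h\<close> computed in an orthonormal real basis; the imaginary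
  part is minus the real part with \<open>v\<close> replaced by \<open>j v\<close>.\<close>

lemma hermitian_frame_coords:
  "(\<Sum>k<N. cnj (vec_index (f u) k) * vec_index (f v) k) = Complex (h u v) (- h u (j v))"
proof -
  have re: "(\<Sum>k<N. Re (cnj (vec_index (f u) k) * vec_index (f v) k)) = h u v" for u v
  proof -
    have "h u v = h (\<Sum>k<N. Re (vec_index (f u) k) *\<^sub>R E k + Im (vec_index (f u) k) *\<^sub>R j (E k)) v"
      using of_coords_frame_coords[of u] by (simp add: of_coords_def)
    also have "\<dots> = (\<Sum>k<N. Re (cnj (vec_index (f u) k) * vec_index (f v) k))"
      unfolding h_sum_left by (rule sum.cong) (simp_all add: h_sym[of _ v])
    finally show ?thesis by simp
  qed
  have "(\<Sum>k<N. Im (cnj (vec_index (f u) k) * vec_index (f v) k)) = - h u (j v)"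
    unfolding re[of u "j v", symmetric] sum_negf[symmetric]
    by (rule sum.cong) (simp_all add: frame_coords_j del: frame_coords_index)
  then show ?thesis using re[of u v] by (simp add: complex_eq_iff)
qed

text \<open>A map \<open>P\<close> in \<open>parallel_transport\<close> is a priori just a function;
  expanding the squared norm of the linearity defect shows that preserving \<open>h\<close> makes it
  linear.\<close>

lemma isometry_linear:
  assumes "\<And>u v. h (P u) (P v) = h u v"
  shows "linear P"
proof (rule linearI)
  show "P (u + v) = P u + P v" for u v
    using h_eq_0[of "P (u + v) - (P u + P v)"] by (simp add: assms h_sym algebra_simps)
  show "P (r *\<^sub>R u) = r *\<^sub>R P u" for r u
    using h_eq_0[of "P (r *\<^sub>R u) - r *\<^sub>R P u"] by (simp add: assms algebra_simps)
qed

lemma isometry_surj: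
  assumes "\<And>u v. h (P u) (P v) = h u v"
  shows "surj P"
proof -
  note lin = isometry_linear[OF assms]
  have "inj P"
    using linear_injective_0[OF lin] assms[of _ _] h_eq_0 by (metis h_simps(9))
  then show ?thesis using linear_injective_imp_surjective[OF lin] by simp
qed

end

lemma omega0_cong:
  assumes "\<And>k. k < 2 * n \<Longrightarrow> vec_index z k = vec_index z' k" "\<And>k. k < 2 * n \<Longrightarrow> vec_index w k = vec_index w' k"
  shows "omega0 n z w = omega0 n z' w'"
  unfolding omega0_def by (rule sum.cong) (use assms in auto)

lemma omega0_scale:
  assumes "\<And>k. k < 2 * n \<Longrightarrow> vec_index z' k = c * vec_index z k" "\<And>k. k < 2 * n \<Longrightarrow> vec_index w' k = c * vec_index w k"
  shows "omega0 n z' w' = c\<^sup>2 * omega0 n z w"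
  unfolding omega0_def sum_distrib_left
  by (rule sum.cong) (use assms in \<open>auto simp: power2_eq_square algebra_simps\<close>)

text \<open>Splitting off the part of \<open>T0 n\<close> that is antilinear in the last argument shows that its
  stabilizer in \<open>U(2n+1)\<close> preserves the product of \<open>\<omega>\<^sub>0\<close> with the last antiholomorphic coordinate;
  this forces the block form.\<close>

lemma (in unitary_framed_space) acts_via_rho_SpU1:
  assumes N: "N = 2 * n + 1" and n: "n > 0"
    and Ph: "\<And>u v. h (P u) (P v) = h u v" and Pj: "\<And>u. P (j u) = j (P u)"
    and PT: "\<And>u v w. T0 n (f (P u)) (f (P v)) (f (P w)) = T0 n (f u) (f v) (f w)"
  shows "acts_via h j N E (rho_SpU1 n) P"
proof -
  have lin: "linear P" by (rule isometry_linear[OF Ph])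
  define om where "om = (\<lambda>u v. omega0 n (f u) (f v))"
  define ze where "ze = (\<lambda>u. vec_index (f u) (2 * n))"
  have T0f: "T0 n (f u) (f v) (f w) = om u v * cnj (ze w) + om v w * cnj (ze u) + om w u * cnj (ze v)" for u v w
    by (simp add: T0_def wedge21_def om_def ze_def)
  have o1: "om (j u) v = \<i> * om u v" and o2: "om u (j v) = \<i> * om u v" for u v
    unfolding om_def omega0_def sum_distrib_left
    by (rule sum.cong; use N in \<open>simp add: frame_coords_j algebra_simps del: frame_coords_index\<close>)+
  have c: "ze (j u) = \<i> * ze u" for u
    unfolding ze_def by (rule frame_coords_j) (use N in simp)
  \<comment> \<open>Adding \<i> times the value at \<open>j w\<close> cancels the terms complex
    linear in \<open>w\<close> and doubles the antilinear one.\<close>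
  have split: "2 * (om u v * cnj (ze w)) = T0 n (f u) (f v) (f w) + \<i> * T0 n (f u) (f v) (f (j w))" for u v w
    unfolding T0f o1 o2 c by (simp add: algebra_simps)
  have inv: "om (P u) (P v) * cnj (ze (P w)) = om u v * cnj (ze w)" for u v w
  proof -
    have "2 * (om (P u) (P v) * cnj (ze (P w))) = 2 * (om u v * cnj (ze w))"
      unfolding split using PT[of u v w] PT[of u v "j w"] by (simp add: Pj)
    then show ?thesis by simp
  qed
  have fE: "vec_index (f (E l)) k = (if k = l then 1 else 0)" if "k < N" "l < N" for k l
    using that by (simp add: frame_orth complex_eq_iff)
  have lt: "2 * n < N" "0 < N" "Suc 0 < N" using N n by auto
  have lt2: "2 * k < N" "Suc (2 * k) < N" if "k < n" for k using N that by auto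
  have lt3: "k < N" if "k < 2 * n" for k using N that by simp
  have fE2n: "ze (E (2 * n)) = 1" unfolding ze_def using fE[OF lt(1) lt(1)] by (simp only: refl if_True)
  define d where "d = ze (P (E (2 * n)))"
  have om01: "om (E 0) (E 1) = 1"
  proof -
    have "om (E 0) (E 1) = (\<Sum>k<n. if k = 0 then 1 else 0)"
      unfolding om_def omega0_def by (rule sum.cong) (auto simp: fE lt lt2 simp del: frame_coords_index)
    then show ?thesis using n by simp
  qed
  \<comment> \<open>With \<omega>0 equal to 1 on the first two frame vectors, the invariance says
    that \<open>P\<close> only rescales the last coordinate; this makes the last row of the matrix
    zero off the diagonal.\<close>
  define \<kappa> where "\<kappa> = om (P (E 0)) (P (E 1))"
  have \<kappa>: "\<kappa> * cnj (ze (P w)) = cnj (ze w)" for w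
    using inv[of "E 0" "E 1" w] om01 by (simp add: \<kappa>_def)
  have \<kappa>d: "\<kappa> * cnj d = 1"
    using \<kappa>[of "E (2 * n)"] fE2n by (simp add: d_def)
  have row: "ze (P (E l)) = 0" if "l < 2 * n" for l
  proof -
    have "ze (E l) = 0" unfolding ze_def using fE[OF lt(1), of l] lt that by (simp del: frame_coords_index)
    then show ?thesis using \<kappa>[of "E l"] \<kappa>d by auto
  qed
  have norm_coord: "(cmod (vec_index (f u) k))\<^sup>2 \<le> h u u" if "k < N" for u k
  proof -
    have "(\<Sum>k<N. (cmod (vec_index (f u) k))\<^sup>2) = Re (\<Sum>k<N. cnj (vec_index (f u) k) * vec_index (f u) k)"
      unfolding Re_sum by (rule sum.cong) (simp_all only: cmod_power2, simp add: power2_eq_square del: frame_coords_index)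
    also have "\<dots> = h u u" unfolding hermitian_frame_coords by simp
    finally have "(\<Sum>k<N. (cmod (vec_index (f u) k))\<^sup>2) = h u u" .
    then show ?thesis
      using member_le_sum[of k "{..<N}" "\<lambda>k. (cmod (vec_index (f u) k))\<^sup>2"] that by simp
  qed
  have hE: "h (E k) (E k) = 1" if "k < N" for k using frame_orth that by simp
  \<comment> \<open>Both \<open>d\<close> and the conjugate of \<kappa> are last coordinates of unit
    vectors, namely of the image and of the preimage of the last frame vector; since \<kappa> times
    the conjugate of \<open>d\<close> is 1, neither modulus can be below 1.\<close>
  have d1: "cmod d = 1"
  proof -
    have "(cmod d)\<^sup>2 \<le> 1"
      using norm_coord[OF lt(1), of "P (E (2 * n))"] hE[OF lt(1)] unfolding d_def ze_def Ph by linarith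
    then have "cmod d \<le> 1" by (simp add: abs_square_le_1)
    obtain w where w: "E (2 * n) = P w" using isometry_surj[OF Ph] by (metis surj_def)
    have "\<kappa> = cnj (ze w)"
      using \<kappa>[of w] fE2n by (simp add: w[symmetric])
    moreover have "(cmod (ze w))\<^sup>2 \<le> 1"
      using norm_coord[OF lt(1), of w] hE[OF lt(1)] Ph[of w w] unfolding w ze_def by linarith
    ultimately have "cmod \<kappa> \<le> 1" by (simp add: abs_square_le_1)
    have "cmod \<kappa> * cmod d = 1" using \<kappa>d by (metis complex_mod_cnj norm_mult norm_one)
    then have "cmod d \<ge> 1" using \<open>cmod \<kappa> \<le> 1\<close> mult_right_mono[of "cmod \<kappa>" 1 "cmod d"] by simp
    with \<open>cmod d \<le> 1\<close> show ?thesis by simp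
  qed
  have dd: "d * cnj d = 1" using d1 by (simp flip: complex_norm_square)
  have om_P: "om (P u) (P v) = d * om u v" for u v
  proof -
    have "om (P u) (P v) * cnj d = om u v" using inv[of u v "E (2 * n)"] fE2n by (simp add: d_def)
    then have "om (P u) (P v) * (d * cnj d) = d * om u v" by (simp add: mult.left_commute)
    then show ?thesis unfolding dd by simp
  qed
  have herm: "(\<Sum>k<N. cnj (vec_index (f (P (E l))) k) * vec_index (f (P (E m))) k) = (if l = m then 1 else 0)"
    if "l < N" "m < N" for l m
    unfolding hermitian_frame_coords using frame_orth that
    by (simp add: Ph Pj[symmetric] complex_eq_iff)
  \<comment> \<open>The image of the last frame vector has norm one, which its last coordinate
    already exhausts.\<close>
  have col: "vec_index (f (P (E (2 * n)))) k = 0" if "k < 2 * n" for k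
  proof -
    let ?g = "\<lambda>k. (cmod (vec_index (f (P (E (2 * n)))) k))\<^sup>2"
    have "(\<Sum>k<N. ?g k) = Re (\<Sum>k<N. cnj (vec_index (f (P (E (2 * n)))) k) * vec_index (f (P (E (2 * n)))) k)"
      unfolding Re_sum by (rule sum.cong) (simp_all only: cmod_power2, simp add: power2_eq_square del: frame_coords_index)
    also have "\<dots> = 1" unfolding herm[OF lt(1) lt(1)] by simp
    finally have "(\<Sum>k<Suc (2 * n). ?g k) = 1" using N by simp
    moreover have "?g (2 * n) = 1" using d1 unfolding d_def ze_def by simp
    ultimately have "(\<Sum>k<2 * n. ?g k) = 0" unfolding sum.lessThan_Suc by linarith
    then have "?g k = 0" using that by (simp add: sum_nonneg_eq_0_iff del: frame_coords_index)
    then show ?thesis by simp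
  qed
  \<comment> \<open>\<open>P\<close> multiplies \<omega>0 by \<open>d\<close>. Dividing the
    horizontal block by a square root of \<open>d\<close> makes it symplectic and leaves
    \<open>b\<close> squared, that is \<open>d\<close>, in the last entry.\<close>
  define b where "b = csqrt d"
  have b2: "b\<^sup>2 = d" by (simp add: b_def)
  have b1: "cmod b = 1" using arg_cong[OF b2, of cmod] d1 norm_ge_zero[of b] by (auto simp: norm_power power2_eq_1_iff)
  have b0: "b \<noteq> 0" using b1 by auto
  have bb: "cnj b * b = 1" using b1 by (simp add: complex_norm_square[symmetric] mult.commute)
  define a where "a = Matrix.mat (2 * n) (2 * n) (\<lambda>(k, l). vec_index (f (P (E l))) k / b)"
  define B where "B = Matrix.mat N N (\<lambda>(k, l). vec_index (f (P (E l))) k)"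
  have P_coords: "vec_index (f (P u)) k = (\<Sum>l<N. vec_index (f (P (E l))) k * vec_index (f u) l)" if k: "k < N" for u k
  proof -
    have "P u = P (of_coords (vec_index (f u)))" by (simp add: of_coords_frame_coords)
    also have "\<dots> = (\<Sum>l<N. Re (vec_index (f u) l) *\<^sub>R P (E l) + Im (vec_index (f u) l) *\<^sub>R j (P (E l)))"
      unfolding of_coords_def linear_sum[OF lin] by (simp add: linear_add[OF lin] linear_cmul[OF lin] Pj)
    finally have Pu: "P u = (\<Sum>l<N. Re (vec_index (f u) l) *\<^sub>R P (E l) + Im (vec_index (f u) l) *\<^sub>R j (P (E l)))" .
    have fs: "vec_index (f (sum F {..<N})) k = (\<Sum>l<N. vec_index (f (F l)) k)" for F
      using k by (simp add: h_sum_left complex_eq_iff)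
    show ?thesis
      by (subst Pu, subst fs, rule sum.cong)
        (use k in \<open>simp_all add: frame_coords_add frame_coords_scaleR frame_coords_j complex_eq_iff algebra_simps del: frame_coords_index\<close>)
  qed
  have Bu: "f (P u) = B *\<^sub>v f u" for u
  proof (rule eq_vecI)
    show "dim_vec (f (P u)) = dim_vec (B *\<^sub>v f u)" by (simp add: B_def frame_coords_def)
    fix k assume "k < dim_vec (B *\<^sub>v f u)"
    then have k: "k < N" by (simp add: B_def)
    show "vec_index (f (P u)) k = vec_index (B *\<^sub>v f u) k"
      unfolding P_coords[OF k, of u] using k frame_coords_dim[of h j N E u]
      by (simp add: B_def scalar_prod_def atLeast0LessThan del: frame_coords_index frame_coords_dim)
  qed
  have block: "B = four_block_mat (b \<cdot>\<^sub>m a) (0\<^sub>m (2 * n) 1) (0\<^sub>m 1 (2 * n)) (b\<^sup>2 \<cdot>\<^sub>m 1\<^sub>m 1)"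
  proof (rule eq_matI)
    fix k l
    assume "k < dim_row (four_block_mat (b \<cdot>\<^sub>m a) (0\<^sub>m (2 * n) 1) (0\<^sub>m 1 (2 * n)) (b\<^sup>2 \<cdot>\<^sub>m 1\<^sub>m 1))"
      and "l < dim_col (four_block_mat (b \<cdot>\<^sub>m a) (0\<^sub>m (2 * n) 1) (0\<^sub>m 1 (2 * n)) (b\<^sup>2 \<cdot>\<^sub>m 1\<^sub>m 1))"
    then have kl: "k < 2 * n \<or> k = 2 * n" "l < 2 * n \<or> l = 2 * n" by (auto simp: a_def)
    then show "B $$ (k, l) = four_block_mat (b \<cdot>\<^sub>m a) (0\<^sub>m (2 * n) 1) (0\<^sub>m 1 (2 * n)) (b\<^sup>2 \<cdot>\<^sub>m 1\<^sub>m 1) $$ (k, l)"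
      using row[of l] col[of k] b0 b2 N
      by (auto simp: B_def a_def ze_def d_def simp del: frame_coords_index)
  qed (use N in \<open>simp_all add: B_def a_def\<close>)
  have a_unitary: "a \<in> unitary_group (2 * n)"
    unfolding unitary_group_def
  proof (intro CollectI conjI eq_matI)
    fix k l assume "k < dim_row (1\<^sub>m (2 * n) :: complex mat)" "l < dim_col (1\<^sub>m (2 * n) :: complex mat)"
    then have kl: "k < 2 * n" "l < 2 * n" by auto
    have "(map_mat cnj (transpose_mat a) * a) $$ (k, l)
        = (\<Sum>i<2 * n. cnj (vec_index (f (P (E k))) i) * vec_index (f (P (E l))) i)"
      using kl bb by (auto simp: a_def scalar_prod_def atLeast0LessThan field_simps b0 simp del: frame_coords_index
          intro!: sum.cong)
    also have "\<dots> = (\<Sum>i<N. cnj (vec_index (f (P (E k))) i) * vec_index (f (P (E l))) i)"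
      using row[OF kl(1)] N by (simp add: ze_def del: frame_coords_index)
    also have "\<dots> = 1\<^sub>m (2 * n) $$ (k, l)" using herm[of k l] kl N by simp
    finally show "(map_mat cnj (transpose_mat a) * a) $$ (k, l) = 1\<^sub>m (2 * n) $$ (k, l)" .
  qed (simp_all add: a_def)
  have "omega0 n (a *\<^sub>v z) (a *\<^sub>v w) = omega0 n z w"
    if z: "z \<in> carrier_vec (2 * n)" and w: "w \<in> carrier_vec (2 * n)" for z w
  proof -
    \<comment> \<open>Horizontal coordinate vectors are padded by a zero last coordinate, so that
      the action of \<open>a\<close> can be read off from \<open>P\<close>.\<close>
    define ext where "ext = (\<lambda>(z::complex Matrix.vec) k. if k < 2 * n then vec_index z k else 0)"
    have f_ext: "vec_index (f (of_coords (ext z))) k = ext z k" if "k < N" for z k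
      by (rule frame_coords_of_coords[OF that])
    have az: "vec_index (f (P (of_coords (ext z)))) k = b * vec_index (a *\<^sub>v z) k"
      if "k < 2 * n" "z \<in> carrier_vec (2 * n)" for z k
    proof -
      have "vec_index (f (P (of_coords (ext z)))) k = (\<Sum>l<N. vec_index (f (P (E l))) k * ext z l)"
        by (subst P_coords[OF lt3[OF that(1)]], rule sum.cong) (simp_all add: f_ext del: frame_coords_index)
      also have "\<dots> = (\<Sum>l<2 * n. vec_index (f (P (E l))) k * vec_index z l)"
        using N by (simp add: ext_def del: frame_coords_index)
      also have "\<dots> = b * vec_index (a *\<^sub>v z) k"
        using that b0 by (simp add: a_def scalar_prod_def atLeast0LessThan sum_distrib_left del: frame_coords_index)
      finally show ?thesis .
    qed
    have "b\<^sup>2 * omega0 n (a *\<^sub>v z) (a *\<^sub>v w) = om (P (of_coords (ext z))) (P (of_coords (ext w)))"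
      unfolding om_def by (rule omega0_scale[symmetric]) (use az z w in auto)
    also have "\<dots> = b\<^sup>2 * om (of_coords (ext z)) (of_coords (ext w))" unfolding om_P b2 ..
    also have "om (of_coords (ext z)) (of_coords (ext w)) = omega0 n z w"
      unfolding om_def by (rule omega0_cong) (simp_all only: f_ext lt3, simp_all add: ext_def)
    finally show ?thesis using b0 by simp
  qed
  with a_unitary have "a \<in> Sp_group n" by (simp add: Sp_group_def)
  then have "B \<in> rho_SpU1 n" unfolding rho_SpU1_def block using b1 by blast
  then show ?thesis unfolding acts_via_def using Bu by blast
qed

section \<open>Curvature and torsion in a chart\<close>

text \<open>The geometry in one chart. Parallelism of \<open>g\<close> and \<open>J\<close> is
  recorded on constant coordinate fields only; \<open>deriv_g\<close> and \<open>nab_J\<close>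
  recover it for moving fields by the product rule.\<close>

locale chart_geometry =
  fixes U :: "'e::euclidean_space set" and g :: "'e \<Rightarrow> 'e \<Rightarrow> 'e \<Rightarrow> real"
    and J :: "'e \<Rightarrow> 'e \<Rightarrow> 'e" and G :: "'e \<Rightarrow> 'e \<Rightarrow> 'e \<Rightarrow> 'e" and H V :: "'e \<Rightarrow> 'e set"
    and T :: "'e \<Rightarrow> 'e \<Rightarrow> 'e \<Rightarrow> 'e"
  defines T_def: "T \<equiv> \<lambda>x u v. G x u v - G x v u"
  assumes U_open: "open U"
    and splitting: "x \<in> U \<Longrightarrow> hermitian_splitting (g x) (J x) (H x) (V x)"
    and g_smooth: "smooth_on U (\<lambda>x. g x u v)"
    and J_smooth: "smooth_on U (\<lambda>x. J x u)"
    and G_smooth: "smooth_on U (\<lambda>x. G x u v)"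
    and G_bilinear: "x \<in> U \<Longrightarrow> bilinear (G x)"
    and g_parallel: "x \<in> U \<Longrightarrow>
      frechet_derivative (\<lambda>y. g y u v) (at x) k = g x (G x k u) v + g x u (G x k v)"
    and J_parallel: "x \<in> U \<Longrightarrow>
      frechet_derivative (\<lambda>y. J y u) (at x) k + G x k (J x u) = J x (G x k u)"
    and H_section: "x \<in> U \<Longrightarrow> a \<in> H x \<Longrightarrow>
      \<exists>S Y. open S \<and> x \<in> S \<and> S \<subseteq> U \<and> smooth_on S Y \<and> (\<forall>z\<in>S. Y z \<in> H z) \<and> Y x = a"
    and V_section: "x \<in> U \<Longrightarrow> a \<in> V x \<Longrightarrow>
      \<exists>S Y. open S \<and> x \<in> S \<and> S \<subseteq> U \<and> smooth_on S Y \<and> (\<forall>z\<in>S. Y z \<in> V z) \<and> Y x = a"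
    and H_parallel: "open S \<Longrightarrow> S \<subseteq> U \<Longrightarrow> smooth_on S Y \<Longrightarrow> (\<And>z. z \<in> S \<Longrightarrow> Y z \<in> H z) \<Longrightarrow>
      x \<in> S \<Longrightarrow> frechet_derivative Y (at x) k + G x k (Y x) \<in> H x"
    and V_parallel: "open S \<Longrightarrow> S \<subseteq> U \<Longrightarrow> smooth_on S Y \<Longrightarrow> (\<And>z. z \<in> S \<Longrightarrow> Y z \<in> V z) \<Longrightarrow>
      x \<in> S \<Longrightarrow> frechet_derivative Y (at x) k + G x k (Y x) \<in> V x"
    and T_mixed: "x \<in> U \<Longrightarrow> mixed_form (J x) (H x) (V x) (\<lambda>u v w. g x (T x u v) w)"
    and T_nondeg: "x \<in> U \<Longrightarrow> u \<noteq> 0 \<Longrightarrow> \<exists>v w. g x (T x u v) w \<noteq> 0"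
begin

definition nab :: "('e \<Rightarrow> 'e) \<Rightarrow> 'e \<Rightarrow> 'e \<Rightarrow> 'e" where
  "nab Y k x = frechet_derivative Y (at x) k + G x k (Y x)"

text \<open>The curvature of \<nabla> on constant coordinate fields, whose brackets vanish.\<close>

definition Rm :: "'e \<Rightarrow> 'e \<Rightarrow> 'e \<Rightarrow> 'e \<Rightarrow> 'e" where
  "Rm x k l w = frechet_derivative (\<lambda>z. G z l w) (at x) k - frechet_derivative (\<lambda>z. G z k w) (at x) l
     + G x k (G x l w) - G x l (G x k w)"

text \<open>The covariant derivative of the torsion in direction \<open>k\<close>.\<close>

definition NT :: "'e \<Rightarrow> 'e \<Rightarrow> 'e \<Rightarrow> 'e \<Rightarrow> 'e" where
  "NT x k u v = frechet_derivative (\<lambda>z. T z u v) (at x) k + G x k (T x u v)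
     - T x (G x k u) v - T x u (G x k v)"

lemma linears:
  assumes "x \<in> U"
  shows "linear (g x u)" "linear (\<lambda>v. g x v u)" "linear (J x)" "linear (G x u)" "linear (\<lambda>v. G x v u)"
    "linear (T x u)" "linear (\<lambda>v. T x v u)"
proof -
  interpret hermitian_splitting "g x" "J x" "H x" "V x" by (rule splitting[OF assms])
  show "linear (g x u)" "linear (\<lambda>v. g x v u)" "linear (J x)"
    using h_bilinear j_linear by (auto simp: bilinear_def)
  show "linear (G x u)" "linear (\<lambda>v. G x v u)"
    using G_bilinear[OF assms] by (auto simp: bilinear_def)
  then show "linear (T x u)" "linear (\<lambda>v. T x v u)"
    using G_bilinear[OF assms] unfolding T_def bilinear_def by (auto intro: linear_compose_sub)
qed

lemma T_bilinear: "x \<in> U \<Longrightarrow> bilinear (T x)"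
  using linears(6,7) by (simp add: bilinear_def)

lemma T_smooth: "smooth_on U (\<lambda>x. T x u v)"
  unfolding T_def by (intro smooth_on_diff U_open G_smooth)

section \<open>Covariant calculus on open subsets of a chart\<close>

context
  fixes S :: "'e set"
  assumes S: "open S" "S \<subseteq> U"
begin

lemma inU: "z \<in> S \<Longrightarrow> z \<in> U" using S by auto

lemmas const_smooth = smooth_on_subset[OF g_smooth S(2)] smooth_on_subset[OF J_smooth S(2)]
  smooth_on_subset[OF G_smooth S(2)] smooth_on_subset[OF T_smooth S(2)]

lemma J_apply_smooth: "smooth_on S Y \<Longrightarrow> smooth_on S (\<lambda>z. J z (Y z))"
  by (rule smooth_on_linear_apply[where G = J, OF S(1) linears(3)[OF inU] const_smooth(2)])

lemma G_apply_smooth: "smooth_on S Y \<Longrightarrow> smooth_on S (\<lambda>z. G z k (Y z))"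
  by (rule smooth_on_linear_apply[where G = "\<lambda>z. G z k", OF S(1) linears(4)[OF inU] const_smooth(3)])

lemma T_apply_smooth:
  assumes Y: "smooth_on S Y" and Z: "smooth_on S Z"
  shows "smooth_on S (\<lambda>z. T z (Y z) (Z z))"
proof (rule smooth_on_linear_apply[where G = "\<lambda>z. T z (Y z)", OF S(1) _ _ Z])
  show "linear (T z (Y z))" if "z \<in> S" for z by (rule linears(6)[OF inU[OF that]])
  show "smooth_on S (\<lambda>z. T z (Y z) e)" for e
  proof (rule smooth_on_linear_apply[where G = "\<lambda>z u. T z u e", OF S(1) _ _ Y])
    show "linear (\<lambda>u. T z u e)" if "z \<in> S" for z by (rule linears(7)[OF inU[OF that]])
    show "smooth_on S (\<lambda>z. T z u e)" for u by (rule const_smooth(4))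
  qed
qed

lemma g_apply_smooth:
  assumes Y: "smooth_on S Y" and Z: "smooth_on S Z"
  shows "smooth_on S (\<lambda>z. g z (Y z) (Z z))"
proof (rule smooth_on_linear_apply[where G = "\<lambda>z. g z (Y z)", OF S(1) _ _ Z])
  show "linear (g z (Y z))" if "z \<in> S" for z by (rule linears(1)[OF inU[OF that]])
  show "smooth_on S (\<lambda>z. g z (Y z) e)" for e
  proof (rule smooth_on_linear_apply[where G = "\<lambda>z u. g z u e", OF S(1) _ _ Y])
    show "linear (\<lambda>u. g z u e)" if "z \<in> S" for z by (rule linears(2)[OF inU[OF that]])
    show "smooth_on S (\<lambda>z. g z u e)" for u by (rule const_smooth(1))
  qed
qed

lemma nab_smooth: "smooth_on S Y \<Longrightarrow> smooth_on S (nab Y k)"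
  unfolding nab_def[abs_def] by (intro smooth_on_add S smooth_on_deriv G_apply_smooth)

lemma nab_add:
  "x \<in> S \<Longrightarrow> smooth_on S Y \<Longrightarrow> smooth_on S Z \<Longrightarrow> nab (\<lambda>z. Y z + Z z) k x = nab Y k x + nab Z k x"
  unfolding nab_def by (simp add: frechet_derivative_add[OF S(1)] linear_add[OF linears(4)] inU)

lemma nab_cong:
  "x \<in> S \<Longrightarrow> (\<And>z. z \<in> S \<Longrightarrow> Y z = Z z) \<Longrightarrow> nab Y k x = nab Z k x"
  unfolding nab_def using frechet_derivative_cong[OF S(1), of x Y Z] by simp

lemma deriv_g:
  assumes "x \<in> S" "smooth_on S Y" "smooth_on S Z"
  shows "frechet_derivative (\<lambda>z. g z (Y z) (Z z)) (at x) k = g x (nab Y k x) (Z x) + g x (Y x) (nab Z k x)"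
proof -
  note x = inU[OF assms(1)]
  have "frechet_derivative (\<lambda>z. g z (Y z) (Z z)) (at x) k
      = frechet_derivative (\<lambda>z. g z (Y z) (Z x)) (at x) k + g x (Y x) (frechet_derivative Z (at x) k)"
    by (rule frechet_derivative_linear_apply[OF S(1) assms(1), of "\<lambda>z. g z (Y z)"])
      (auto intro: linears inU assms g_apply_smooth smooth_on_const)
  also have "frechet_derivative (\<lambda>z. g z (Y z) (Z x)) (at x) k
      = frechet_derivative (\<lambda>z. g z (Y x) (Z x)) (at x) k + g x (frechet_derivative Y (at x) k) (Z x)"
    by (rule frechet_derivative_linear_apply[OF S(1) assms(1), of "\<lambda>z u. g z u (Z x)"])
      (auto intro: linears inU assms const_smooth)
  finally show ?thesis
    unfolding g_parallel[OF x] nab_def by (simp add: linear_add[OF linears(1)[OF x]] linear_add[OF linears(2)[OF x]])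
qed

lemma nab_J:
  assumes "x \<in> S" "smooth_on S Y"
  shows "nab (\<lambda>z. J z (Y z)) k x = J x (nab Y k x)"
proof -
  note x = inU[OF assms(1)]
  have "frechet_derivative (\<lambda>z. J z (Y z)) (at x) k
      = frechet_derivative (\<lambda>z. J z (Y x)) (at x) k + J x (frechet_derivative Y (at x) k)"
    by (rule frechet_derivative_linear_apply[OF S(1) assms(1)])
      (auto intro: linears inU assms const_smooth)
  then show ?thesis
    using J_parallel[OF x, of "Y x" k] unfolding nab_def by (simp add: linear_add[OF linears(3)[OF x]] algebra_simps)
qed

lemma nab_T:
  assumes "x \<in> S" "smooth_on S Y" "smooth_on S Z"
  shows "nab (\<lambda>z. T z (Y z) (Z z)) k x
    = NT x k (Y x) (Z x) + T x (nab Y k x) (Z x) + T x (Y x) (nab Z k x)"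
proof -
  note x = inU[OF assms(1)]
  have "frechet_derivative (\<lambda>z. T z (Y z) (Z z)) (at x) k
      = frechet_derivative (\<lambda>z. T z (Y z) (Z x)) (at x) k + T x (Y x) (frechet_derivative Z (at x) k)"
    by (rule frechet_derivative_linear_apply[OF S(1) assms(1), of "\<lambda>z. T z (Y z)"])
      (auto intro: linears inU assms T_apply_smooth smooth_on_const)
  also have "frechet_derivative (\<lambda>z. T z (Y z) (Z x)) (at x) k
      = frechet_derivative (\<lambda>z. T z (Y x) (Z x)) (at x) k + T x (frechet_derivative Y (at x) k) (Z x)"
    by (rule frechet_derivative_linear_apply[OF S(1) assms(1), of "\<lambda>z u. T z u (Z x)"])
      (auto intro: linears inU assms const_smooth)
  finally show ?thesis
    unfolding NT_def nab_def by (simp add: linear_add[OF linears(6)[OF x]] linear_add[OF linears(7)[OF x]])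
qed

lemma deriv_T3:
  assumes "x \<in> S" "smooth_on S X" "smooth_on S Y" "smooth_on S Z"
  shows "frechet_derivative (\<lambda>z. g z (T z (X z) (Y z)) (Z z)) (at x) k
    = g x (NT x k (X x) (Y x)) (Z x) + g x (T x (nab X k x) (Y x)) (Z x)
      + g x (T x (X x) (nab Y k x)) (Z x) + g x (T x (X x) (Y x)) (nab Z k x)"
  using deriv_g[OF assms(1) T_apply_smooth[OF assms(2,3)] assms(4), of k] nab_T[OF assms(1,2,3), of k]
  by (simp add: linear_add[OF linears(2)[OF inU[OF assms(1)]]])

text \<open>The second derivatives of \<open>Y\<close> cancel by symmetry. Applied to constant
  fields, local sections and tensors evaluated on constants, this transfers every parallel structure
  to the curvature.\<close>

lemma ricci_identity:
  assumes x: "x \<in> S" and Y: "smooth_on S Y"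
  shows "nab (nab Y l) k x - nab (nab Y k) l x = Rm x k l (Y x)"
proof -
  have 1: "nab (nab Y l) k x = frechet_derivative (\<lambda>z. frechet_derivative Y (at z) l) (at x) k
      + frechet_derivative (\<lambda>z. G z l (Y x)) (at x) k + G x l (frechet_derivative Y (at x) k)
      + G x k (frechet_derivative Y (at x) l) + G x k (G x l (Y x))" for k l
  proof -
    have "frechet_derivative (nab Y l) (at x) k = frechet_derivative (\<lambda>z. frechet_derivative Y (at z) l) (at x) k
        + frechet_derivative (\<lambda>z. G z l (Y z)) (at x) k"
      unfolding nab_def[abs_def] by (intro frechet_derivative_add[OF S(1) x] smooth_on_deriv Y G_apply_smooth)
    also have "frechet_derivative (\<lambda>z. G z l (Y z)) (at x) k
        = frechet_derivative (\<lambda>z. G z l (Y x)) (at x) k + G x l (frechet_derivative Y (at x) k)"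
      by (rule frechet_derivative_linear_apply[OF S(1) x, of "\<lambda>z. G z l"])
        (auto intro: linears inU Y const_smooth)
    finally show ?thesis
      using linear_add[OF linears(4)[OF inU[OF x]]] by (simp add: nab_def[abs_def])
  qed
  show ?thesis
    unfolding 1 Rm_def using second_derivative_symmetric[OF S(1) x Y, of l k] by simp
qed

end

lemma Rm_skew: "Rm x k l w = - Rm x l k w"
  by (simp add: Rm_def)

lemma Rm_J:
  assumes x: "x \<in> U" shows "Rm x k l (J x u) = J x (Rm x k l u)"
proof -
  have 1: "nab (nab (\<lambda>z. J z u) l) k x = J x (nab (nab (\<lambda>_. u) l) k x)" for k l
  proof -
    have "nab (nab (\<lambda>z. J z u) l) k x = nab (\<lambda>z. J z (nab (\<lambda>_. u) l z)) k x"
      by (rule nab_cong[OF U_open order_refl x]) (rule nab_J[OF U_open order_refl _ smooth_on_const])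
    also have "\<dots> = J x (nab (nab (\<lambda>_. u) l) k x)"
      by (intro nab_J[OF U_open order_refl x] nab_smooth U_open order_refl smooth_on_const)
    finally show ?thesis .
  qed
  show ?thesis
    using ricci_identity[OF U_open order_refl x J_smooth, of u l k]
      ricci_identity[OF U_open order_refl x smooth_on_const, of u l k]
    by (simp add: 1 linear_diff[OF linears(3)[OF x], symmetric])
qed

text \<open>In the antisymmetrized second derivative of \<open>g u v\<close> the products of two
  covariant derivatives cancel, leaving the two curvature terms.\<close>

lemma Rm_g:
  assumes x: "x \<in> U" shows "g x (Rm x k l u) v = - g x u (Rm x k l v)"
proof -
  let ?c = "\<lambda>(u::'e) (z::'e). u"
  note A = U_open order_refl
  have sm: "smooth_on U (?c u)" "smooth_on U (nab (?c u) k)" for u k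
    by (intro smooth_on_const nab_smooth A)+
  have 1: "frechet_derivative (\<lambda>z. frechet_derivative (\<lambda>z. g z u v) (at z) l) (at x) k
     = g x (nab (nab (?c u) l) k x) v + g x (nab (?c u) l x) (nab (?c v) k x)
       + (g x (nab (?c u) k x) (nab (?c v) l x) + g x u (nab (nab (?c v) l) k x))" for k l
  proof -
    have "frechet_derivative (\<lambda>z. frechet_derivative (\<lambda>z. g z u v) (at z) l) (at x) k
       = frechet_derivative (\<lambda>z. g z (nab (?c u) l z) v + g z u (nab (?c v) l z)) (at x) k"
      using frechet_derivative_cong[OF U_open x, of "\<lambda>z. frechet_derivative (\<lambda>z. g z u v) (at z) l"]
        deriv_g[OF A _ sm(1) sm(1), of _ u v l] by simp
    also have "\<dots> = frechet_derivative (\<lambda>z. g z (nab (?c u) l z) v) (at x) k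
        + frechet_derivative (\<lambda>z. g z u (nab (?c v) l z)) (at x) k"
      by (intro frechet_derivative_add[OF U_open x] g_apply_smooth A sm smooth_on_const)
    finally show ?thesis
      using deriv_g[OF A x sm(2) sm(1), of u l v k] deriv_g[OF A x sm(1) sm(2), of u v l k] by simp
  qed
  have R: "Rm x k l w = nab (nab (?c w) l) k x - nab (nab (?c w) k) l x" for w
    using ricci_identity[OF A x smooth_on_const, of w l k] by simp
  show ?thesis
    using second_derivative_symmetric[OF U_open x g_smooth, of u v k l]
    unfolding 1 R linear_diff[OF linears(1)[OF x]] linear_diff[OF linears(2)[OF x]] by simp
qed

text \<open>A vector of H extends to a local section, whose iterated covariant derivatives stay in
  the parallel subbundle.\<close>

lemma Rm_H:
  assumes x: "x \<in> U" and a: "a \<in> H x" shows "Rm x k l a \<in> H x"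
proof -
  interpret hermitian_splitting "g x" "J x" "H x" "V x" by (rule splitting[OF x])
  obtain S Y where S: "open S" "S \<subseteq> U" and xS: "x \<in> S" and Y: "smooth_on S Y" "\<And>z. z \<in> S \<Longrightarrow> Y z \<in> H z"
    and Yx: "Y x = a" using H_section[OF x a] by blast
  have "nab Y k z \<in> H z" if "z \<in> S" for z k
    using H_parallel[OF S Y that] by (simp add: nab_def)
  then have mem: "nab (nab Y l) k x \<in> H x" for k l
    unfolding nab_def[of "nab Y l"] by (rule H_parallel[OF S nab_smooth[OF S Y(1)] _ xS])
  have "Rm x k l a = nab (nab Y l) k x - nab (nab Y k) l x"
    using ricci_identity[OF S xS Y(1), of l k] Yx by simp
  then show ?thesis
    using subspace_diff[OF H_subspace mem mem] by simp
qed

lemma Rm_V: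
  assumes x: "x \<in> U" and a: "a \<in> V x" shows "Rm x k l a \<in> V x"
proof -
  interpret hermitian_splitting "g x" "J x" "H x" "V x" by (rule splitting[OF x])
  obtain S Y where S: "open S" "S \<subseteq> U" and xS: "x \<in> S" and Y: "smooth_on S Y" "\<And>z. z \<in> S \<Longrightarrow> Y z \<in> V z"
    and Yx: "Y x = a" using V_section[OF x a] by blast
  have "nab Y k z \<in> V z" if "z \<in> S" for z k
    using V_parallel[OF S Y that] by (simp add: nab_def)
  then have mem: "nab (nab Y l) k x \<in> V x" for k l
    unfolding nab_def[of "nab Y l"] by (rule V_parallel[OF S nab_smooth[OF S Y(1)] _ xS])
  have "Rm x k l a = nab (nab Y l) k x - nab (nab Y k) l x"
    using ricci_identity[OF S xS Y(1), of l k] Yx by simp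
  then show ?thesis
    using subspace_diff[OF V_subspace mem mem] by simp
qed

end

section \<open>Parallel torsion and local constancy of the conformal factor\<close>

context chart_geometry
begin

lemma nab_const: "nab (\<lambda>_. u) k x = G x k u"
  by (simp add: nab_def)

lemma T_form:
  assumes "x \<in> U"
  shows T_swap1: "g x (T x u v) w = - g x (T x v u) w" and T_swap2: "g x (T x u v) w = - g x (T x u w) v"
    and T_HHH: "a \<in> H x \<Longrightarrow> b \<in> H x \<Longrightarrow> c \<in> H x \<Longrightarrow> g x (T x a b) c = 0"
    and T_VV: "y \<in> V x \<Longrightarrow> z \<in> V x \<Longrightarrow> g x (T x y z) u = 0"
    and T_J: "a \<in> H x \<Longrightarrow> b \<in> H x \<Longrightarrow> y \<in> V x \<Longrightarrow> g x (T x (J x a) b) y = - g x (T x a b) (J x y)"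
  using T_mixed[OF assms] unfolding mixed_form_def alternating3_def by blast+

lemma section_common:
  assumes "x \<in> U" "a \<in> H x" "b \<in> H x" "y \<in> V x" "y' \<in> V x"
  obtains S A B Y Y' where "open S" "S \<subseteq> U" "x \<in> S" "smooth_on S A" "smooth_on S B" "smooth_on S Y" "smooth_on S Y'"
    "\<And>z. z \<in> S \<Longrightarrow> A z \<in> H z" "\<And>z. z \<in> S \<Longrightarrow> B z \<in> H z" "\<And>z. z \<in> S \<Longrightarrow> Y z \<in> V z" "\<And>z. z \<in> S \<Longrightarrow> Y' z \<in> V z"
    "A x = a" "B x = b" "Y x = y" "Y' x = y'"
proof -
  obtain S1 A where 1: "open S1" "x \<in> S1" "S1 \<subseteq> U" "smooth_on S1 A" "\<forall>z\<in>S1. A z \<in> H z" "A x = a"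
    using H_section[OF assms(1,2)] by blast
  obtain S2 B where 2: "open S2" "x \<in> S2" "S2 \<subseteq> U" "smooth_on S2 B" "\<forall>z\<in>S2. B z \<in> H z" "B x = b"
    using H_section[OF assms(1,3)] by blast
  obtain S3 Y where 3: "open S3" "x \<in> S3" "S3 \<subseteq> U" "smooth_on S3 Y" "\<forall>z\<in>S3. Y z \<in> V z" "Y x = y"
    using V_section[OF assms(1,4)] by blast
  obtain S4 Y' where 4: "open S4" "x \<in> S4" "S4 \<subseteq> U" "smooth_on S4 Y'" "\<forall>z\<in>S4. Y' z \<in> V z" "Y' x = y'"
    using V_section[OF assms(1,5)] by blast
  let ?S = "S1 \<inter> S2 \<inter> (S3 \<inter> S4)"
  show ?thesis
  proof (rule that[of ?S A B Y Y'])
    show "smooth_on ?S A" by (rule smooth_on_subset[OF 1(4)]) blast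
    show "smooth_on ?S B" by (rule smooth_on_subset[OF 2(4)]) blast
    show "smooth_on ?S Y" by (rule smooth_on_subset[OF 3(4)]) blast
    show "smooth_on ?S Y'" by (rule smooth_on_subset[OF 4(4)]) blast
  qed (use 1 2 3 4 in auto)
qed

text \<open>Each defining identity is differentiated along fields satisfying it near
  \<open>x\<close>: constant fields for the symmetries, local sections of H and V for the rest.
  Parallelism keeps the differentiated sections in H and V, so every term other than that of
  \<open>NT\<close> already obeys the identity.\<close>

lemma NT_mixed:
  assumes x: "x \<in> U"
  shows "mixed_form (J x) (H x) (V x) (\<lambda>u v w. g x (NT x k u v) w)"
proof -
  interpret hermitian_splitting "g x" "J x" "H x" "V x" by (rule splitting[OF x])
  note A = U_open order_refl
  have D: "frechet_derivative (\<lambda>z. g z (T z u v) w) (at x) k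
    = g x (NT x k u v) w + g x (T x (G x k u) v) w + g x (T x u (G x k v)) w + g x (T x u v) (G x k w)" for u v w
    using deriv_T3[OF A x smooth_on_const smooth_on_const smooth_on_const, of u v w k] unfolding nab_const .
  have sm: "smooth_on U (\<lambda>z. g z (T z u v) w)" for u v w
    by (rule g_apply_smooth[OF A T_smooth smooth_on_const])
  have swap1: "g x (NT x k u v) w = - g x (NT x k v u) w" for u v w
  proof -
    have "frechet_derivative (\<lambda>z. g z (T z u v) w) (at x) k = - frechet_derivative (\<lambda>z. g z (T z v u) w) (at x) k"
      unfolding frechet_derivative_uminus[OF U_open x sm, symmetric]
      by (rule fun_cong[OF frechet_derivative_cong[OF U_open x]]) (rule T_swap1)
    then show ?thesis
      using T_swap1[OF x, of "G x k u" v w] T_swap1[OF x, of u "G x k v" w] T_swap1[OF x, of u v "G x k w"]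
      unfolding D by linarith
  qed
  have swap2: "g x (NT x k u v) w = - g x (NT x k u w) v" for u v w
  proof -
    have "frechet_derivative (\<lambda>z. g z (T z u v) w) (at x) k = - frechet_derivative (\<lambda>z. g z (T z u w) v) (at x) k"
      unfolding frechet_derivative_uminus[OF U_open x sm, symmetric]
      by (rule fun_cong[OF frechet_derivative_cong[OF U_open x]]) (rule T_swap2)
    then show ?thesis
      using T_swap2[OF x, of "G x k u" v w] T_swap2[OF x, of u "G x k v" w] T_swap2[OF x, of u v "G x k w"]
      unfolding D by linarith
  qed
  have zeroV: "0 \<in> V x" using subspace_0[OF V_subspace] .
  have HHH: "g x (NT x k a b) c = 0" if abc: "a \<in> H x" "b \<in> H x" "c \<in> H x" for a b c
  proof -
    obtain S A B Y Y' where S: "open S" "S \<subseteq> U" "x \<in> S" and sA: "smooth_on S A" and sB: "smooth_on S B"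
      and AH: "\<And>z. z \<in> S \<Longrightarrow> A z \<in> H z" and BH: "\<And>z. z \<in> S \<Longrightarrow> B z \<in> H z" and ab: "A x = a" "B x = b"
      by (rule section_common[OF x abc(1,2) zeroV zeroV]) blast
    obtain S' C where S': "open S'" "x \<in> S'" "S' \<subseteq> U" "smooth_on S' C" and CH: "\<forall>z\<in>S'. C z \<in> H z" and c: "C x = c"
      using H_section[OF x abc(3)] by blast
    let ?S = "S \<inter> S'"
    have S2: "open ?S" "?S \<subseteq> U" "x \<in> ?S" using S S' by auto
    have sm: "smooth_on ?S A" "smooth_on ?S B" "smooth_on ?S C"
      using sA sB S'(4) smooth_on_subset by blast+
    have n: "nab A k x \<in> H x" "nab B k x \<in> H x" "nab C k x \<in> H x"
      unfolding nab_def by (rule H_parallel[OF S2(1,2) _ _ S2(3)]; use sm AH BH CH in auto)+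
    have "frechet_derivative (\<lambda>z. g z (T z (A z) (B z)) (C z)) (at x) = frechet_derivative (\<lambda>z. 0) (at x)"
      by (rule frechet_derivative_cong[OF S2(1,3)]) (use AH BH CH S2 T_HHH in auto)
    then have "0 = g x (NT x k a b) c + g x (T x (nab A k x) b) c
      + g x (T x a (nab B k x)) c + g x (T x a b) (nab C k x)"
      using deriv_T3[OF S2(1,2,3) sm, of k] unfolding ab c by simp
    then show ?thesis using T_HHH[OF x] abc n by simp
  qed
  have VV: "g x (NT x k y y') u = 0" if yy: "y \<in> V x" "y' \<in> V x" for y y' u
  proof -
    have zH: "0 \<in> H x" using subspace_0[OF H_subspace] .
    obtain S A B Y Y' where S: "open S" "S \<subseteq> U" "x \<in> S" and sY: "smooth_on S Y" "smooth_on S Y'"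
      and YV: "\<And>z. z \<in> S \<Longrightarrow> Y z \<in> V z" "\<And>z. z \<in> S \<Longrightarrow> Y' z \<in> V z" and y: "Y x = y" "Y' x = y'"
      by (rule section_common[OF x zH zH yy]) blast
    have n: "nab Y k x \<in> V x" "nab Y' k x \<in> V x"
      unfolding nab_def by (rule V_parallel[OF S(1,2) _ _ S(3)]; use sY YV in auto)+
    have "frechet_derivative (\<lambda>z. g z (T z (Y z) (Y' z)) u) (at x) = frechet_derivative (\<lambda>z. 0) (at x)"
      by (rule frechet_derivative_cong[OF S(1,3)]) (use YV S T_VV in auto)
    then have "0 = g x (NT x k y y') u + g x (T x (nab Y k x) y') u
      + g x (T x y (nab Y' k x)) u + g x (T x y y') (nab (\<lambda>_. u) k x)"
      using deriv_T3[OF S sY smooth_on_const, of u k] unfolding y by simp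
    then show ?thesis using T_VV[OF x] yy n by simp
  qed
  have Jt: "g x (NT x k (J x a) b) y = - g x (NT x k a b) (J x y)" if ay: "a \<in> H x" "b \<in> H x" "y \<in> V x" for a b y
  proof -
    obtain S A B Y Y' where S: "open S" "S \<subseteq> U" "x \<in> S" and sm: "smooth_on S A" "smooth_on S B" "smooth_on S Y"
      and AH: "\<And>z. z \<in> S \<Longrightarrow> A z \<in> H z" and BH: "\<And>z. z \<in> S \<Longrightarrow> B z \<in> H z" and YV: "\<And>z. z \<in> S \<Longrightarrow> Y z \<in> V z"
      and aby: "A x = a" "B x = b" "Y x = y"
      by (rule section_common[OF x ay zeroV]) blast
    have sJ: "smooth_on S (\<lambda>z. J z (A z))" "smooth_on S (\<lambda>z. J z (Y z))"
      by (rule J_apply_smooth[OF S(1,2)], rule sm)+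
    have n: "nab A k x \<in> H x" "nab B k x \<in> H x"
      unfolding nab_def by (rule H_parallel[OF S(1,2) _ _ S(3)]; use sm AH BH in auto)+
    have nV: "nab Y k x \<in> V x"
      unfolding nab_def by (rule V_parallel[OF S(1,2) _ _ S(3)]; use sm YV in auto)
    have "smooth_on S (\<lambda>z. g z (T z (A z) (B z)) (J z (Y z)))"
      by (rule g_apply_smooth[OF S(1,2) T_apply_smooth[OF S(1,2) sm(1,2)] sJ(2)])
    note um = frechet_derivative_uminus[OF S(1,3) this, of k]
    have "frechet_derivative (\<lambda>z. g z (T z (J z (A z)) (B z)) (Y z)) (at x) k
      = frechet_derivative (\<lambda>z. - g z (T z (A z) (B z)) (J z (Y z))) (at x) k"
      by (rule fun_cong[OF frechet_derivative_cong[OF S(1,3)]]) (use S T_J AH BH YV in auto)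
    then have "g x (NT x k (J x a) b) y + g x (T x (J x (nab A k x)) b) y
        + g x (T x (J x a) (nab B k x)) y + g x (T x (J x a) b) (nab Y k x)
      = - (g x (NT x k a b) (J x y) + g x (T x (nab A k x) b) (J x y)
        + g x (T x a (nab B k x)) (J x y) + g x (T x a b) (J x (nab Y k x)))"
      unfolding um deriv_T3[OF S sJ(1) sm(2,3)] deriv_T3[OF S sm(1,2) sJ(2)]
        nab_J[OF S sm(1)] nab_J[OF S sm(3)] aby .
    then show ?thesis
      using T_J[OF x n(1) ay(2,3)] T_J[OF x ay(1) n(2) ay(3)] T_J[OF x ay(1,2) nV] by linarith
  qed
  show ?thesis
    unfolding mixed_form_def alternating3_def
    using swap1 swap2 HHH VV Jt linears(1)[OF x] by blast
qed

text \<open>As \<open>T\<close> antisymmetrizes \<open>G\<close>, both sides reduce to the same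
  derivatives and products of \<open>G\<close>.\<close>

lemma bianchi:
  assumes x: "x \<in> U"
  shows "Rm x u v w + Rm x v w u + Rm x w u v
    = NT x u v w + NT x v w u + NT x w u v + T x (T x u v) w + T x (T x v w) u + T x (T x w u) v"
proof -
  have fd: "frechet_derivative (\<lambda>z. T z v w) (at x) u
     = frechet_derivative (\<lambda>z. G z v w) (at x) u - frechet_derivative (\<lambda>z. G z w v) (at x) u" for u v w
    unfolding T_def by (rule frechet_derivative_diff[OF U_open x G_smooth G_smooth])
  note [simp] = bilinear_lsub[OF G_bilinear[OF x]] bilinear_rsub[OF G_bilinear[OF x]]
  show ?thesis
    unfolding Rm_def NT_def fd by (simp add: T_def algebra_simps)
qed

lemma NT_linear_dir:
  assumes x: "x \<in> U" shows "linear (\<lambda>k. g x (NT x k u v) w)"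
proof -
  have 1: "linear (frechet_derivative (\<lambda>z. T z u v) (at x))"
    using smooth_on_has_derivative[OF U_open x T_smooth] has_derivative_linear by blast
  have "linear (\<lambda>k. T x (G x k u) v)" "linear (\<lambda>k. T x u (G x k v))"
    using linear_compose[OF linears(5)[OF x, of u] linears(7)[OF x, of v]]
      linear_compose[OF linears(5)[OF x, of v] linears(6)[OF x, of u]] by (simp_all add: o_def)
  then have "linear (\<lambda>k. NT x k u v)"
    unfolding NT_def by (intro linear_compose_sub linear_compose_add 1 linears x)
  from linear_compose[OF this linears(2)[OF x, of w]] show ?thesis by (simp add: o_def)
qed

lemma bianchi_inner:
  assumes x: "x \<in> U"
  shows "g x (Rm x u v w) z + g x (Rm x v w u) z + g x (Rm x w u v) z
    = g x (NT x u v w) z + g x (NT x v w u) z + g x (NT x w u v) z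
      + (g x (T x u v) (T x w z) + g x (T x v w) (T x u z) + g x (T x w u) (T x v z))"
proof -
  interpret hermitian_splitting "g x" "J x" "H x" "V x" by (rule splitting[OF x])
  \<comment> \<open>Total skewness brings the iterated torsion into the form expected by the
    pointwise argument.\<close>
  have TT: "g x (T x (T x u v) w) z = g x (T x u v) (T x w z)" for u v w
    using T_swap1[OF x, of "T x u v" w z] T_swap2[OF x, of w "T x u v" z] h_sym[of "T x w z"] by simp
  have "g x (Rm x u v w + Rm x v w u + Rm x w u v) z
    = g x (NT x u v w + NT x v w u + NT x w u v + T x (T x u v) w + T x (T x v w) u + T x (T x w u) v) z"
    unfolding bianchi[OF x] ..
  then show ?thesis by (simp add: TT)
qed

lemma NT_eq_0:
  assumes x: "x \<in> U" shows "NT x k u v = 0"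
proof -
  interpret hermitian_splitting "g x" "J x" "H x" "V x" by (rule splitting[OF x])
  have "g x (NT x k u v) w = 0" for w
  proof (rule bianchi_mixed_form_eq_0[of "T x" "\<lambda>k u v w. g x (NT x k u v) w" "\<lambda>u v w z. g x (Rm x u v w) z"])
    show "g x (Rm x u v w) z = - g x (Rm x v u w) z" for u v w z
      using Rm_skew[of x u v w] by simp
    show "g x (Rm x u v w) z = - g x (Rm x u v z) w" for u v w z
      using Rm_g[OF x, of u v w z] h_sym[of w "Rm x u v z"] by simp
    show "linear (g x (Rm x u v w))" for u v w by (rule linears[OF x])
    show "g x (Rm x u v (J x w)) (J x z) = g x (Rm x u v w) z" for u v w z
      by (simp add: Rm_J[OF x])
    show "g x (Rm x u v a) y = 0" if "a \<in> H x" "y \<in> V x" for u v a y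
      using HV_orth[OF Rm_H[OF x that(1)] that(2)] .
  qed (rule T_mixed NT_mixed NT_linear_dir bianchi_inner, rule x)+
  then show ?thesis by (intro h_eqI) simp
qed

text \<open>Once \<nabla>T = 0, antisymmetrizing second covariant derivatives makes the curvature a
  derivation of T.\<close>

lemma Rm_T:
  assumes x: "x \<in> U"
  shows "Rm x k l (T x u v) = T x (Rm x k l u) v + T x u (Rm x k l v)"
proof -
  let ?c = "\<lambda>(u::'e) (z::'e). u"
  note A = U_open order_refl
  have sm: "smooth_on U (?c u)" "smooth_on U (nab (?c u) k)" for u k
    by (rule smooth_on_const, rule nab_smooth[OF A smooth_on_const])
  have d: "nab (\<lambda>z. T z (Y z) (Z z)) k z = T z (nab Y k z) (Z z) + T z (Y z) (nab Z k z)"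
    if "z \<in> U" "smooth_on U Y" "smooth_on U Z" for Y Z k z
    using nab_T[OF A that, of k] NT_eq_0[OF that(1)] by simp
  have 1: "nab (nab (\<lambda>z. T z u v) l) k x
     = T x (nab (nab (?c u) l) k x) v + T x (nab (?c u) l x) (nab (?c v) k x)
       + (T x (nab (?c u) k x) (nab (?c v) l x) + T x u (nab (nab (?c v) l) k x))" for k l
  proof -
    have "nab (nab (\<lambda>z. T z u v) l) k x = nab (\<lambda>z. T z (nab (?c u) l z) v + T z u (nab (?c v) l z)) k x"
      by (rule nab_cong[OF A x]) (rule d[OF _ sm(1) sm(1)])
    also have "\<dots> = nab (\<lambda>z. T z (nab (?c u) l z) v) k x + nab (\<lambda>z. T z u (nab (?c v) l z)) k x"
      by (rule nab_add[OF A x T_apply_smooth[OF A sm(2) sm(1)] T_apply_smooth[OF A sm(1) sm(2)]])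
    finally show ?thesis
      using d[OF x sm(2) sm(1), of u l v k] d[OF x sm(1) sm(2), of u v l k] by simp
  qed
  have R: "Rm x k l w = nab (nab (?c w) l) k x - nab (nab (?c w) k) l x" for w
    using ricci_identity[OF A x smooth_on_const, of w l k] by simp
  show ?thesis
    using ricci_identity[OF A x T_smooth, of u v l k]
    unfolding 1 R linear_diff[OF linears(6)[OF x]] linear_diff[OF linears(7)[OF x]] by (simp add: algebra_simps)
qed

lemma conformal_exists:
  assumes x: "x \<in> U"
  shows "\<exists>\<mu>. hermitian_splitting.conformal_torsion (g x) (H x) (V x) (T x) \<mu>"
proof -
  interpret hermitian_splitting "g x" "J x" "H x" "V x" by (rule splitting[OF x])
  obtain y where y: "y \<in> V x" "y \<noteq> 0" using dim_V dim_eq_0[of "V x"] by auto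
  show ?thesis
  proof (rule conformal_torsionI[OF T_mixed[OF x] T_bilinear[OF x] T_nondeg[OF x] y])
    show "g x (Rm x (J x y) y u) v = - g x u (Rm x (J x y) y v)" for u v by (rule Rm_g[OF x])
    show "Rm x (J x y) y u \<in> H x" if "u \<in> H x" for u by (rule Rm_H[OF x that])
    show "Rm x (J x y) y u \<in> V x" if "u \<in> V x" for u by (rule Rm_V[OF x that])
    show "Rm x (J x y) y (T x u v) = T x (Rm x (J x y) y u) v + T x u (Rm x (J x y) y v)" for u v
      by (rule Rm_T[OF x])
    \<comment> \<open>Two curvature terms of the Bianchi identity take values in V and are
      orthogonal to \<open>b\<close>; also T(Jy, y) = 0. The operator R(Jy, y) is thus expressed by
      torsion alone.\<close>
    fix a b assume a: "a \<in> H x" and b: "b \<in> H x"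
    have "T x (J x y) y = 0"
      using T_VV[OF x j_V[OF y(1)] y(1)] by (intro h_eqI) simp
    moreover have "T x a (J x y) = - T x (J x y) a" by (simp add: T_def)
    moreover have "g x (Rm x y a (J x y)) b = 0" "g x (Rm x a (J x y) y) b = 0"
      using HV_orth[OF b Rm_V[OF x j_V[OF y(1)], of y a]] HV_orth[OF b Rm_V[OF x y(1), of a "J x y"]]
        h_sym[of b] by simp_all
    ultimately show "g x (Rm x (J x y) y a) b = g x (T x y a) (T x (J x y) b) - g x (T x (J x y) a) (T x y b)"
      using bianchi_inner[OF x, of "J x y" y a b] NT_eq_0[OF x] by simp
  qed
qed

text \<open>\<open>|T(Y, A)|\<^sup>2 = \<mu> |Y|\<^sup>2 |A|\<^sup>2\<close> for local sections \<open>Y\<close> of \<open>V\<close> and \<open>A\<close> of \<open>H\<close>; as everything in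
  sight is parallel, differentiating the quotient gives \<open>d\<mu> = 0\<close>.\<close>

lemma conformal_locally_constant:
  assumes x: "x \<in> U"
  shows "\<exists>\<mu> S. open S \<and> x \<in> S \<and> S \<subseteq> U \<and>
    (\<forall>z\<in>S. hermitian_splitting.conformal_torsion (g z) (H z) (V z) (T z) \<mu>)"
proof -
  interpret X: hermitian_splitting "g x" "J x" "H x" "V x" by (rule splitting[OF x])
  obtain \<mu> where \<mu>: "X.conformal_torsion (T x) \<mu>" using conformal_exists[OF x] by blast
  obtain a y where a: "a \<in> H x" "a \<noteq> 0" and y: "y \<in> V x" "y \<noteq> 0"
    using X.conformal_torsion_pos[OF T_mixed[OF x] T_bilinear[OF x] T_nondeg[OF x] \<mu>] by blast
  obtain S A B Y Y' where S: "open S" "S \<subseteq> U" "x \<in> S" and sA: "smooth_on S A" and sY: "smooth_on S Y"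
    and AH: "\<And>z. z \<in> S \<Longrightarrow> A z \<in> H z" and YV: "\<And>z. z \<in> S \<Longrightarrow> Y z \<in> V z" and ay: "A x = a" "Y x = y"
    by (rule section_common[OF x a(1) a(1) y(1) y(1)]) blast
  \<comment> \<open>Shrinking to a ball on which \<open>A\<close> and \<open>Y\<close> have no zero
    makes the quotient defined and the domain convex.\<close>
  have "open (S \<inter> A -` (- {0}))" "open (S \<inter> Y -` (- {0}))"
    by (rule continuous_open_preimage[OF smooth_on_continuous_on[OF sA] S(1)], simp add: open_Compl,
      rule continuous_open_preimage[OF smooth_on_continuous_on[OF sY] S(1)], simp add: open_Compl)
  then have "open ((S \<inter> A -` (- {0})) \<inter> (S \<inter> Y -` (- {0})))" by (rule open_Int)
  moreover have "x \<in> (S \<inter> A -` (- {0})) \<inter> (S \<inter> Y -` (- {0}))" using S a y ay by auto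
  ultimately obtain r where r: "r > 0" and rS: "ball x r \<subseteq> (S \<inter> A -` (- {0})) \<inter> (S \<inter> Y -` (- {0}))"
    by (meson open_contains_ball)
  let ?S = "ball x r"
  have S': "open ?S" "?S \<subseteq> U" using rS S by auto
  have sA': "smooth_on ?S A" and sY': "smooth_on ?S Y" using sA sY rS by (auto intro: smooth_on_subset)
  define num where "num = (\<lambda>z. g z (T z (Y z) (A z)) (T z (Y z) (A z)))"
  define den where "den = (\<lambda>z. g z (Y z) (Y z) * g z (A z) (A z))"
  have sT: "smooth_on ?S (\<lambda>z. T z (Y z) (A z))" by (rule T_apply_smooth[OF S' sY' sA'])
  have der: "((\<lambda>z. num z / den z) has_derivative (\<lambda>k. 0)) (at z) \<and> den z > 0 \<and>
     (\<forall>\<mu>. hermitian_splitting.conformal_torsion (g z) (H z) (V z) (T z) \<mu> \<longrightarrow> num z / den z = \<mu>)" if z: "z \<in> ?S" for z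
  proof -
    have zU: "z \<in> U" using z S' by blast
    interpret hermitian_splitting "g z" "J z" "H z" "V z" by (rule splitting[OF zU])
    \<comment> \<open>The factor at the point \<open>z\<close>, not yet known to agree with the one
      elsewhere.\<close>
    obtain \<nu> where \<nu>: "conformal_torsion (T z) \<nu>" using conformal_exists[OF zU] by blast
    have zS: "z \<in> S" "A z \<noteq> 0" "Y z \<noteq> 0" using z rS by auto
    have Az: "A z \<in> H z" and Yz: "Y z \<in> V z" using AH YV zS by auto
    have nA: "nab A k z \<in> H z" for k
      unfolding nab_def by (rule H_parallel[OF S(1,2) sA AH zS(1)])
    have nY: "nab Y k z \<in> V z" for k
      unfolding nab_def by (rule V_parallel[OF S(1,2) sY YV zS(1)])
    have num_eq: "num z = \<mu> * den z" if "conformal_torsion (T z) \<mu>" for \<mu>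
      using that Az Yz by (simp add: conformal_torsion_def num_def den_def)
    have den_pos: "den z > 0" using h_pos[OF zS(2)] h_pos[OF zS(3)] by (simp add: den_def)
    have dn: "(num has_derivative frechet_derivative num (at z)) (at z)"
      unfolding num_def by (rule smooth_on_has_derivative[OF S'(1) z g_apply_smooth[OF S' sT sT]])
    have dd: "(den has_derivative frechet_derivative den (at z)) (at z)"
      unfolding den_def
      by (rule smooth_on_has_derivative[OF S'(1) z smooth_on_mult[OF S'(1) g_apply_smooth[OF S' sY' sY'] g_apply_smooth[OF S' sA' sA']]])
    \<comment> \<open>The polarized identity uses only the factor at \<open>z\<close>, so the
      derivative of \<open>num\<close> is \<nu> times that of \<open>den\<close> without
      differentiating the factor.\<close>
    have dnk: "frechet_derivative num (at z) k
      = 2 * \<nu> * (g z (nab Y k z) (Y z) * g z (A z) (A z) + g z (Y z) (Y z) * g z (nab A k z) (A z))" for k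
    proof -
      have "frechet_derivative num (at z) k = 2 * g z (T z (nab Y k z) (A z) + T z (Y z) (nab A k z)) (T z (Y z) (A z))"
        unfolding num_def deriv_g[OF S' z sT sT] nab_T[OF S' z sY' sA'] NT_eq_0[OF zU]
        using h_sym[of "T z (Y z) (A z)" "T z (nab Y k z) (A z)"] h_sym[of "T z (Y z) (A z)" "T z (Y z) (nab A k z)"]
        by simp
      then show ?thesis
        using conformal_torsion_polar[OF T_bilinear[OF zU] \<nu> Yz nY[of k] Az nA[of k]] by (simp add: algebra_simps)
    qed
    have ddk: "frechet_derivative den (at z) k
      = 2 * (g z (nab Y k z) (Y z) * g z (A z) (A z) + g z (Y z) (Y z) * g z (nab A k z) (A z))" for k
    proof -
      have "(den has_derivative (\<lambda>k. g z (Y z) (Y z) * frechet_derivative (\<lambda>z. g z (A z) (A z)) (at z) k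
          + frechet_derivative (\<lambda>z. g z (Y z) (Y z)) (at z) k * g z (A z) (A z))) (at z)"
        unfolding den_def
        by (rule has_derivative_mult; rule smooth_on_has_derivative[OF S'(1) z])
          (rule g_apply_smooth[OF S' sY' sY'], rule g_apply_smooth[OF S' sA' sA'])
      from has_derivative_unique[OF dd this]
      have "frechet_derivative den (at z) k = g z (Y z) (Y z) * frechet_derivative (\<lambda>z. g z (A z) (A z)) (at z) k
          + frechet_derivative (\<lambda>z. g z (Y z) (Y z)) (at z) k * g z (A z) (A z)" by metis
      then show ?thesis
        unfolding deriv_g[OF S' z sY' sY'] deriv_g[OF S' z sA' sA']
        using h_sym[of "Y z" "nab Y k z"] h_sym[of "A z" "nab A k z"] by (simp add: algebra_simps)
    qed
    have "((\<lambda>z. num z / den z) has_derivative (\<lambda>k. (frechet_derivative num (at z) k * den z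
        - num z * frechet_derivative den (at z) k) / (den z * den z))) (at z)"
      by (rule has_derivative_divide'[OF dn dd]) (use den_pos in simp)
    moreover have "frechet_derivative num (at z) k * den z - num z * frechet_derivative den (at z) k = 0" for k
      unfolding dnk ddk num_eq[OF \<nu>] by (simp add: algebra_simps)
    ultimately show ?thesis using den_pos num_eq by (auto simp: field_simps)
  qed
  have "\<exists>c. \<forall>z\<in>?S. num z / den z = c"
    by (rule has_derivative_zero_constant[OF convex_ball]) (use der has_derivative_at_withinI in blast)
  then obtain c where c: "\<And>z. z \<in> ?S \<Longrightarrow> num z / den z = c" by blast
  have "hermitian_splitting.conformal_torsion (g z) (H z) (V z) (T z) c" if z: "z \<in> ?S" for z
  proof -
    obtain \<nu> where \<nu>: "hermitian_splitting.conformal_torsion (g z) (H z) (V z) (T z) \<nu>"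
      using conformal_exists[OF subsetD[OF S'(2) z]] by blast
    then have "c = \<nu>" using der[OF z] c[OF z] by simp
    then show ?thesis using \<nu> by simp
  qed
  then show ?thesis using S' r by (intro exI[of _ c] exI[of _ ?S]) auto
qed

end

section \<open>Parallel fields along curves\<close>

context chart_geometry
begin

context
  fixes I :: "real set" and a :: "real \<Rightarrow> 'e" and a' :: 'e and t :: real
  assumes I: "open I" "t \<in> I" and aU: "\<And>s. s \<in> I \<Longrightarrow> a s \<in> U"
    and a: "(a has_vector_derivative a') (at t)"
begin

lemma along_curve:
  assumes F: "smooth_on U F"
  shows "((\<lambda>s. F (a s)) has_derivative (\<lambda>h. frechet_derivative F (at (a t)) (h *\<^sub>R a'))) (at t)"
  by (rule has_derivative_compose[OF a[unfolded has_vector_derivative_def]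
      smooth_on_has_derivative[OF U_open aU[OF I(2)] F]])

lemma parallel_J:
  assumes W: "(W has_vector_derivative - G (a t) a' (W t)) (at t)"
  shows "((\<lambda>s. J (a s) (W s)) has_vector_derivative - G (a t) a' (J (a t) (W t))) (at t)"
proof -
  note x = aU[OF I(2)]
  have "((\<lambda>s. J (a s) (W s)) has_derivative
     (\<lambda>h. frechet_derivative (\<lambda>z. J z (W t)) (at (a t)) (h *\<^sub>R a') + J (a t) (h *\<^sub>R - G (a t) a' (W t)))) (at t)"
    by (rule has_derivative_linear_apply[OF I linears(3)[OF aU] along_curve[OF J_smooth] W[unfolded has_vector_derivative_def]])
  moreover have "frechet_derivative (\<lambda>z. J z (W t)) (at (a t)) (h *\<^sub>R a') + J (a t) (h *\<^sub>R - G (a t) a' (W t))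
      = h *\<^sub>R - G (a t) a' (J (a t) (W t))" for h
    using J_parallel[OF x, of "W t" "h *\<^sub>R a'"]
    by (simp add: linear_cmul[OF linears(5)[OF x]] linear_cmul[OF linears(3)[OF x]] linear_neg[OF linears(3)[OF x]] algebra_simps)
  ultimately show ?thesis by (simp only: has_vector_derivative_def)
qed

text \<open>By \<nabla>T = 0 the field T(W, W') is again parallel, so invariance of the 3-form
  reduces to that of the metric.\<close>

lemma parallel_T:
  assumes W: "(W has_vector_derivative - G (a t) a' (W t)) (at t)"
    and W': "(W' has_vector_derivative - G (a t) a' (W' t)) (at t)"
  shows "((\<lambda>s. T (a s) (W s) (W' s)) has_vector_derivative - G (a t) a' (T (a t) (W t) (W' t))) (at t)"
proof -
  note x = aU[OF I(2)]
  have 1: "((\<lambda>s. T (a s) (W s) e) has_derivative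
     (\<lambda>h. frechet_derivative (\<lambda>z. T z (W t) e) (at (a t)) (h *\<^sub>R a') + T (a t) (h *\<^sub>R - G (a t) a' (W t)) e)) (at t)" for e
    by (rule has_derivative_linear_apply[OF I linears(7)[OF aU] along_curve[OF T_smooth] W[unfolded has_vector_derivative_def]])
  have "((\<lambda>s. T (a s) (W s) (W' s)) has_derivative
     (\<lambda>h. (frechet_derivative (\<lambda>z. T z (W t) (W' t)) (at (a t)) (h *\<^sub>R a') + T (a t) (h *\<^sub>R - G (a t) a' (W t)) (W' t))
        + T (a t) (W t) (h *\<^sub>R - G (a t) a' (W' t)))) (at t)"
    by (rule has_derivative_linear_apply[OF I linears(6)[OF aU] 1 W'[unfolded has_vector_derivative_def]])
  moreover have "(frechet_derivative (\<lambda>z. T z (W t) (W' t)) (at (a t)) (h *\<^sub>R a') + T (a t) (h *\<^sub>R - G (a t) a' (W t)) (W' t))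
        + T (a t) (W t) (h *\<^sub>R - G (a t) a' (W' t)) = h *\<^sub>R - G (a t) a' (T (a t) (W t) (W' t))" for h
    using NT_eq_0[OF x, of "h *\<^sub>R a'" "W t" "W' t"] unfolding NT_def
    by (simp add: linear_cmul[OF linears(5)[OF x]] linear_cmul[OF linears(6)[OF x]] linear_neg[OF linears(6)[OF x]]
        linear_cmul[OF linears(7)[OF x]] linear_neg[OF linears(7)[OF x]] algebra_simps)
  ultimately show ?thesis by (simp only: has_vector_derivative_def)
qed

lemma parallel_g:
  assumes W: "(W has_vector_derivative - G (a t) a' (W t)) (at t)"
    and W': "(W' has_vector_derivative - G (a t) a' (W' t)) (at t)"
  shows "((\<lambda>s. g (a s) (W s) (W' s)) has_vector_derivative 0) (at t)"
proof -
  note x = aU[OF I(2)]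
  have 1: "((\<lambda>s. g (a s) (W s) e) has_derivative
     (\<lambda>h. frechet_derivative (\<lambda>z. g z (W t) e) (at (a t)) (h *\<^sub>R a') + g (a t) (h *\<^sub>R - G (a t) a' (W t)) e)) (at t)" for e
    by (rule has_derivative_linear_apply[OF I linears(2)[OF aU] along_curve[OF g_smooth] W[unfolded has_vector_derivative_def]])
  have "((\<lambda>s. g (a s) (W s) (W' s)) has_derivative
     (\<lambda>h. (frechet_derivative (\<lambda>z. g z (W t) (W' t)) (at (a t)) (h *\<^sub>R a') + g (a t) (h *\<^sub>R - G (a t) a' (W t)) (W' t))
        + g (a t) (W t) (h *\<^sub>R - G (a t) a' (W' t)))) (at t)"
    by (rule has_derivative_linear_apply[OF I linears(1)[OF aU] 1 W'[unfolded has_vector_derivative_def]])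
  moreover have "(frechet_derivative (\<lambda>z. g z (W t) (W' t)) (at (a t)) (h *\<^sub>R a') + g (a t) (h *\<^sub>R - G (a t) a' (W t)) (W' t))
        + g (a t) (W t) (h *\<^sub>R - G (a t) a' (W' t)) = h *\<^sub>R 0" for h
    unfolding g_parallel[OF x]
    by (simp add: linear_cmul[OF linears(5)[OF x]] linear_cmul[OF linears(1)[OF x]] linear_neg[OF linears(1)[OF x]]
        linear_cmul[OF linears(2)[OF x]] linear_neg[OF linears(2)[OF x]])
  ultimately show ?thesis by (simp only: has_vector_derivative_def)
qed

end

end

text \<open>A curve may cross many charts. The local expressions agree on overlaps and therefore
  glue to one function on the real line with zero derivative.\<close>

lemma constant_along_curve:
  fixes A :: "('a::topological_space, 'e) chart set" and f :: "('a, 'e) chart \<Rightarrow> real \<Rightarrow> real"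
  assumes cover: "(\<Union>c\<in>A. cdom c) = UNIV" and op: "\<And>c. c \<in> A \<Longrightarrow> open (cdom c)"
    and \<gamma>: "continuous_on UNIV \<gamma>"
    and der: "\<And>c t. c \<in> A \<Longrightarrow> \<gamma> t \<in> cdom c \<Longrightarrow> (f c has_vector_derivative 0) (at t)"
    and agree: "\<And>c d t. c \<in> A \<Longrightarrow> d \<in> A \<Longrightarrow> \<gamma> t \<in> cdom c \<Longrightarrow> \<gamma> t \<in> cdom d \<Longrightarrow> f c t = f d t"
    and c: "c \<in> A" "\<gamma> s \<in> cdom c" and d: "d \<in> A" "\<gamma> t \<in> cdom d"
  shows "f c s = f d t"
proof -
  define F where "F = (\<lambda>t. f (SOME c. c \<in> A \<and> \<gamma> t \<in> cdom c) t)"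
  have F: "F t = f c t" if "c \<in> A" "\<gamma> t \<in> cdom c" for c t
    unfolding F_def using someI[of "\<lambda>c. c \<in> A \<and> \<gamma> t \<in> cdom c" c] that agree by blast
  have "(F has_vector_derivative 0) (at t)" for t
  proof -
    obtain c where c: "c \<in> A" "\<gamma> t \<in> cdom c" using cover by (metis UNIV_I UN_E)
    have "open (\<gamma> -` cdom c)" using \<gamma> op[OF c(1)] by (simp add: continuous_on_open_vimage)
    from has_vector_derivative_transform_within_open[OF der[OF c] this, of F] show ?thesis
      using F[OF c(1)] c(2) by simp
  qed
  then have "\<exists>k. \<forall>x\<in>UNIV. F x = k"
    by (intro has_derivative_zero_constant[OF convex_UNIV]) (simp add: has_vector_derivative_def)
  then have "F s = F t" by auto
  then show ?thesis using F[OF c] F[OF d] by simp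
qed

text \<open>The 2-form is multiplied by \<open>s\<close> and the 1-form by \<open>- s\<close>,
  whence the sign in the last rule. As \<open>s\<close> does not occur in the conclusions, both
  conjugate summands obey the same real conditions.\<close>

lemma tensor21_type:
  assumes \<sigma>: "\<sigma> \<in> tensor21 (forms2 s j V) (forms1 (- s) j H)"
  shows "a \<in> H \<Longrightarrow> b \<in> H \<Longrightarrow> c \<in> H \<Longrightarrow> \<sigma> a b c = 0"
    and "x \<in> V \<Longrightarrow> y \<in> V \<Longrightarrow> \<sigma> x y u = 0"
    and "a \<in> H \<Longrightarrow> b \<in> H \<Longrightarrow> x \<in> V \<Longrightarrow> j a \<in> H \<Longrightarrow> j x \<in> V \<Longrightarrow> \<sigma> (j a) b x = - \<sigma> a b (j x)"
proof -
  obtain k \<beta> \<alpha> where \<sigma>_eq: "\<sigma> = (\<lambda>u v w. \<Sum>i<(k::nat). wedge21 (\<beta> i) (\<alpha> i) u v w)"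
    and mem: "\<And>i. i < k \<Longrightarrow> \<beta> i \<in> forms2 s j V" "\<And>i. i < k \<Longrightarrow> \<alpha> i \<in> forms1 (- s) j H"
    using \<sigma> unfolding tensor21_def by blast
  have \<alpha>H: "\<alpha> i a = 0" if "i < k" "a \<in> H" for i a using mem(2)[OF that(1)] that by (simp add: forms1_def)
  have \<alpha>j: "\<alpha> i (j u) = - s * \<alpha> i u" if "i < k" for i u using mem(2)[OF that] by (simp add: forms1_def)
  have \<beta>V: "\<beta> i x u = 0" if "i < k" "x \<in> V" for i x u
    using mem(1)[OF that(1)] that unfolding forms2_def by blast
  have \<beta>V2: "\<beta> i u x = 0" if "i < k" "x \<in> V" for i x u
  proof -
    have "\<beta> i u x = - \<beta> i x u" using mem(1)[OF that(1)] unfolding forms2_def by blast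
    then show ?thesis using \<beta>V[OF that] by simp
  qed
  have \<beta>j: "\<beta> i (j u) v = s * \<beta> i u v" if "i < k" for i u v
    using mem(1)[OF that] unfolding forms2_def by blast
  show "a \<in> H \<Longrightarrow> b \<in> H \<Longrightarrow> c \<in> H \<Longrightarrow> \<sigma> a b c = 0"
    unfolding \<sigma>_eq by (intro sum.neutral) (simp add: wedge21_def \<alpha>H)
  show "x \<in> V \<Longrightarrow> y \<in> V \<Longrightarrow> \<sigma> x y u = 0"
    unfolding \<sigma>_eq by (intro sum.neutral) (simp add: wedge21_def \<beta>V \<beta>V2)
  show "a \<in> H \<Longrightarrow> b \<in> H \<Longrightarrow> x \<in> V \<Longrightarrow> j a \<in> H \<Longrightarrow> j x \<in> V \<Longrightarrow> \<sigma> (j a) b x = - \<sigma> a b (j x)"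
    unfolding \<sigma>_eq sum_negf[symmetric] by (intro sum.cong) (simp_all add: wedge21_def \<alpha>H \<alpha>j \<beta>V \<beta>V2 \<beta>j)
qed

lemma torsion_eq: "torsion \<Gamma>c x u v = \<Gamma>c x u v - \<Gamma>c x v u"
  by (simp add: torsion_def cov_def lie_bracket_def)

text \<open>The values at \<open>x\<close> of smooth sections over a fixed neighbourhood form a
  subspace containing the local frame, hence the whole fibre.\<close>

lemma smooth_subbundle_section:
  assumes D: "smooth_subbundle A r D" and c: "c \<in> A" and x: "x \<in> cimg c" and a: "a \<in> D c x"
  shows "\<exists>S Y. open S \<and> x \<in> S \<and> S \<subseteq> cimg c \<and> smooth_on S Y \<and> (\<forall>z\<in>S. Y z \<in> D c z) \<and> Y x = a"
proof -
  obtain S F where S: "open S" "x \<in> S" "S \<subseteq> cimg c" and F: "\<And>i. i < r \<Longrightarrow> smooth_on S (F i)"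
    and span: "\<And>y. y \<in> S \<Longrightarrow> D c y = span ((\<lambda>i. F i y) ` {..<r})"
    using D[unfolded smooth_subbundle_def, THEN conjunct2, THEN conjunct1, rule_format, OF c x]
    by (elim exE conjE) blast
  let ?P = "{a. \<exists>Y. smooth_on S Y \<and> (\<forall>z\<in>S. Y z \<in> D c z) \<and> Y x = a}"
  have "subspace ?P"
  proof (rule subspaceI)
    show "0 \<in> ?P" using span by (auto intro!: exI[of _ "\<lambda>_. 0"] smooth_on_const simp: span_zero)
    fix a b r assume "a \<in> ?P"
    then obtain Y where Y: "smooth_on S Y" "\<forall>z\<in>S. Y z \<in> D c z" "Y x = a" by blast
    show "r *\<^sub>R a \<in> ?P"
      using Y span by (auto intro!: exI[of _ "\<lambda>z. r *\<^sub>R Y z"] smooth_on_scaleR S smooth_on_const simp: span_scale)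
    assume "b \<in> ?P"
    then obtain Z where Z: "smooth_on S Z" "\<forall>z\<in>S. Z z \<in> D c z" "Z x = b" by blast
    show "a + b \<in> ?P"
      using Y Z span by (auto intro!: exI[of _ "\<lambda>z. Y z + Z z"] smooth_on_add S simp: span_add)
  qed
  moreover have "(\<lambda>i. F i x) ` {..<r} \<subseteq> ?P"
  proof (rule image_subsetI)
    fix i assume "i \<in> {..<r}"
    then show "F i x \<in> ?P" using F[of i] span by (auto intro!: exI[of _ "F i"] span_base)
  qed
  ultimately have "D c x \<subseteq> ?P" unfolding span[OF S(2)] by (intro span_minimal)
  then have "a \<in> ?P" using a by blast
  then show ?thesis using S by blast
qed

section \<open>Globalization\<close>

locale bismut_splitting =
  fixes A :: "('a::{t2_space, second_countable_topology}, 'e::euclidean_space) chart set"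
    and g :: "('a, 'e) metric" and J :: "('a, 'e) endo_field"
    and \<Gamma> :: "('a, 'e) christoffel" and H V :: "('a, 'e) distribution" and m :: nat
  assumes hermitian: "hermitian_manifold A g J"
    and bismut: "bismut_connection A g J \<Gamma>"
    and split: "parallel_splitting A g J \<Gamma> m H V"
    and type: "torsion_type A g J \<Gamma> H V"
    and nondegenerate: "nondegenerate_torsion A g \<Gamma>"
begin

lemma manifold: "smooth_manifold A" and metric: "riemannian_metric A g"
  and acs: "almost_complex_structure A J"
  using hermitian by (auto simp: hermitian_manifold_def)

lemma connection: "affine_connection A \<Gamma>" "metric_connection A g \<Gamma>" "complex_connection A J \<Gamma>"
  using bismut by (auto simp: bismut_connection_def)

lemma hermitian_splitting:
  assumes c: "c \<in> A" and x: "x \<in> cimg c"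
  shows "hermitian_splitting (g c x) (J c x) (H c x) (V c x)"
proof (intro hermitian_splitting.intro hermitian_space.intro hermitian_splitting_axioms.intro)
  show "bilinear (g c x)" "g c x u v = g c x v u" "u \<noteq> 0 \<Longrightarrow> 0 < g c x u u" for u v
    using metric c x unfolding riemannian_metric_def by blast+
  show "linear (J c x)" "J c x (J c x u) = - u" for u
    using acs c x unfolding almost_complex_structure_def by blast+
  show "g c x (J c x u) (J c x v) = g c x u v" for u v
    using hermitian c x unfolding hermitian_manifold_def by blast
  have "smooth_subbundle A (2 * m) H" "smooth_subbundle A 2 V"
    using split unfolding parallel_splitting_def by blast+
  from this[unfolded smooth_subbundle_def, THEN conjunct1, rule_format, OF c x]
  show "subspace (H c x)" "subspace (V c x)" "dim (V c x) = 2" by simp_all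
  show "\<exists>u\<in>H c x. \<exists>v\<in>V c x. w = u + v" "u \<in> H c x \<Longrightarrow> v \<in> V c x \<Longrightarrow> g c x u v = 0"
    "u \<in> H c x \<Longrightarrow> J c x u \<in> H c x" "u \<in> V c x \<Longrightarrow> J c x u \<in> V c x" for u v w
    using split c x unfolding parallel_splitting_def by blast+
qed

lemma chart_geometry:
  assumes c: "c \<in> A"
  shows "chart_geometry (cimg c) (g c) (J c) (\<Gamma> c) (H c) (V c)"
proof (rule chart_geometry.intro)
  show "open (cimg c)" using manifold c unfolding smooth_manifold_def by blast
  show "smooth_on (cimg c) (\<lambda>x. g c x u v)" for u v
    using metric c unfolding riemannian_metric_def by blast
  show "smooth_on (cimg c) (\<lambda>x. J c x u)" for u
    using acs c unfolding almost_complex_structure_def by blast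
  show "smooth_on (cimg c) (\<lambda>x. \<Gamma> c x u v)" for u v
    using connection(1) c unfolding affine_connection_def by blast
  show "\<exists>S Y. open S \<and> x \<in> S \<and> S \<subseteq> cimg c \<and> smooth_on S Y \<and> (\<forall>z\<in>S. Y z \<in> H c z) \<and> Y x = a"
    if "x \<in> cimg c" "a \<in> H c x" for x a
  proof -
    have "smooth_subbundle A (2 * m) H" using split unfolding parallel_splitting_def by blast
    from smooth_subbundle_section[where D = H, OF this c that] show ?thesis .
  qed
  show "\<exists>S Y. open S \<and> x \<in> S \<and> S \<subseteq> cimg c \<and> smooth_on S Y \<and> (\<forall>z\<in>S. Y z \<in> V c z) \<and> Y x = a"
    if "x \<in> cimg c" "a \<in> V c x" for x a
  proof -
    have "smooth_subbundle A (2) V" using split unfolding parallel_splitting_def by blast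
    from smooth_subbundle_section[where D = V, OF this c that] show ?thesis .
  qed
  show "frechet_derivative Y (at x) k + \<Gamma> c x k (Y x) \<in> H c x"
    if "open S" "S \<subseteq> cimg c" "smooth_on S Y" "\<And>z. z \<in> S \<Longrightarrow> Y z \<in> H c z" "x \<in> S" for S Y x k
  proof -
    have "parallel_subbundle A \<Gamma> H" using split unfolding parallel_splitting_def by blast
    from this[unfolded parallel_subbundle_def, rule_format, OF c, of S "\<lambda>_. k" Y x] show ?thesis
      using that by (simp add: cov_def smooth_on_const)
  qed
  show "frechet_derivative Y (at x) k + \<Gamma> c x k (Y x) \<in> V c x"
    if "open S" "S \<subseteq> cimg c" "smooth_on S Y" "\<And>z. z \<in> S \<Longrightarrow> Y z \<in> V c z" "x \<in> S" for S Y x k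
  proof -
    have "parallel_subbundle A \<Gamma> V" using split unfolding parallel_splitting_def by blast
    from this[unfolded parallel_subbundle_def, rule_format, OF c, of S "\<lambda>_. k" Y x] show ?thesis
      using that by (simp add: cov_def smooth_on_const)
  qed
  fix x assume x: "x \<in> cimg c"
  interpret hermitian_splitting "g c x" "J c x" "H c x" "V c x" by (rule hermitian_splitting[OF c x])
  show "hermitian_splitting (g c x) (J c x) (H c x) (V c x)" by (rule hermitian_splitting[OF c x])
  show "bilinear (\<Gamma> c x)"
    using connection(1) c x unfolding affine_connection_def by blast
  show "frechet_derivative (\<lambda>y. g c y u v) (at x) k = g c x (\<Gamma> c x k u) v + g c x u (\<Gamma> c x k v)" for u v k
    using connection(2)[unfolded metric_connection_def, rule_format, OF c _ x, of "\<lambda>_. k" "\<lambda>_. u" "\<lambda>_. v"]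
    by (simp add: cov_def smooth_on_const)
  show "frechet_derivative (\<lambda>y. J c y u) (at x) k + \<Gamma> c x k (J c x u) = J c x (\<Gamma> c x k u)" for u k
    using connection(3)[unfolded complex_connection_def, rule_format, OF c _ x, of "\<lambda>_. k" "\<lambda>_. u"]
    by (simp add: cov_def smooth_on_const)
  have t3: "torsion3 g \<Gamma> c x u v w = g c x (\<Gamma> c x u v - \<Gamma> c x v u) w" for u v w
    by (simp add: torsion3_def torsion_eq)
  show "\<exists>v w. g c x (\<Gamma> c x u v - \<Gamma> c x v u) w \<noteq> 0" if "u \<noteq> 0" for u
    using nondegenerate[unfolded nondegenerate_torsion_def, rule_format, OF c x that] unfolding t3 .
  \<comment> \<open>The double minus makes the second summand an instance of
    \<open>tensor21_type\<close> with \<open>s\<close> equal to - \<i>.\<close>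
  obtain \<sigma> \<tau> where \<sigma>: "\<sigma> \<in> tensor21 (forms2 \<i> (J c x) (V c x)) (forms1 (- \<i>) (J c x) (H c x))"
    and \<tau>: "\<tau> \<in> tensor21 (forms2 (- \<i>) (J c x) (V c x)) (forms1 (- (- \<i>)) (J c x) (H c x))"
    and eq: "\<And>u v w. complex_of_real (torsion3 g \<Gamma> c x u v w) = \<sigma> u v w + \<tau> u v w"
    using type c x unfolding torsion_type_def minus_minus by blast
  show "mixed_form (J c x) (H c x) (V c x) (\<lambda>u v w. g c x (\<Gamma> c x u v - \<Gamma> c x v u) w)"
    unfolding t3[symmetric] mixed_form_def alternating3_def
  proof (intro conjI allI ballI)
    show "linear (torsion3 g \<Gamma> c x u v)" for u v
      using h_bilinear unfolding t3[abs_def] bilinear_def by blast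
    show "torsion3 g \<Gamma> c x u v w = - torsion3 g \<Gamma> c x v u w"
      "torsion3 g \<Gamma> c x u v w = - torsion3 g \<Gamma> c x u w v" for u v w
      using bismut c x unfolding bismut_connection_def by blast+
    show "torsion3 g \<Gamma> c x a b d = 0" if "a \<in> H c x" "b \<in> H c x" "d \<in> H c x" for a b d
      using eq[of a b d] tensor21_type(1)[OF \<sigma> that] tensor21_type(1)[OF \<tau> that] by simp
    show "torsion3 g \<Gamma> c x y z u = 0" if "y \<in> V c x" "z \<in> V c x" for y z u
      using eq[of y z u] tensor21_type(2)[OF \<sigma> that] tensor21_type(2)[OF \<tau> that] by simp
    show "torsion3 g \<Gamma> c x (J c x a) b y = - torsion3 g \<Gamma> c x a b (J c x y)"
      if "a \<in> H c x" "b \<in> H c x" "y \<in> V c x" for a b y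
    proof -
      have "complex_of_real (torsion3 g \<Gamma> c x (J c x a) b y) = complex_of_real (- torsion3 g \<Gamma> c x a b (J c x y))"
        using tensor21_type(3)[OF \<sigma> that j_H[OF that(1)] j_V[OF that(3)]]
          tensor21_type(3)[OF \<tau> that j_H[OF that(1)] j_V[OF that(3)]]
        by (simp add: eq)
      then show ?thesis by (simp only: of_real_eq_iff)
    qed
  qed
qed

end

section \<open>Change of charts and global constancy\<close>

context bismut_splitting
begin

definition tor :: "('a, 'e) chart \<Rightarrow> 'e \<Rightarrow> 'e \<Rightarrow> 'e \<Rightarrow> 'e" where
  "tor c = (\<lambda>x u v. \<Gamma> c x u v - \<Gamma> c x v u)"

definition tor3 :: "('a, 'e) chart \<Rightarrow> 'e \<Rightarrow> 'e \<Rightarrow> 'e \<Rightarrow> 'e \<Rightarrow> real" where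
  "tor3 c x u v w = g c x (tor c x u v) w"

lemma torsion3_eq: "torsion3 g \<Gamma> c x u v w = tor3 c x u v w"
  by (simp add: torsion3_def torsion_eq tor3_def tor_def)

abbreviation conf :: "('a, 'e) chart \<Rightarrow> 'e \<Rightarrow> real \<Rightarrow> bool" where
  "conf c x \<equiv> hermitian_splitting.conformal_torsion (g c x) (H c x) (V c x) (tor c x)"

lemma chart:
  assumes "c \<in> A"
  shows "open (cdom c)" "open (cimg c)" "homeomorphism (cdom c) (cimg c) (cmap c) (cinv c)"
  using manifold assms unfolding smooth_manifold_def by blast+

lemma chart_cover: "(\<Union>c\<in>A. cdom c) = UNIV"
  using manifold unfolding smooth_manifold_def by blast

lemma cmap_in: "p \<in> cdom c \<Longrightarrow> cmap c p \<in> cimg c"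
  by (simp add: cimg_def)

lemma overlap_props:
  assumes "c \<in> A" "d \<in> A"
  shows "open (overlap c d)" "overlap c d \<subseteq> cimg c" "smooth_on (overlap c d) (transition c d)"
proof -
  note hom = chart(3)[OF assms(1)]
  have "overlap c d = cimg c \<inter> cinv c -` cdom d"
  proof (intro Set.set_eqI iffI)
    fix x assume "x \<in> overlap c d"
    then obtain p where "p \<in> cdom c" "p \<in> cdom d" "x = cmap c p" by (auto simp: overlap_def)
    then show "x \<in> cimg c \<inter> cinv c -` cdom d"
      using homeomorphism_apply1[OF hom] by (simp add: cmap_in)
  next
    fix x assume x: "x \<in> cimg c \<inter> cinv c -` cdom d"
    then obtain p where "p \<in> cdom c" "x = cmap c p" by (auto simp: cimg_def)
    then show "x \<in> overlap c d"
      using x homeomorphism_apply1[OF hom] by (auto simp: overlap_def)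
  qed
  then show "open (overlap c d)"
    using continuous_open_preimage[OF homeomorphism_cont2[OF hom] chart(2)[OF assms(1)] chart(1)[OF assms(2)]]
    by simp
  show "overlap c d \<subseteq> cimg c" by (auto simp: overlap_def cimg_def)
  show "smooth_on (overlap c d) (transition c d)"
    using manifold assms unfolding smooth_manifold_def by blast
qed

lemma overlap_point:
  assumes "c \<in> A" "p \<in> cdom c" "p \<in> cdom d"
  shows "cmap c p \<in> overlap c d" "transition c d (cmap c p) = cmap d p"
  using assms homeomorphism_apply1[OF chart(3)[OF assms(1)]] by (auto simp: overlap_def transition_def)

context
  fixes c d :: "('a, 'e) chart" and x :: 'e
  assumes cd: "c \<in> A" "d \<in> A" and x: "x \<in> overlap c d"
begin

lemma g_change: "g d (transition c d x) (jac c d x u) (jac c d x v) = g c x u v"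
  using metric cd x unfolding riemannian_metric_def by auto

lemma J_change: "J d (transition c d x) (jac c d x u) = jac c d x (J c x u)"
  using acs cd x unfolding almost_complex_structure_def by auto

lemma jac_linear: "linear (jac c d x)"
  unfolding jac_def
  by (rule has_derivative_linear[OF smooth_on_has_derivative[OF overlap_props(1)[OF cd] x overlap_props(3)[OF cd]]])

text \<open>The inhomogeneous term in the law for Christoffel symbols is a second derivative of the
  coordinate change; it is symmetric and cancels from the torsion.\<close>

lemma tor_change: "tor d (transition c d x) (jac c d x u) (jac c d x v) = jac c d x (tor c x u v)"
proof -
  have law: "jac c d x (\<Gamma> c x u v) = frechet_derivative (\<lambda>y. jac c d y v) (at x) u
      + \<Gamma> d (transition c d x) (jac c d x u) (jac c d x v)" for u v
    using connection(1) cd x unfolding affine_connection_def by blast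
  have "frechet_derivative (\<lambda>y. jac c d y v) (at x) u = frechet_derivative (\<lambda>y. jac c d y u) (at x) v"
    unfolding jac_def by (rule second_derivative_symmetric[OF overlap_props(1)[OF cd] x overlap_props(3)[OF cd]])
  then show ?thesis
    by (simp add: tor_def linear_diff[OF jac_linear] law)
qed

lemma tor3_change:
  "tor3 d (transition c d x) (jac c d x u) (jac c d x v) (jac c d x w) = tor3 c x u v w"
  by (simp add: tor3_def tor_change g_change)

lemma HV_change: "jac c d x ` H c x = H d (transition c d x)" "jac c d x ` V c x = V d (transition c d x)"
proof -
  have "smooth_subbundle A (2 * m) H" "smooth_subbundle A 2 V"
    using split unfolding parallel_splitting_def by blast+
  from this[unfolded smooth_subbundle_def, THEN conjunct2, THEN conjunct2, rule_format, OF cd x]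
  show "jac c d x ` H c x = H d (transition c d x)" "jac c d x ` V c x = V d (transition c d x)" by simp_all
qed

end

lemma conf_overlap:
  assumes c: "c \<in> A" "p \<in> cdom c" and d: "d \<in> A" "p \<in> cdom d" and \<mu>: "conf c (cmap c p) \<mu>"
  shows "conf d (cmap d p) \<mu>"
proof -
  let ?x = "cmap c p" and ?y = "cmap d p"
  note o = overlap_point[OF c d(2)]
  note ch = g_change[OF c(1) d(1) o(1)] tor_change[OF c(1) d(1) o(1)] HV_change[OF c(1) d(1) o(1)]
  interpret C: hermitian_splitting "g c ?x" "J c ?x" "H c ?x" "V c ?x"
    by (rule hermitian_splitting[OF c(1) cmap_in[OF c(2)]])
  interpret D: hermitian_splitting "g d ?y" "J d ?y" "H d ?y" "V d ?y"
    by (rule hermitian_splitting[OF d(1) cmap_in[OF d(2)]])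
  show ?thesis
    unfolding D.conformal_torsion_def
  proof (intro ballI)
    fix y a assume "y \<in> V d ?y" "a \<in> H d ?y"
    then obtain y' a' where "y' \<in> V c ?x" "a' \<in> H c ?x" "y = jac c d ?x y'" "a = jac c d ?x a'"
      using ch(3,4) unfolding o(2) by blast
    then show "g d ?y (tor d ?y y a) (tor d ?y y a) = \<mu> * g d ?y y y * g d ?y a a"
      using \<mu> ch(1,2) unfolding o(2) C.conformal_torsion_def by simp
  qed
qed

lemma geometry_facts:
  assumes c: "c \<in> A" and x: "x \<in> cimg c"
  shows "mixed_form (J c x) (H c x) (V c x) (\<lambda>u v w. g c x (tor c x u v) w)" "bilinear (tor c x)"
    "u \<noteq> 0 \<Longrightarrow> \<exists>v w. g c x (tor c x u v) w \<noteq> 0"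
  using chart_geometry.T_mixed[OF chart_geometry[OF c] x] chart_geometry.T_bilinear[OF chart_geometry[OF c] x]
    chart_geometry.T_nondeg[OF chart_geometry[OF c] x] unfolding tor_def by blast+

lemma conf_pos:
  assumes c: "c \<in> A" and x: "x \<in> cimg c" and \<mu>: "conf c x \<mu>"
  shows "\<mu> > 0" "\<exists>a\<in>H c x. a \<noteq> 0" "\<exists>y\<in>V c x. y \<noteq> 0"
  using hermitian_splitting.conformal_torsion_pos[OF hermitian_splitting[OF c x] geometry_facts[OF c x] \<mu>] by blast+

lemma conf_unique:
  assumes c: "c \<in> A" and x: "x \<in> cimg c" and \<mu>: "conf c x \<mu>" and \<nu>: "conf c x \<nu>"
  shows "\<mu> = \<nu>"
proof -
  interpret hermitian_splitting "g c x" "J c x" "H c x" "V c x" by (rule hermitian_splitting[OF c x])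
  obtain a y where a: "a \<in> H c x" "a \<noteq> 0" and y: "y \<in> V c x" "y \<noteq> 0"
    using conf_pos[OF c x \<mu>] by blast
  have "\<mu> * g c x y y * g c x a a = \<nu> * g c x y y * g c x a a"
    using \<mu> \<nu> a y unfolding conformal_torsion_def by metis
  then show ?thesis using h_pos[OF a(2)] h_pos[OF y(2)] by simp
qed

text \<open>The factor at a point is the same in all charts and unique, so it defines a function on
  the manifold; this function is locally constant and the manifold is connected.\<close>

lemma conf_constant: "\<exists>\<mu>. \<forall>c\<in>A. \<forall>x\<in>cimg c. conf c x \<mu>"
proof -
  define f where "f = (\<lambda>p. SOME \<mu>. \<forall>c\<in>A. p \<in> cdom c \<longrightarrow> conf c (cmap c p) \<mu>)"
  have f: "f p = \<mu>" if c: "c \<in> A" "p \<in> cdom c" and \<mu>: "conf c (cmap c p) \<mu>" for c p \<mu>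
  proof -
    have "\<forall>d\<in>A. p \<in> cdom d \<longrightarrow> conf d (cmap d p) \<mu>" using conf_overlap[OF c _ _ \<mu>] by blast
    then have "\<forall>d\<in>A. p \<in> cdom d \<longrightarrow> conf d (cmap d p) (f p)"
      unfolding f_def by (rule someI[of "\<lambda>\<mu>. \<forall>c\<in>A. p \<in> cdom c \<longrightarrow> conf c (cmap c p) \<mu>"])
    then show ?thesis using conf_unique[OF c(1) cmap_in[OF c(2)] _ \<mu>] c by blast
  qed
  have loc: "\<exists>N. open N \<and> p \<in> N \<and> (\<forall>q\<in>N. f p = f q)" for p
  proof -
    obtain c where c: "c \<in> A" "p \<in> cdom c" using chart_cover by (metis UNIV_I UN_E)
    obtain \<mu> S where S: "open S" "cmap c p \<in> S" "S \<subseteq> cimg c" "\<forall>z\<in>S. conf c z \<mu>"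
      using chart_geometry.conformal_locally_constant[OF chart_geometry[OF c(1)] cmap_in[OF c(2)]]
      unfolding tor_def by blast
    have "open (cdom c \<inter> cmap c -` S)"
      by (rule continuous_open_preimage[OF homeomorphism_cont1[OF chart(3)[OF c(1)]] chart(1)[OF c(1)] S(1)])
    moreover have "f q = \<mu>" if "q \<in> cdom c \<inter> cmap c -` S" for q
      using f[OF c(1), of q \<mu>] that S(4) by blast
    ultimately show ?thesis using c(2) S(2) by (intro exI[of _ "cdom c \<inter> cmap c -` S"]) auto
  qed
  have "connected (UNIV :: 'a set)" using manifold unfolding smooth_manifold_def by blast
  then have const: "f p = f q" for p q
    by (rule connected_local_const[OF _ UNIV_I UNIV_I]) (use loc in \<open>auto simp: eventually_at_topological, metis\<close>)
  \<comment> \<open>\<open>undefined\<close> is just an arbitrary base point at which the constant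
    is read off.\<close>
  have "conf c x (f undefined)" if c: "c \<in> A" and x: "x \<in> cimg c" for c x
  proof -
    obtain p where p: "p \<in> cdom c" "x = cmap c p" using x by (auto simp: cimg_def)
    obtain \<mu> where \<mu>: "conf c x \<mu>"
      using chart_geometry.conformal_exists[OF chart_geometry[OF c] x] unfolding tor_def by blast
    then show ?thesis using f[OF c p(1)] p(2) const[of p undefined] by simp
  qed
  then show ?thesis by blast
qed

section \<open>The parallel tensor built from the torsion\<close>

text \<open>On forms of type \<open>(2,1)\<close> the derivation induced by \<open>J\<close> acts by \<open>\<i>\<close>, on type \<open>(1,2)\<close> by
  \<open>-\<i>\<close>; so \<open>S \<mu>\<close> is \<open>2 / sqrt \<mu>\<close> times the \<open>(2,1)\<close>-part of the torsion.\<close>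

definition S :: "real \<Rightarrow> ('a, 'e) tensor3" where
  "S \<mu> c x u v w = complex_of_real (1 / sqrt \<mu>) * (complex_of_real (tor3 c x u v w)
     - \<i> * complex_of_real (tor3 c x (J c x u) v w + tor3 c x u (J c x v) w + tor3 c x u v (J c x w)))"

lemma tor3_linear:
  assumes "c \<in> A" "x \<in> cimg c"
  shows "tor3 c x (u + u') v w = tor3 c x u v w + tor3 c x u' v w" "tor3 c x (r *\<^sub>R u) v w = r * tor3 c x u v w"
    "tor3 c x u (v + v') w = tor3 c x u v w + tor3 c x u v' w" "tor3 c x u (r *\<^sub>R v) w = r * tor3 c x u v w"
    "tor3 c x u v (w + w') = tor3 c x u v w + tor3 c x u v w'" "tor3 c x u v (r *\<^sub>R w) = r * tor3 c x u v w"
proof -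
  interpret hermitian_splitting "g c x" "J c x" "H c x" "V c x" by (rule hermitian_splitting[OF assms])
  note Tb = geometry_facts(2)[OF assms]
  show "tor3 c x (u + u') v w = tor3 c x u v w + tor3 c x u' v w" "tor3 c x (r *\<^sub>R u) v w = r * tor3 c x u v w"
    "tor3 c x u (v + v') w = tor3 c x u v w + tor3 c x u v' w" "tor3 c x u (r *\<^sub>R v) w = r * tor3 c x u v w"
    "tor3 c x u v (w + w') = tor3 c x u v w + tor3 c x u v w'" "tor3 c x u v (r *\<^sub>R w) = r * tor3 c x u v w"
    by (simp_all add: tor3_def bilinear_ladd[OF Tb] bilinear_radd[OF Tb] bilinear_lmul[OF Tb] bilinear_rmul[OF Tb])
qed

lemma tor3_field:
  assumes c: "c \<in> A" and sm: "smooth_on (cimg c) X" "smooth_on (cimg c) Y" "smooth_on (cimg c) Z"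
  shows "smooth_on (cimg c) (\<lambda>y. tor3 c y (X y) (Y y) (Z y))"
    and "x \<in> cimg c \<Longrightarrow> frechet_derivative (\<lambda>y. tor3 c y (X y) (Y y) (Z y)) (at x) (W x)
      = tor3 c x (cov (\<Gamma> c) W X x) (Y x) (Z x) + tor3 c x (X x) (cov (\<Gamma> c) W Y x) (Z x)
        + tor3 c x (X x) (Y x) (cov (\<Gamma> c) W Z x)"
proof -
  interpret chart_geometry "cimg c" "g c" "J c" "\<Gamma> c" "H c" "V c" "\<lambda>x u v. \<Gamma> c x u v - \<Gamma> c x v u"
    by (rule chart_geometry[OF c]) simp
  note A = U_open order_refl
  show "smooth_on (cimg c) (\<lambda>y. tor3 c y (X y) (Y y) (Z y))"
    unfolding tor3_def tor_def by (rule g_apply_smooth[OF A T_apply_smooth[OF A sm(1,2)] sm(3)])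
  have cov: "cov (\<Gamma> c) W F x = nab F (W x) x" for F by (simp add: cov_def nab_def)
  assume x: "x \<in> cimg c"
  interpret hermitian_splitting "g c x" "J c x" "H c x" "V c x" by (rule hermitian_splitting[OF c x])
  show "frechet_derivative (\<lambda>y. tor3 c y (X y) (Y y) (Z y)) (at x) (W x)
      = tor3 c x (cov (\<Gamma> c) W X x) (Y x) (Z x) + tor3 c x (X x) (cov (\<Gamma> c) W Y x) (Z x)
        + tor3 c x (X x) (Y x) (cov (\<Gamma> c) W Z x)"
    unfolding tor3_def tor_def cov
    using deriv_T3[OF A x sm, of "W x"] NT_eq_0[OF x] by simp
qed

lemma J_field:
  assumes c: "c \<in> A" and Y: "smooth_on (cimg c) Y"
  shows "smooth_on (cimg c) (\<lambda>y. J c y (Y y))"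
    and "x \<in> cimg c \<Longrightarrow> cov (\<Gamma> c) W (\<lambda>y. J c y (Y y)) x = J c x (cov (\<Gamma> c) W Y x)"
proof -
  interpret chart_geometry "cimg c" "g c" "J c" "\<Gamma> c" "H c" "V c" "\<lambda>x u v. \<Gamma> c x u v - \<Gamma> c x v u"
    by (rule chart_geometry[OF c]) simp
  note A = U_open order_refl
  show "smooth_on (cimg c) (\<lambda>y. J c y (Y y))" by (rule J_apply_smooth[OF A Y])
  show "x \<in> cimg c \<Longrightarrow> cov (\<Gamma> c) W (\<lambda>y. J c y (Y y)) x = J c x (cov (\<Gamma> c) W Y x)"
    using nab_J[OF A _ Y, of x "W x"] by (simp add: cov_def nab_def)
qed

lemma S_smooth:
  assumes c: "c \<in> A" and sm: "smooth_on (cimg c) X" "smooth_on (cimg c) Y" "smooth_on (cimg c) Z"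
  shows "smooth_on (cimg c) (\<lambda>x. S \<mu> c x (X x) (Y x) (Z x))"
  unfolding S_def
  by (intro smooth_on_mult smooth_on_diff smooth_on_const smooth_on_of_real smooth_on_add chart(2)[OF c]
      tor3_field(1)[OF c] J_field(1)[OF c] sm)

lemma S_complex_tensor: "complex_tensor3 A (S \<mu>)"
  unfolding complex_tensor3_def
proof (intro conjI ballI allI)
  fix c x u v assume c: "c \<in> A" and x: "x \<in> cimg c"
  interpret hermitian_splitting "g c x" "J c x" "H c x" "V c x" by (rule hermitian_splitting[OF c x])
  note [simp] = tor3_linear[OF c x]
  show "linear (\<lambda>w. S \<mu> c x w u v)" "linear (\<lambda>w. S \<mu> c x u w v)" "linear (\<lambda>w. S \<mu> c x u v w)"
    by (rule linearI; simp add: S_def scaleR_conv_of_real algebra_simps)+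
next
  fix c u v w assume "c \<in> A"
  then show "smooth_on (cimg c) (\<lambda>x. S \<mu> c x u v w)" by (intro S_smooth smooth_on_const)
next
  fix c d x u v w assume cd: "c \<in> A" "d \<in> A" and x: "x \<in> overlap c d"
  show "S \<mu> c x u v w = S \<mu> d (transition c d x) (jac c d x u) (jac c d x v) (jac c d x w)"
    unfolding S_def J_change[OF cd x] tor3_change[OF cd x] ..
qed

text \<open>\<open>S\<close> is an algebraic expression in the 3-form and \<open>J\<close>, both
  parallel, so the Leibniz rule holds term by term.\<close>

lemma S_parallel: "parallel_tensor3 A \<Gamma> (S \<mu>)"
  unfolding parallel_tensor3_def
proof (intro conjI ballI allI impI S_complex_tensor)
  fix c and W X Y Z :: "'e \<Rightarrow> 'e" and x :: 'e
  assume c: "c \<in> A" and x: "x \<in> cimg c"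
    and sm: "smooth_on (cimg c) W \<and> smooth_on (cimg c) X \<and> smooth_on (cimg c) Y \<and> smooth_on (cimg c) Z"
  define F where "F = (\<lambda>X Y Z y. tor3 c y (X y) (Y y) (Z y))"
  define JJ where "JJ = (\<lambda>(X::'e \<Rightarrow> 'e) y. J c y (X y))"
  have sJ: "smooth_on (cimg c) (JJ X)" if "smooth_on (cimg c) X" for X
    unfolding JJ_def by (rule J_field(1)[OF c that])
  have hd: "(F X Y Z has_derivative frechet_derivative (F X Y Z) (at x)) (at x)"
    if "smooth_on (cimg c) X" "smooth_on (cimg c) Y" "smooth_on (cimg c) Z" for X Y Z :: "'e \<Rightarrow> 'e"
    unfolding F_def by (rule smooth_on_has_derivative[OF chart(2)[OF c] x tor3_field(1)[OF c that]])
  have S_F: "(\<lambda>y. S \<mu> c y (X y) (Y y) (Z y)) = (\<lambda>y. complex_of_real (1 / sqrt \<mu>) * (complex_of_real (F X Y Z y)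
     - \<i> * complex_of_real (F (JJ X) Y Z y + F X (JJ Y) Z y + F X Y (JJ Z) y)))"
    by (simp add: S_def F_def JJ_def fun_eq_iff)
  have "((\<lambda>y. S \<mu> c y (X y) (Y y) (Z y)) has_derivative (\<lambda>k. complex_of_real (1 / sqrt \<mu>) *
     (complex_of_real (frechet_derivative (F X Y Z) (at x) k) - \<i> * complex_of_real (
       frechet_derivative (F (JJ X) Y Z) (at x) k + frechet_derivative (F X (JJ Y) Z) (at x) k
       + frechet_derivative (F X Y (JJ Z)) (at x) k)))) (at x)"
    unfolding S_F
    by (intro has_derivative_mult_right has_derivative_diff has_derivative_of_real has_derivative_add hd sJ)
      (use sm in auto)
  note fd = fun_cong[OF frechet_derivative_at[OF this], of "W x", symmetric]
  have sX: "smooth_on (cimg c) X" and sY: "smooth_on (cimg c) Y" and sZ: "smooth_on (cimg c) Z"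
    using sm by auto
  have cJ: "cov (\<Gamma> c) W (JJ Y) x = J c x (cov (\<Gamma> c) W Y x)" if "smooth_on (cimg c) Y" for Y
    unfolding JJ_def by (rule J_field(2)[OF c that x])
  have JJx: "JJ Y x = J c x (Y x)" for Y by (simp add: JJ_def)
  have fr: "frechet_derivative (F X Y Z) (at x) (W x)
      = tor3 c x (cov (\<Gamma> c) W X x) (Y x) (Z x) + tor3 c x (X x) (cov (\<Gamma> c) W Y x) (Z x)
        + tor3 c x (X x) (Y x) (cov (\<Gamma> c) W Z x)"
    if "smooth_on (cimg c) X" "smooth_on (cimg c) Y" "smooth_on (cimg c) Z" for X Y Z :: "'e \<Rightarrow> 'e"
    unfolding F_def by (rule tor3_field(2)[OF c that x])
  show "frechet_derivative (\<lambda>y. S \<mu> c y (X y) (Y y) (Z y)) (at x) (W x) =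
      S \<mu> c x (cov (\<Gamma> c) W X x) (Y x) (Z x) + S \<mu> c x (X x) (cov (\<Gamma> c) W Y x) (Z x)
      + S \<mu> c x (X x) (Y x) (cov (\<Gamma> c) W Z x)"
    unfolding fd fr[OF sX sY sZ] fr[OF sJ[OF sX] sY sZ] fr[OF sX sJ[OF sY] sZ] fr[OF sX sY sJ[OF sZ]]
      cJ[OF sX] cJ[OF sY] cJ[OF sZ] JJx
    by (simp add: S_def algebra_simps)
qed

text \<open>Compatibility with \<open>J\<close> is phrased through g(Ju, v) so that all three
  invariants are scalars constant along the curve. The fields JW and T(W, W') being parallel, each
  case is an instance of \<open>parallel_g\<close>.\<close>

lemma transport_invariant:
  assumes "parallel_transport A \<Gamma> p c q d P"
  shows "c \<in> A \<and> d \<in> A \<and> p \<in> cdom c \<and> q \<in> cdom d \<and>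
    (\<forall>u v. g d (cmap d q) (P u) (P v) = g c (cmap c p) u v) \<and>
    (\<forall>u v. g d (cmap d q) (J d (cmap d q) (P u)) (P v) = g c (cmap c p) (J c (cmap c p) u) v) \<and>
    (\<forall>u v w. tor3 d (cmap d q) (P u) (P v) (P w) = tor3 c (cmap c p) u v w)"
  using assms
proof (induction rule: parallel_transport.induct)
  case (segment \<gamma> c d P)
  have \<gamma>: "continuous_on UNIV \<gamma>" using segment(1) by (simp add: smooth_curve_def)
  have W: "\<exists>W. parallel_along A \<Gamma> \<gamma> W \<and> W c 0 = u \<and> W d 1 = P u" for u using segment(6) by blast
  have coord: "((\<lambda>s. cmap c (\<gamma> s)) has_vector_derivative vector_derivative (cmap c \<circ> \<gamma>) (at t)) (at t)"
    and op: "open (\<gamma> -` cdom c)" if "c \<in> A" "\<gamma> t \<in> cdom c" for c t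
  proof -
    show op: "open (\<gamma> -` cdom c)" using \<gamma> chart(1)[OF that(1)] by (simp add: continuous_on_open_vimage)
    have "smooth_on (\<gamma> -` cdom c) (cmap c \<circ> \<gamma>)" using segment(1) that by (simp add: smooth_curve_def)
    from smooth_on_has_derivative[OF op _ this, of t] have "(cmap c \<circ> \<gamma>) differentiable (at t)"
      using that differentiableI by auto
    then show "((\<lambda>s. cmap c (\<gamma> s)) has_vector_derivative vector_derivative (cmap c \<circ> \<gamma>) (at t)) (at t)"
      by (simp add: vector_derivative_works o_def)
  qed
  have along: "(W c has_vector_derivative
           - \<Gamma> c (cmap c (\<gamma> t)) (vector_derivative (cmap c \<circ> \<gamma>) (at t)) (W c t)) (at t)"
    if "parallel_along A \<Gamma> \<gamma> W" "c \<in> A" "\<gamma> t \<in> cdom c" for W c t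
    using that unfolding parallel_along_def by blast
  have along_change: "W d t = jac c d (cmap c (\<gamma> t)) (W c t)"
    if "parallel_along A \<Gamma> \<gamma> W" "c \<in> A" "d \<in> A" "\<gamma> t \<in> cdom c" "\<gamma> t \<in> cdom d" for W c d t
    using that unfolding parallel_along_def by blast
  note const = constant_along_curve[OF chart_cover chart(1) \<gamma> _ _ segment(2,4,3,5)]
  have "g d (cmap d (\<gamma> 1)) (P u) (P v) = g c (cmap c (\<gamma> 0)) u v" for u v
  proof -
    obtain W1 W2 where W1: "parallel_along A \<Gamma> \<gamma> W1" "W1 c 0 = u" "W1 d 1 = P u"
      and W2: "parallel_along A \<Gamma> \<gamma> W2" "W2 c 0 = v" "W2 d 1 = P v" using W by meson
    have "g c (cmap c (\<gamma> 0)) (W1 c 0) (W2 c 0) = g d (cmap d (\<gamma> 1)) (W1 d 1) (W2 d 1)"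
    proof (rule const[where f = "\<lambda>c t. g c (cmap c (\<gamma> t)) (W1 c t) (W2 c t)"])
      fix c t assume c: "c \<in> A" "\<gamma> t \<in> cdom c"
      have in_img: "cmap c (\<gamma> s) \<in> cimg c" if "s \<in> \<gamma> -` cdom c" for s using that by (intro cmap_in) simp
      have t: "t \<in> \<gamma> -` cdom c" using c by simp
      show "((\<lambda>t. g c (cmap c (\<gamma> t)) (W1 c t) (W2 c t)) has_vector_derivative 0) (at t)"
        by (rule chart_geometry.parallel_g[OF chart_geometry[OF c(1)] op[OF c] t in_img coord[OF c]
              along[OF W1(1) c] along[OF W2(1) c]])
    next
      fix c d t assume c: "c \<in> A" and d: "d \<in> A" and p: "\<gamma> t \<in> cdom c" "\<gamma> t \<in> cdom d"
      show "g c (cmap c (\<gamma> t)) (W1 c t) (W2 c t) = g d (cmap d (\<gamma> t)) (W1 d t) (W2 d t)"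
        using g_change[OF c d overlap_point(1)[OF c p]] overlap_point(2)[OF c p]
        by (simp add: along_change[OF W1(1) c d p] along_change[OF W2(1) c d p])
    qed
    then show ?thesis using W1 W2 by simp
  qed
  moreover have "g d (cmap d (\<gamma> 1)) (J d (cmap d (\<gamma> 1)) (P u)) (P v)
      = g c (cmap c (\<gamma> 0)) (J c (cmap c (\<gamma> 0)) u) v" for u v
  proof -
    obtain W1 W2 where W1: "parallel_along A \<Gamma> \<gamma> W1" "W1 c 0 = u" "W1 d 1 = P u"
      and W2: "parallel_along A \<Gamma> \<gamma> W2" "W2 c 0 = v" "W2 d 1 = P v" using W by meson
    have "g c (cmap c (\<gamma> 0)) (J c (cmap c (\<gamma> 0)) (W1 c 0)) (W2 c 0)
        = g d (cmap d (\<gamma> 1)) (J d (cmap d (\<gamma> 1)) (W1 d 1)) (W2 d 1)"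
    proof (rule const[where f = "\<lambda>c t. g c (cmap c (\<gamma> t)) (J c (cmap c (\<gamma> t)) (W1 c t)) (W2 c t)"])
      fix c t assume c: "c \<in> A" "\<gamma> t \<in> cdom c"
      note geo = chart_geometry[OF c(1)]
      have in_img: "cmap c (\<gamma> s) \<in> cimg c" if "s \<in> \<gamma> -` cdom c" for s using that by (intro cmap_in) simp
      have t: "t \<in> \<gamma> -` cdom c" using c by simp
      note J = chart_geometry.parallel_J[OF geo op[OF c] t in_img coord[OF c] along[OF W1(1) c]]
      show "((\<lambda>t. g c (cmap c (\<gamma> t)) (J c (cmap c (\<gamma> t)) (W1 c t)) (W2 c t)) has_vector_derivative 0) (at t)"
        by (rule chart_geometry.parallel_g[OF geo op[OF c] t in_img coord[OF c] J along[OF W2(1) c]])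
    next
      fix c d t assume c: "c \<in> A" and d: "d \<in> A" and p: "\<gamma> t \<in> cdom c" "\<gamma> t \<in> cdom d"
      note o = overlap_point[OF c p]
      show "g c (cmap c (\<gamma> t)) (J c (cmap c (\<gamma> t)) (W1 c t)) (W2 c t)
          = g d (cmap d (\<gamma> t)) (J d (cmap d (\<gamma> t)) (W1 d t)) (W2 d t)"
        using g_change[OF c d o(1)] J_change[OF c d o(1)] o(2)
        by (simp add: along_change[OF W1(1) c d p] along_change[OF W2(1) c d p])
    qed
    then show ?thesis using W1 W2 by simp
  qed
  moreover have "tor3 d (cmap d (\<gamma> 1)) (P u) (P v) (P w) = tor3 c (cmap c (\<gamma> 0)) u v w" for u v w
  proof -
    obtain W1 W2 W3 where W1: "parallel_along A \<Gamma> \<gamma> W1" "W1 c 0 = u" "W1 d 1 = P u"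
      and W2: "parallel_along A \<Gamma> \<gamma> W2" "W2 c 0 = v" "W2 d 1 = P v"
      and W3: "parallel_along A \<Gamma> \<gamma> W3" "W3 c 0 = w" "W3 d 1 = P w" using W by meson
    have "tor3 c (cmap c (\<gamma> 0)) (W1 c 0) (W2 c 0) (W3 c 0) = tor3 d (cmap d (\<gamma> 1)) (W1 d 1) (W2 d 1) (W3 d 1)"
    proof (rule const[where f = "\<lambda>c t. tor3 c (cmap c (\<gamma> t)) (W1 c t) (W2 c t) (W3 c t)"])
      fix c t assume c: "c \<in> A" "\<gamma> t \<in> cdom c"
      note geo = chart_geometry[OF c(1)]
      have in_img: "cmap c (\<gamma> s) \<in> cimg c" if "s \<in> \<gamma> -` cdom c" for s using that by (intro cmap_in) simp
      have t: "t \<in> \<gamma> -` cdom c" using c by simp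
      note T = chart_geometry.parallel_T[OF geo op[OF c] t in_img coord[OF c] along[OF W1(1) c] along[OF W2(1) c]]
      show "((\<lambda>t. tor3 c (cmap c (\<gamma> t)) (W1 c t) (W2 c t) (W3 c t)) has_vector_derivative 0) (at t)"
        unfolding tor3_def tor_def
        by (rule chart_geometry.parallel_g[OF geo op[OF c] t in_img coord[OF c] T along[OF W3(1) c]])
    next
      fix c d t assume c: "c \<in> A" and d: "d \<in> A" and p: "\<gamma> t \<in> cdom c" "\<gamma> t \<in> cdom d"
      show "tor3 c (cmap c (\<gamma> t)) (W1 c t) (W2 c t) (W3 c t) = tor3 d (cmap d (\<gamma> t)) (W1 d t) (W2 d t) (W3 d t)"
        using tor3_change[OF c d overlap_point(1)[OF c p]] overlap_point(2)[OF c p]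
        by (simp add: along_change[OF W1(1) c d p] along_change[OF W2(1) c d p] along_change[OF W3(1) c d p])
    qed
    then show ?thesis using W1 W2 W3 by simp
  qed
  ultimately show ?case using segment(2-5) by blast
next
  case (concat p c q d P r e Q)
  then show ?case by simp
qed

lemma adapted_frame_at:
  assumes all: "\<forall>c\<in>A. \<forall>x\<in>cimg c. conf c x \<mu>" and c: "c \<in> A" and p: "p \<in> cdom c"
  shows "\<exists>n E. m = 2 * n \<and> unitary_frame (g c (cmap c p)) (J c (cmap c p)) (2 * n + 1) E \<and>
    (\<forall>k<2 * n. E k \<in> H c (cmap c p)) \<and> E (2 * n) \<in> V c (cmap c p) \<and>
    (\<forall>P \<in> holonomy_group A \<Gamma> p c. acts_via (g c (cmap c p)) (J c (cmap c p)) (2 * n + 1) E (rho_SpU1 n) P) \<and>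
    (\<forall>u v w. S \<mu> c (cmap c p) u v w = T0 n (frame_coords (g c (cmap c p)) (J c (cmap c p)) (2 * n + 1) E u)
       (frame_coords (g c (cmap c p)) (J c (cmap c p)) (2 * n + 1) E v)
       (frame_coords (g c (cmap c p)) (J c (cmap c p)) (2 * n + 1) E w))"
proof -
  define x where "x = cmap c p"
  have x: "x \<in> cimg c" using cmap_in[OF p] by (simp add: x_def)
  interpret hermitian_splitting "g c x" "J c x" "H c x" "V c x" by (rule hermitian_splitting[OF c x])
  have \<mu>: "conf c x \<mu>" using all c x by blast
  note pos = conf_pos[OF c x \<mu>]
  obtain n E where dimH: "dim (H c x) = 4 * n" and frame: "unitary_frame (g c x) (J c x) (2 * n + 1) E"
    and EHV: "\<forall>k<2 * n. E k \<in> H c x" "E (2 * n) \<in> V c x"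
    and form: "\<And>u v w. g c x (tor c x u v) w = sqrt \<mu> * Re (T0 n (frame_coords (g c x) (J c x) (2 * n + 1) E u)
        (frame_coords (g c x) (J c x) (2 * n + 1) E v) (frame_coords (g c x) (J c x) (2 * n + 1) E w))"
    using adapted_frame[OF geometry_facts(1,2)[OF c x] \<mu> pos(1)] by blast
  let ?f = "frame_coords (g c x) (J c x) (2 * n + 1) E"
  have "smooth_subbundle A (2 * m) H" using split unfolding parallel_splitting_def by blast
  from this[unfolded smooth_subbundle_def, THEN conjunct1, rule_format, OF c x]
  have m: "m = 2 * n" using dimH by simp
  have n: "n > 0" using pos(2) dimH dim_eq_0[of "H c x"] by (cases "n = 0") auto
  have S_T0: "S \<mu> c x u v w = T0 n (?f u) (?f v) (?f w)" for u v w
  \<comment> \<open>The 3-form is sqrt \<mu> times Re T0, and its derivation by \<open>J\<close> is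
    sqrt \<mu> times Re of \<i> T0, that is - sqrt \<mu> times Im T0. \<open>S\<close> recombines
    the two parts into T0.\<close>
  proof -
    have "tor3 c x (J c x u) v w + tor3 c x u (J c x v) w + tor3 c x u v (J c x w)
       = sqrt \<mu> * Re (T0 n (?f (J c x u)) (?f v) (?f w) + T0 n (?f u) (?f (J c x v)) (?f w)
          + T0 n (?f u) (?f v) (?f (J c x w)))"
      unfolding tor3_def form plus_complex.sel by (simp add: algebra_simps)
    also have "\<dots> = - sqrt \<mu> * Im (T0 n (?f u) (?f v) (?f w))" unfolding T0_frame_j by simp
    finally have J_sum: "tor3 c x (J c x u) v w + tor3 c x u (J c x v) w + tor3 c x u v (J c x w)
       = - sqrt \<mu> * Im (T0 n (?f u) (?f v) (?f w))" .
    have "tor3 c x u v w = sqrt \<mu> * Re (T0 n (?f u) (?f v) (?f w))" unfolding tor3_def form ..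
    then show ?thesis
      unfolding S_def J_sum using pos(1) by (simp add: complex_eq_iff)
  qed
  interpret F: unitary_framed_space "g c x" "J c x" "2 * n + 1" E by unfold_locales (rule frame)
  have hol: "acts_via (g c x) (J c x) (2 * n + 1) E (rho_SpU1 n) P" if "P \<in> holonomy_group A \<Gamma> p c" for P
  proof -
    have inv: "\<forall>u v. g c x (P u) (P v) = g c x u v" "\<forall>u v. g c x (J c x (P u)) (P v) = g c x (J c x u) v"
      "\<forall>u v w. tor3 c x (P u) (P v) (P w) = tor3 c x u v w"
      using transport_invariant[of p c p c P] that unfolding holonomy_group_def x_def by auto
    \<comment> \<open>Only pairings against vectors \<open>P v\<close> are known to be preserved;
      surjectivity of the isometry makes these all vectors.\<close>
    have PJ: "P (J c x u) = J c x (P u)" for u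
    proof (rule h_eqI)
      fix b
      obtain v where v: "b = P v" using F.isometry_surj[of P] inv(1) by (metis surj_def)
      show "g c x (P (J c x u)) b = g c x (J c x (P u)) b" unfolding v using inv(1,2) by simp
    qed
    have "T0 n (?f (P u)) (?f (P v)) (?f (P w)) = T0 n (?f u) (?f v) (?f w)" for u v w
      unfolding S_T0[symmetric] S_def PJ[symmetric] using inv(3) by simp
    then show ?thesis
      by (rule F.acts_via_rho_SpU1[OF refl n inv(1)[rule_format] PJ])
  qed
  show ?thesis
    using m frame EHV hol S_T0 unfolding x_def by blast
qed

lemma torsion_reduction:
  shows "\<exists>n. m = 2 * n \<and>
    (\<exists>S l. holonomy_reduction A g J \<Gamma> H V n S \<and> l \<noteq> 0 \<and>
      (\<forall>c\<in>A. \<forall>x\<in>cimg c. \<forall>u v w.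
         complex_of_real (torsion3 g \<Gamma> c x u v w) = l * S c x u v w + cnj l * cnj (S c x u v w)))"
proof -
  obtain \<mu> where \<mu>: "\<forall>c\<in>A. \<forall>x\<in>cimg c. conf c x \<mu>" using conf_constant by blast
  obtain c p where c: "c \<in> A" "p \<in> cdom c" using chart_cover by (metis UNIV_I UN_E)
  have pos: "\<mu> > 0" by (rule conf_pos(1)[OF c(1) cmap_in[OF c(2)] \<mu>[rule_format, OF c(1) cmap_in[OF c(2)]]])
  obtain n where m: "m = 2 * n" using adapted_frame_at[OF \<mu> c] by blast
  have "holonomy_reduction A g J \<Gamma> H V n (S \<mu>)"
    unfolding holonomy_reduction_def Let_def
  proof (intro conjI allI ballI impI S_parallel)
    fix p c assume c: "c \<in> A" "p \<in> cdom c"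
    obtain n' E where n': "m = 2 * n'" and E: "unitary_frame (g c (cmap c p)) (J c (cmap c p)) (2 * n' + 1) E \<and>
      (\<forall>k<2 * n'. E k \<in> H c (cmap c p)) \<and> E (2 * n') \<in> V c (cmap c p) \<and>
      (\<forall>P \<in> holonomy_group A \<Gamma> p c. acts_via (g c (cmap c p)) (J c (cmap c p)) (2 * n' + 1) E (rho_SpU1 n') P) \<and>
      (\<forall>u v w. S \<mu> c (cmap c p) u v w = T0 n' (frame_coords (g c (cmap c p)) (J c (cmap c p)) (2 * n' + 1) E u)
       (frame_coords (g c (cmap c p)) (J c (cmap c p)) (2 * n' + 1) E v)
       (frame_coords (g c (cmap c p)) (J c (cmap c p)) (2 * n' + 1) E w))"
      using adapted_frame_at[OF \<mu> c] by blast
    \<comment> \<open>Frames at different points come with their own dimension, which the global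
      \<open>m\<close> fixes.\<close>
    have "n' = n" using m n' by simp
    then show "\<exists>E. unitary_frame (g c (cmap c p)) (J c (cmap c p)) (2 * n + 1) E \<and>
      (\<forall>k<2 * n. E k \<in> H c (cmap c p)) \<and> E (2 * n) \<in> V c (cmap c p) \<and>
      (\<forall>P \<in> holonomy_group A \<Gamma> p c. acts_via (g c (cmap c p)) (J c (cmap c p)) (2 * n + 1) E (rho_SpU1 n) P) \<and>
      (\<forall>u v w. S \<mu> c (cmap c p) u v w = T0 n (frame_coords (g c (cmap c p)) (J c (cmap c p)) (2 * n + 1) E u)
       (frame_coords (g c (cmap c p)) (J c (cmap c p)) (2 * n + 1) E v)
       (frame_coords (g c (cmap c p)) (J c (cmap c p)) (2 * n + 1) E w))"
      using E by blast
  qed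
  \<comment> \<open>The real part of \<open>S\<close> is the torsion divided by sqrt \<mu>, and
    adding the conjugate doubles it; hence the constant sqrt \<mu> / 2.\<close>
  moreover have "complex_of_real (sqrt \<mu> / 2) \<noteq> 0" using pos by simp
  moreover have "complex_of_real (torsion3 g \<Gamma> c x u v w)
      = complex_of_real (sqrt \<mu> / 2) * S \<mu> c x u v w + cnj (complex_of_real (sqrt \<mu> / 2)) * cnj (S \<mu> c x u v w)" for c x u v w
    using pos by (simp add: torsion3_eq S_def complex_eq_iff) (simp add: field_simps)
  ultimately show ?thesis using m by blast
qed

end

theorem proposition3p4:
  fixes A :: "('a::{t2_space, second_countable_topology}, 'e::euclidean_space) chart set"
    and g :: "('a, 'e) metric" and J :: "('a, 'e) endo_field"
    and \<Gamma> :: "('a, 'e) christoffel" and H V :: "('a, 'e) distribution" and m :: nat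
  assumes "hermitian_manifold A g J"
    and "DIM('e) = 2 * m + 2"
    and "bismut_connection A g J \<Gamma>"
    and "parallel_splitting A g J \<Gamma> m H V"
    and "torsion_type A g J \<Gamma> H V"
    and "nondegenerate_torsion A g \<Gamma>"
  shows "\<exists>n. m = 2 * n \<and>
    (\<exists>S l. holonomy_reduction A g J \<Gamma> H V n S \<and> l \<noteq> 0 \<and>
      (\<forall>c\<in>A. \<forall>x\<in>cimg c. \<forall>u v w.
         complex_of_real (torsion3 g \<Gamma> c x u v w) = l * S c x u v w + cnj l * cnj (S c x u v w)))"
proof -
  interpret bismut_splitting A g J \<Gamma> H V m using assms by unfold_locales
  show ?thesis by (rule torsion_reduction)
qed

end
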